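(* Let $\mathbb{K}$ be a field of characteristic $0$, let $A=A(\alpha,\beta,0)$ be a down-up algebra belonging to the family (F1), with the roots $r_1,r_2$ of $t^2-\alpha t-\beta$ in $\mathbb{K}$, labelled so that $r_1\neq0$, and let $w_1=\beta ud+r_1du\in A$. The Hilbert series (for the usual grading) of the Hochschild cohomology spaces are $$HH^0(A)(t)=1,\qquad HH^1(A)(t)=2,\qquad HH^2(A)(t)=\frac{1}{t^2}+2+\frac{t^2}{1-t^2},\qquad HH^3(A)(t)=\frac{1}{t^4(1-t^2)}.$$ Moreover, computing $HH^\bullet(A)$ with the complex $0\to A\to V^*\otimes A\to R^*\otimes A\to\Omega^*\otimes A\to0$ described in the context: (i) $HH^0(A)=\mathbb{K}$; (ii) the classes of the elements $D|d$ and $U|u$ form a basis of $HH^1(A)$; (iii) the classes of the elements of $\{D^2U|w_1^kd+DU^2|uw_1^k : k\ge0\}\cup\{D^2U|ud^2+DU^2|u^2d\}$ form a basis of $HH^2(A)$; (iv) the classes of the elements of $\{D^2U^2|w_1^j : j\ge0,\ j\neq2\}\cup\{D^2U^2|uw_1d\}$ form a basis of $HH^3(A)$.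
   Context: For a field $\mathbb{K}$ of characteristic $0$ and $\alpha,\beta\in\mathbb{K}$, the down-up algebra $A=A(\alpha,\beta,0)$ is the quotient of $\mathbb{K}\langle u,d\rangle$ by the relations $d^2u=\alpha dud+\beta ud^2$ and $du^2=\alpha udu+\beta u^2d$. It is graded by the usual grading ($u,d$ of degree $1$). Family (F1): $(\alpha,\beta)\neq(0,0)$ and, with $r_1,r_2$ the roots of $t^2-\alpha t-\beta$, $r_1^ir_2^j\neq1$ for all $i$ and $j$ such that $(i,j)\neq(0,0)$. Let $V=\mathrm{span}\{d,u\}$, $R=\mathrm{span}\{d^2u,du^2\}\subset V^{\otimes3}$, $\Omega=\mathrm{span}\{d^2u^2\}\subset V^{\otimes4}$; let $\{D,U\}$, $\{D^2U,DU^2\}$, $\{D^2U^2\}$ be the dual bases of $V^*,R^*,\Omega^*$. Write $X|a$ for $X\otimes a$. The Hochschild cohomology $HH^\bullet(A)=\mathrm{Ext}^\bullet_{A\otimes A^{op}}(A,A)$ is the cohomology of the complex $$0\to A\xrightarrow{d_0^*}V^*\otimes A\xrightarrow{d_1^*}R^*\otimes A\xrightarrow{d_2^*}\Omega^*\otimes A\to0,$$ with $d_0^*(a)=U|(ua-au)+D|(da-ad)$; $d_1^*(x)=D^2U|\Delta_1(x)+DU^2|\Delta_2(x)$, where for $x=U|a+D|a'$, $\Delta_1(x)=d^2a+a'du+da'u-\alpha(dad+a'ud+dua')-\beta(ad^2+ua'd+uda')$ and $\Delta_2(x)=dau+dua+a'u^2-\alpha(adu+uda+ua'u)-\beta(aud+uad+u^2a')$;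 and $d_2^*(D^2U|a+DU^2|a')=D^2U^2|(da'+\beta a'd-au-\beta ua)$. Giving $D,U$ degree $-1$ (so $D^2U,DU^2$ have degree $-3$ and $D^2U^2$ has degree $-4$), all differentials have degree $0$, and $HH^i(A)(t)=\sum_{m\in\mathbb{Z}}\dim_{\mathbb{K}}(HH^i(A)_m)\,t^m$.
   Formalization: In (F1) the exponents i, j are read as arbitrary integers and both roots are required to be nonzero (β ≠ 0); for β = 0 the claim fails, e.g. for α = 2, β = 0 the space HH^3 has dimension 3 in degree 0 instead of 1. *)

theory Defs
  imports
    "HOL-Library.Poly_Mapping"
    "HOL-Algebra.QuotRing"
    "HOL-Computational_Algebra.Formal_Laurent_Series"
    "Jordan_Normal_Form.VS_Connect"
begin

hide_const (open) Multiset.mult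

section \<open>Free algebra on two generators and quotient modules\<close>

datatype gen = Dn | Up

text \<open>The free monoid on \<open>d\<close> and \<open>u\<close>, written additively so that
  \<open>word \<Rightarrow>\<^sub>0 'k\<close> with its convolution product is the free algebra.\<close>

datatype word = Word (letters: "gen list")

instantiation word :: monoid_add
begin
definition zero_word :: word where "0 = Word []"
definition plus_word :: "word \<Rightarrow> word \<Rightarrow> word" where "v + w = Word (letters v @ letters w)"
instance by standard (simp_all add: zero_word_def plus_word_def)
end

definition free_algebra :: "('k::field, word \<Rightarrow>\<^sub>0 'k) module" where
  "free_algebra =
    \<lparr>carrier = UNIV, mult = (*), one = 1, zero = 0, add = (+),
     smult = (\<lambda>c. Poly_Mapping.map ((*) c))\<rparr>"

definition monom_word :: "gen list \<Rightarrow> (word \<Rightarrow>\<^sub>0 'k::field)" where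
  "monom_word w = Poly_Mapping.single (Word w) 1"

text \<open>\<open>M Quot N\<close> together with the induced scalar multiplication. For a two-sided ideal \<open>N\<close> of an
  algebra this is the quotient algebra; for a submodule \<open>N\<close> of a bare module only the additive
  structure and the scalar multiplication are meaningful.\<close>

definition quot_module :: "('k, 'a) module \<Rightarrow> 'a set \<Rightarrow> ('k, 'a set) module" where
  "quot_module M N = ring.extend (M Quot N)
     (module.fields (\<lambda>c X. \<Union>x\<in>X. N +>\<^bsub>M\<^esub> (c \<odot>\<^bsub>M\<^esub> x)))"

section \<open>The down-up algebra \<open>A(\<alpha>,\<beta>,0)\<close>\<close>

context
  fixes \<alpha> \<beta> :: "'k::field"
begin

definition down_up_ideal :: "(word \<Rightarrow>\<^sub>0 'k) set" where
  "down_up_ideal = genideal free_algebra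
     (let m = monom_word; c = (\<lambda>k. Poly_Mapping.single 0 k) in
      {m [Dn, Dn, Up] - (c \<alpha> * m [Dn, Up, Dn] + c \<beta> * m [Up, Dn, Dn]),
       m [Dn, Up, Up] - (c \<alpha> * m [Up, Dn, Up] + c \<beta> * m [Up, Up, Dn])})"

definition down_up :: "('k, (word \<Rightarrow>\<^sub>0 'k) set) module" where
  "down_up = quot_module free_algebra down_up_ideal"

definition du_d :: "(word \<Rightarrow>\<^sub>0 'k) set" where
  "du_d = down_up_ideal +>\<^bsub>free_algebra\<^esub> monom_word [Dn]"

definition du_u :: "(word \<Rightarrow>\<^sub>0 'k) set" where
  "du_u = down_up_ideal +>\<^bsub>free_algebra\<^esub> monom_word [Up]"

text \<open>The component of degree \<open>m\<close> for the usual grading (zero for \<open>m < 0\<close>).\<close>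

definition du_deg :: "int \<Rightarrow> (word \<Rightarrow>\<^sub>0 'k) set set" where
  "du_deg m = {down_up_ideal +>\<^bsub>free_algebra\<^esub> p | p.
     \<forall>w \<in> Poly_Mapping.keys p. int (length (letters w)) = m}"

end

text \<open>\<open>r\<^sub>1\<close> and \<open>r\<^sub>2\<close> are the roots of \<open>t\<^sup>2 - \<alpha>t - \<beta>\<close>, counted with multiplicity. The exponents range
  over all integers, so the powers only make sense when both roots are nonzero, that is
  \<open>\<beta> \<noteq> 0\<close>. This has to be said explicitly, as \<open>powi\<close> returns \<open>0\<close> for negative powers of \<open>0\<close>, so that the condition on
  the powers alone would not exclude \<open>\<beta> = 0\<close>.\<close>

definition family_F1 :: "'k::field \<Rightarrow> 'k \<Rightarrow> 'k \<Rightarrow> 'k \<Rightarrow> bool" where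
  "family_F1 \<alpha> \<beta> r1 r2 \<longleftrightarrow>
     (\<alpha>, \<beta>) \<noteq> (0, 0) \<and>
     [:- \<beta>, - \<alpha>, 1:] = [:- r1, 1:] * [:- r2, 1:] \<and>
     r1 \<noteq> 0 \<and> r2 \<noteq> 0 \<and>
     (\<forall>i j :: int. (i, j) \<noteq> (0, 0) \<longrightarrow> r1 powi i * r2 powi j \<noteq> 1)"

section \<open>The complex computing Hochschild cohomology\<close>

text \<open>The four spaces \<open>K\<close>, \<open>V\<^sup>*\<close>, \<open>R\<^sup>*\<close>, \<open>\<Omega>\<^sup>*\<close> have dual bases indexed by the words below. An element
  of the tensor product of such a space with \<open>A\<close> is encoded by its coefficient function, which
  maps each of these words to an element of \<open>A\<close> and every other word to zero.\<close>

definition dual_words :: "nat \<Rightarrow> gen list set" where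
  "dual_words n =
    (if n = 0 then {[]}
     else if n = 1 then {[Dn], [Up]}
     else if n = 2 then {[Dn, Dn, Up], [Dn, Up, Up]}
     else if n = 3 then {[Dn, Dn, Up, Up]}
     else {})"

text \<open>\<open>W \<parallel> a\<close> is the tensor \<open>W|a\<close>, the word \<open>W\<close> standing for the dual basis element.\<close>

definition tensor :: "('a, 'm) ring_scheme \<Rightarrow> gen list \<Rightarrow> 'a \<Rightarrow> (gen list \<Rightarrow> 'a)"
    (infix \<open>\<parallel>\<index>\<close> 67) where
  "W \<parallel>\<^bsub>A\<^esub> a = (\<lambda>W'. if W' = W then a else \<zero>\<^bsub>A\<^esub>)"

text \<open>Only the module structure of the cochains is used; they carry no product.\<close>

definition cochains :: "('k, 'a) module \<Rightarrow> nat \<Rightarrow> ('k, gen list \<Rightarrow> 'a) module" where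
  "cochains A n =
    \<lparr>carrier = {f. (\<forall>W \<in> dual_words n. f W \<in> carrier A) \<and> (\<forall>W. W \<notin> dual_words n \<longrightarrow> f W = \<zero>\<^bsub>A\<^esub>)},
     mult = undefined, one = undefined,
     zero = (\<lambda>W. \<zero>\<^bsub>A\<^esub>),
     add = (\<lambda>f g W. f W \<oplus>\<^bsub>A\<^esub> g W),
     smult = (\<lambda>c f W. c \<odot>\<^bsub>A\<^esub> f W)\<rparr>"

context
  fixes A :: "('k, 'a) module" (structure)
    and \<alpha> \<beta> :: 'k
    and d u :: 'a
begin

definition diff0 :: "'a \<Rightarrow> (gen list \<Rightarrow> 'a)" where
  "diff0 a = ([Up] \<parallel> (u \<otimes> a \<ominus> a \<otimes> u)) \<oplus>\<^bsub>cochains A 1\<^esub> ([Dn] \<parallel> (d \<otimes> a \<ominus> a \<otimes> d))"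

text \<open>\<open>\<Delta>\<^sub>1\<close> and \<open>\<Delta>\<^sub>2\<close> evaluated at \<open>U|a + D|a'\<close>.\<close>

definition Delta1 :: "'a \<Rightarrow> 'a \<Rightarrow> 'a" where
  "Delta1 a a' =
     (d \<otimes> d \<otimes> a \<oplus> a' \<otimes> d \<otimes> u \<oplus> d \<otimes> a' \<otimes> u)
     \<ominus> \<alpha> \<odot> (d \<otimes> a \<otimes> d \<oplus> a' \<otimes> u \<otimes> d \<oplus> d \<otimes> u \<otimes> a')
     \<ominus> \<beta> \<odot> (a \<otimes> d \<otimes> d \<oplus> u \<otimes> a' \<otimes> d \<oplus> u \<otimes> d \<otimes> a')"

definition Delta2 :: "'a \<Rightarrow> 'a \<Rightarrow> 'a" where
  "Delta2 a a' =
     (d \<otimes> a \<otimes> u \<oplus> d \<otimes> u \<otimes> a \<oplus> a' \<otimes> u \<otimes> u)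
     \<ominus> \<alpha> \<odot> (a \<otimes> d \<otimes> u \<oplus> u \<otimes> d \<otimes> a \<oplus> u \<otimes> a' \<otimes> u)
     \<ominus> \<beta> \<odot> (a \<otimes> u \<otimes> d \<oplus> u \<otimes> a \<otimes> d \<oplus> u \<otimes> u \<otimes> a')"

definition diff1 :: "'a \<Rightarrow> 'a \<Rightarrow> (gen list \<Rightarrow> 'a)" where
  "diff1 a a' = ([Dn, Dn, Up] \<parallel> Delta1 a a') \<oplus>\<^bsub>cochains A 2\<^esub> ([Dn, Up, Up] \<parallel> Delta2 a a')"

definition diff2 :: "'a \<Rightarrow> 'a \<Rightarrow> (gen list \<Rightarrow> 'a)" where
  "diff2 a a' =
     [Dn, Dn, Up, Up] \<parallel> (d \<otimes> a' \<oplus> \<beta> \<odot> (a' \<otimes> d) \<ominus> a \<otimes> u \<ominus> \<beta> \<odot> (u \<otimes> a))"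

definition differential :: "nat \<Rightarrow> (gen list \<Rightarrow> 'a) \<Rightarrow> (gen list \<Rightarrow> 'a)" where
  "differential n f =
    (if n = 0 then diff0 (f [])
     else if n = 1 then diff1 (f [Up]) (f [Dn])
     else if n = 2 then diff2 (f [Dn, Dn, Up]) (f [Dn, Up, Up])
     else (\<lambda>W. \<zero>))"

end

section \<open>Hochschild cohomology of the down-up algebra\<close>

context
  fixes \<alpha> \<beta> :: "'k::field"
begin

abbreviation du_cochains :: "nat \<Rightarrow> ('k, gen list \<Rightarrow> (word \<Rightarrow>\<^sub>0 'k) set) module" where
  "du_cochains \<equiv> cochains (down_up \<alpha> \<beta>)"

abbreviation du_differential ::
    "nat \<Rightarrow> (gen list \<Rightarrow> (word \<Rightarrow>\<^sub>0 'k) set) \<Rightarrow> (gen list \<Rightarrow> (word \<Rightarrow>\<^sub>0 'k) set)" where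
  "du_differential \<equiv> differential (down_up \<alpha> \<beta>) \<alpha> \<beta> (du_d \<alpha> \<beta>) (du_u \<alpha> \<beta>)"

definition cocycles :: "nat \<Rightarrow> (gen list \<Rightarrow> (word \<Rightarrow>\<^sub>0 'k) set) set" where
  "cocycles n = {f \<in> carrier (du_cochains n).
     du_differential n f = \<zero>\<^bsub>du_cochains (Suc n)\<^esub>}"

definition coboundaries :: "nat \<Rightarrow> (gen list \<Rightarrow> (word \<Rightarrow>\<^sub>0 'k) set) set" where
  "coboundaries n = (case n of
      0 \<Rightarrow> {\<zero>\<^bsub>du_cochains 0\<^esub>}
    | Suc k \<Rightarrow> du_differential k ` carrier (du_cochains k))"

definition HH :: "nat \<Rightarrow> ('k, (gen list \<Rightarrow> (word \<Rightarrow>\<^sub>0 'k) set) set) module" where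
  "HH n = quot_module (du_cochains n \<lparr>carrier := cocycles n\<rparr>) (coboundaries n)"

definition HH_class ::
    "nat \<Rightarrow> (gen list \<Rightarrow> (word \<Rightarrow>\<^sub>0 'k) set) \<Rightarrow> (gen list \<Rightarrow> (word \<Rightarrow>\<^sub>0 'k) set) set" where
  "HH_class n f = coboundaries n +>\<^bsub>du_cochains n\<^esub> f"

text \<open>The dual basis element indexed by \<open>W\<close> has degree minus the length of \<open>W\<close>, so \<open>W|a\<close> has
  degree \<open>m\<close> iff \<open>a\<close> has degree \<open>m + length W\<close>.\<close>

definition HH_deg :: "nat \<Rightarrow> int \<Rightarrow> ('k, (gen list \<Rightarrow> (word \<Rightarrow>\<^sub>0 'k) set) set) module" where
  "HH_deg n m = HH n \<lparr>carrier := HH_class n `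
     {f \<in> cocycles n. \<forall>W \<in> dual_words n. f W \<in> du_deg \<alpha> \<beta> (m + int (length W))}\<rparr>"

text \<open>The elements of \<open>E\<close> are cocycles, their classes are pairwise distinct, and these classes form
  a basis.\<close>

definition classes_form_basis :: "nat \<Rightarrow> (gen list \<Rightarrow> (word \<Rightarrow>\<^sub>0 'k) set) set \<Rightarrow> bool" where
  "classes_form_basis n E \<longleftrightarrow>
     E \<subseteq> cocycles n \<and> inj_on (HH_class n) E \<and>
     vectorspace.basis class_ring (HH n) (HH_class n ` E)"

end

text \<open>\<open>F\<close> is the Laurent series with coefficients \<open>dim (V m)\<close>, all of these being finite.\<close>

definition has_hilbert_series :: "(int \<Rightarrow> ('k::field, 'v) module) \<Rightarrow> rat fls \<Rightarrow> bool" where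
  "has_hilbert_series V F \<longleftrightarrow>
     (\<forall>m. vectorspace.fin_dim class_ring (V m) \<and>
          fls_nth F m = of_nat (vectorspace.dim class_ring (V m)))"

end

(*
  With \<sigma> the automorphism x \<mapsto> r1 x, y \<mapsto> r2 y of K[x, y] and c = (x - y) / (r1 - r2), the algebra A is
  a generalized Weyl algebra over K[x, y]: x and y are the classes of w1 and of its analogue w2 for r2,
  and d f = \<sigma>(f) d, f u = u \<sigma>(f), du = c, ud = \<sigma>^-1(c).  So A is free over K[x, y] on the elements
  v_n, equal to d^n for n \<ge> 0 and to u^-n for n < 0, and the complex splits along the weight n.

  For n > 0 everything is decided by which eigenvalues of \<sigma> - 1, (\<sigma> - r1)(\<sigma> - r2) and \<sigma> + \<beta> vanish on
  the monomials; by (F1) these are 1, then x and y, then xy, and the complex turns out to be exact.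
  The anti-automorphism exchanging d and u carries weight n to weight -n.

  In weight 0 the complex becomes K[x, y] \<rightarrow> K[x, y]^2 \<rightarrow> K[x, y]^2 \<rightarrow> K[x, y], and HH^2 and HH^3 are the quotients
  of K[x, y] by P(c K[x, y]), where P = \<sigma> - \<alpha> - \<beta> \<sigma>^-1 in degree 2 and P = 1 + \<beta> \<sigma>^-1 in degree 3.
  Both operators are diagonal on monomials, and the ideal generated by c is the kernel of the
  restriction to x = y, so the powers of x represent the quotient up to the monomials killed by P.
*)
theory Submission
  imports Defs "HOL-Library.Product_Plus"
begin

section \<open>Polynomials in two variables\<close>

text \<open>The complex uses only multiplication by d and u on either side, so no product on normal
  forms is built: four operators on families of polynomials suffice. The delicate point of the
  normal form is that the v_n are independent over K[x, y]. It is obtained by letting the free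
  algebra act through these operators, which satisfy both relations; that the v_n span comes from
  rewriting words modulo the ideal.

  In weight n > 0, dividing by the nonzero eigenvalues leaves a complex of dimensions 1, 3, 3, 1 on
  the exceptional monomials 1; then 1, x, y; then x, y, xy; then xy. The entries that matter are
  nonzero multiples of r1^n - 1 and r2^n - 1, so (F1) enters a second time.

  The two lists of representatives differ in shape because of weight 0. In degree 2, P kills x and
  y, hence c itself: x stays a class, and y adds another one, represented through u d^2. In degree
  3, P kills xy, so P(c x) is a nonzero multiple of x^2: w1^2 becomes a coboundary, and xy
  contributes the class of u w1 d instead.\<close>

text \<open>The coefficient of \<open>x\<^sup>i y\<^sup>j\<close>: the outer variable is \<open>y\<close>, the inner one is \<open>x\<close>.\<close>

definition co :: "'a::zero poly poly \<Rightarrow> nat \<Rightarrow> nat \<Rightarrow> 'a" where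
  "co f i j = coeff (coeff f j) i"

lemma poly2_eqI: "(\<And>i j. co f i j = co g i j) \<Longrightarrow> f = g"
  by (intro poly_eqI) (simp add: co_def)

lemma co_simps [simp]:
  "co 0 i j = 0" "co (f + g) i j = co f i j + co g i j"
  "co (f' - g') i j = co f' i j - co g' i j" "co (- f') i j = - co f' i j"
  for f g :: "'a::comm_monoid_add poly poly" and f' g' :: "'b::ab_group_add poly poly"
  by (simp_all add: co_def)

definition const2 :: "'a::zero \<Rightarrow> 'a poly poly" where "const2 a = [:[:a:]:]"

definition lin :: "'a::zero \<Rightarrow> 'a \<Rightarrow> 'a poly poly" where "lin p q = [:[:0, p:], [:q:]:]"

definition quad :: "'a::comm_semiring_1 \<Rightarrow> 'a \<Rightarrow> 'a \<Rightarrow> 'a poly poly" where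
  "quad p q r = [:[:0, 0, p:], [:0, q:], [:r:]:]"

lemma co_const2: "co (const2 a) i j = (if i = 0 \<and> j = 0 then a else 0)"
  by (simp add: co_def const2_def coeff_pCons split: nat.split)

lemma co_const2_mult [simp]: "co (const2 a * f) i j = a * co f i j"
  for a :: "'a::comm_semiring_1"
  by (simp add: co_def const2_def)

lemma const2_hom:
  "const2 0 = 0" "const2 1 = 1" "const2 (a + b) = const2 a + const2 b"
  "const2 (a * b) = const2 a * const2 b" "const2 (a - b) = const2 a - const2 b"
  "const2 (- a) = - const2 a"
  for a b :: "'a::comm_ring_1"
  by (simp_all add: const2_def one_pCons)

lemma co_lin: "co (lin p q) i j = (if i = 1 \<and> j = 0 then p else if i = 0 \<and> j = 1 then q else 0)"
  by (simp add: co_def lin_def coeff_pCons split: nat.split)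

lemma co_quad: "co (quad p q r) i j = (if i = 2 \<and> j = 0 then p else if i = 1 \<and> j = 1 then q
    else if i = 0 \<and> j = 2 then r else 0)"
  by (auto simp add: co_def quad_def coeff_pCons split: nat.split)

lemma co_lin_mult:
  "co (lin p q * f) i j = (if i = 0 then 0 else p * co f (i - 1) j) + (if j = 0 then 0 else q * co f i (j - 1))"
  for p :: "'a::comm_semiring_1"
  by (cases i; cases j) (simp_all add: co_def lin_def)

lemma lin_mult_lin: "lin p q * lin p' q' = quad (p * p') (p * q' + q * p') (q * q')"
  for p :: "'a::comm_semiring_1"
  by (simp add: lin_def quad_def add.commute)

text \<open>Powers of sigma, the eigenvalue operators, their partial inverses and the projection to
  a total degree are all diagonal on monomials, so one construction with an arbitrary eigenvalue
  function serves them all.\<close>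

definition diag :: "(nat \<Rightarrow> nat \<Rightarrow> 'a) \<Rightarrow> 'a::comm_ring_1 poly poly \<Rightarrow> 'a poly poly" where
  "diag e f = Abs_poly (\<lambda>j. Abs_poly (\<lambda>i. e i j * co f i j))"

lemma co_diag [simp]: "co (diag e f) i j = e i j * co f i j"
proof -
  have *: "coeff (Abs_poly (\<lambda>i. e i j * co f i j)) = (\<lambda>i. e i j * co f i j)" for j
    by (rule coeff_Abs_poly[of "degree (coeff f j)"]) (simp add: co_def coeff_eq_0)
  have "coeff (diag e f) = (\<lambda>j. Abs_poly (\<lambda>i. e i j * co f i j))"
    unfolding diag_def
  proof (rule coeff_Abs_poly[of "degree f"])
    fix j assume "degree f < j"
    then have "e i j * co f i j = 0" for i
      by (simp add: co_def coeff_eq_0)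
    then show "Abs_poly (\<lambda>i. e i j * co f i j) = 0"
      by (intro poly_eqI) (simp add: coeff_Abs_poly[of 0])
  qed
  then show ?thesis
    by (simp add: co_def[of "diag e f"] *)
qed

lemma diag_0 [simp]: "diag e 0 = 0"
  and diag_add: "diag e (f + g) = diag e f + diag e g"
  and diag_diff: "diag e (f - g) = diag e f - diag e g"
  and diag_minus: "diag e (- f) = - diag e f"
  and diag_const2_mult: "diag e (const2 a * f) = const2 a * diag e f"
  by (rule poly2_eqI; simp add: distrib_left right_diff_distrib mult.left_commute mult.assoc)+

lemma co_mult: "co (f * g) i j = (\<Sum>j'\<le>j. \<Sum>i'\<le>i. co f i' j' * co g (i - i') (j - j'))"
  for f :: "'a::comm_ring_1 poly poly"
  by (simp add: co_def coeff_mult coeff_sum)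

text \<open>A multiplicative eigenvalue function passes through the convolution formula for
  coefficients term by term. This is what makes sigma a ring homomorphism.\<close>

lemma diag_mult:
  fixes f g :: "'a::comm_ring_1 poly poly"
  assumes "\<And>i j i' j'. e (i + i') (j + j') = e i j * e i' j'"
  shows "diag e (f * g) = diag e f * diag e g"
proof (rule poly2_eqI)
  fix i j
  have "e i j = e i' j' * e (i - i') (j - j')" if "i' \<le> i" "j' \<le> j" for i' j'
    using assms[of i' "i - i'" j' "j - j'"] that by simp
  then show "co (diag e (f * g)) i j = co (diag e f * diag e g) i j"
    unfolding co_diag co_mult sum_distrib_left by (intro sum.cong refl) simp
qed

text \<open>A sum over coefficients rather than an evaluation homomorphism: \<open>Nf\<close>
  substitutes for x and y elements of the free algebra, where they do not commute.\<close>

definition psum :: "(nat \<Rightarrow> 'a::zero \<Rightarrow> 'b::comm_monoid_add) \<Rightarrow> 'a poly \<Rightarrow> 'b" where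
  "psum h f = (\<Sum>j\<le>Polynomial.degree f. h j (coeff f j))"

lemma psum_ge:
  assumes "\<And>j. h j 0 = 0" "Polynomial.degree f \<le> n"
  shows "psum h f = (\<Sum>j\<le>n. h j (coeff f j))"
  unfolding psum_def using assms by (intro sum.mono_neutral_left) (auto simp: coeff_eq_0)

lemma psum_add:
  assumes "\<And>j. h j 0 = 0" "\<And>j a b. h j (a + b) = h j a + h j b"
  shows "psum h (f + g) = psum h f + psum h g"
proof -
  let ?n = "max (Polynomial.degree f) (Polynomial.degree g)"
  have "psum h (f + g) = (\<Sum>j\<le>?n. h j (coeff (f + g) j))"
    using assms by (intro psum_ge degree_add_le) auto
  moreover have "psum h f = (\<Sum>j\<le>?n. h j (coeff f j))" "psum h g = (\<Sum>j\<le>?n. h j (coeff g j))"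
    using assms by (intro psum_ge; simp)+
  ultimately show ?thesis
    using assms by (simp add: sum.distrib)
qed

lemma psum_monom:
  assumes "\<And>j. h j 0 = 0"
  shows "psum h (Polynomial.monom a j) = h j a"
proof -
  have "psum h (Polynomial.monom a j) = (\<Sum>i\<le>j. h i (coeff (Polynomial.monom a j) i))"
    using assms by (intro psum_ge degree_monom_le)
  also have "\<dots> = (\<Sum>i\<le>j. if i = j then h j a else 0)"
    using assms by (intro sum.cong) auto
  finally show ?thesis by simp
qed

lemma poly2_induct:
  assumes "\<And>a i j. P (Polynomial.monom (Polynomial.monom a i) j)" "\<And>f g. P f \<Longrightarrow> P g \<Longrightarrow> P (f + g)"
  shows "P f"
proof -
  have P0: "P 0" using assms(1)[of 0 0 0] by simp
  have sumP: "P (\<Sum>j\<in>A. F j)" if "finite A" "\<And>j. P (F j)" for A :: "nat set" and F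
    using that by (induction A) (auto intro: P0 assms(2))
  have "P (Polynomial.monom q j)" for q j
  proof -
    have "Polynomial.monom q j = Polynomial.monom (\<Sum>i\<le>Polynomial.degree q. Polynomial.monom (coeff q i) i) j"
      by (simp add: poly_as_sum_of_monoms)
    also have "\<dots> = (\<Sum>i\<le>Polynomial.degree q. Polynomial.monom (Polynomial.monom (coeff q i) i) j)"
      by (rule Polynomial.monom_sum)
    finally show ?thesis using sumP[OF finite_atMost assms(1)] by simp
  qed
  then show ?thesis
    using sumP[of "{..Polynomial.degree f}"] by (subst poly_as_sum_of_monoms[of f, symmetric]) simp
qed

lemma co_monom: "co (Polynomial.monom (Polynomial.monom a i') j') i j = (if i = i' \<and> j = j' then a else 0)"
  by (simp add: co_def)

text \<open>Restriction to \<open>x = y\<close>.\<close>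

definition ediag :: "'a::comm_ring_1 poly poly \<Rightarrow> 'a poly" where "ediag f = poly f [:0, 1:]"

lemma ediag_simps [simp]:
  "ediag 0 = 0" "ediag (f + g) = ediag f + ediag g" "ediag (f - g) = ediag f - ediag g"
  "ediag (f * g) = ediag f * ediag g" "ediag [:q:] = q"
  "ediag (lin a b) = [:0, a + b:]" "ediag (quad a b c) = [:0, 0, a + b + c:]"
  by (simp_all add: ediag_def lin_def quad_def)

text \<open>The factor theorem for polynomials in y over the ring of polynomials in x, with root x;
  the sign only turns y - x into x - y.\<close>

lemma ediag_eq_0_iff: "ediag f = 0 \<longleftrightarrow> (\<exists>g. f = lin 1 (-1) * g)"
  for f :: "'a::idom poly poly"
proof
  assume "ediag f = 0"
  then have "[:- [:0, 1:], 1:] dvd f" by (simp add: ediag_def poly_eq_0_iff_dvd)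
  then obtain g where "f = [:- [:0, 1:], 1:] * g" by blast
  also have "[:- [:0, 1:], 1:] = - lin 1 (-1 :: 'a)" by (simp add: lin_def one_pCons)
  also have "- lin 1 (-1) * g = lin 1 (-1) * (- g)" by simp
  finally show "\<exists>g. f = lin 1 (-1) * g" by blast
qed auto

section \<open>The weight components of the complex\<close>

locale F1 =
  fixes \<alpha> \<beta> r1 r2 :: "'k::field_char_0"
  assumes F1: "family_F1 \<alpha> \<beta> r1 r2"
begin

lemma alpha: "\<alpha> = r1 + r2" and beta: "\<beta> = - (r1 * r2)"
proof -
  have "[:- \<beta>, - \<alpha>, 1:] = [:- r1, 1:] * [:- r2, 1:]"
    using F1 by (simp add: family_F1_def)
  then have *: "- \<beta> = r1 * r2" "- \<alpha> = - r1 - r2" by simp_all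
  show "\<alpha> = r1 + r2" using *(2) by (metis minus_diff_eq minus_minus diff_minus_eq_add add.commute)
  show "\<beta> = - (r1 * r2)" using *(1) by (metis minus_minus)
qed

lemma r_nz [simp]: "r1 \<noteq> 0" "r2 \<noteq> 0"
  using F1 by (simp_all add: family_F1_def)

lemma powi_ne_1: "i \<noteq> 0 \<or> j \<noteq> 0 \<Longrightarrow> r1 powi i * r2 powi j \<noteq> 1"
  using F1 by (auto simp: family_F1_def)

lemma r1_powi_ne_1: "i \<noteq> 0 \<Longrightarrow> r1 powi i \<noteq> 1" and r2_powi_ne_1: "i \<noteq> 0 \<Longrightarrow> r2 powi i \<noteq> 1"
  using powi_ne_1[of i 0] powi_ne_1[of 0 i] by simp_all

section \<open>The automorphism sigma, its eigenvalues and the element c\<close>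

definition ev :: "nat \<Rightarrow> nat \<Rightarrow> 'k" where "ev i j = r1 ^ i * r2 ^ j"

lemma ev_nz [simp]: "ev i j \<noteq> 0" by (simp add: ev_def)

text \<open>Condition (F1) applied to differences of exponents. Hence the zeros of an expression
  built from factors \<open>ev i j - ev i' j'\<close> can be read off from the exponents
  alone.\<close>

lemma ev_inj: "ev i j = ev i' j' \<longleftrightarrow> i = i' \<and> j = j'"
proof
  assume "ev i j = ev i' j'"
  then have "r1 powi (int i - int i') * r2 powi (int j - int j') = 1"
    by (simp add: ev_def power_int_diff field_simps)
  then show "i = i' \<and> j = j'" using powi_ne_1[of "int i - int i'" "int j - int j'"] by auto
qed auto

lemma ev_simps: "ev 0 0 = 1" "ev 1 0 = r1" "ev 0 1 = r2" "ev 1 1 = - \<beta>"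
  by (simp_all add: ev_def beta)

lemma r1_ne_r2: "r1 \<noteq> r2" using powi_ne_1[of 1 "-1"] by auto

definition sg :: "int \<Rightarrow> 'k poly poly \<Rightarrow> 'k poly poly" where
  "sg n = diag (\<lambda>i j. (r1 powi n) ^ i * (r2 powi n) ^ j)"

lemma co_sg [simp]: "co (sg n f) i j = (r1 powi n) ^ i * (r2 powi n) ^ j * co f i j"
  by (simp add: sg_def)

lemma co_sg_1: "co (sg 1 f) i j = ev i j * co f i j" and co_sg_m1: "co (sg (-1) f) i j = co f i j / ev i j"
  by (simp_all add: ev_def field_simps)

lemma sg_0 [simp]: "sg n 0 = 0"
  and sg_add: "sg n (f + g) = sg n f + sg n g"
  and sg_diff: "sg n (f - g) = sg n f - sg n g"
  and sg_minus: "sg n (- f) = - sg n f"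
  by (simp_all add: sg_def diag_add diag_diff diag_minus)

lemma sg_mult: "sg n (f * g) = sg n f * sg n g"
  unfolding sg_def by (rule diag_mult) (simp add: power_add)

lemma sg_const2 [simp]: "sg n (const2 a) = const2 a"
  by (rule poly2_eqI) (simp add: co_const2)

lemma sg_lin [simp]: "sg n (lin p q) = lin (r1 powi n * p) (r2 powi n * q)"
  by (rule poly2_eqI) (simp add: co_lin)

lemma sg_sg [simp]: "sg m (sg n f) = sg (m + n) f"
  by (rule poly2_eqI) (simp add: power_int_add power_mult_distrib mult_ac)

lemma sg_zero_left [simp]: "sg 0 f = f"
  by (rule poly2_eqI) simp

lemmas sg_hom = sg_add sg_diff sg_minus sg_mult

definition kappa :: 'k where "kappa = inverse (r1 - r2)"

lemma kappa: "kappa * (r1 - r2) = 1" "kappa \<noteq> 0" using r1_ne_r2 by (simp_all add: kappa_def)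

definition cc :: "int \<Rightarrow> 'k poly poly" where "cc n = lin (kappa * r1 powi n) (- (kappa * r2 powi n))"

lemma sg_cc [simp]: "sg m (cc n) = cc (m + n)"
  by (simp add: cc_def power_int_add mult_ac)

text \<open>Powers of a root of t^2 - \<alpha> t - \<beta> satisfy this recursion, and
  \<open>cc\<close> combines the powers of both roots. The relations of the algebra come down to
  it.\<close>

lemma cc_rec: "cc (n + 2) = const2 \<alpha> * cc (n + 1) + const2 \<beta> * cc n"
  by (rule poly2_eqI)
    (auto simp: cc_def co_lin alpha beta power_int_add power2_eq_square algebra_simps)

lemma cc_0: "cc 0 = const2 kappa * lin 1 (-1)"
  by (rule poly2_eqI) (simp add: cc_def co_lin)

text \<open>If \<open>f v\<^sub>n\<close> is the element of weight \<open>n\<close> with coefficient \<open>f\<close>, these are the coefficients of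
  \<open>d f v\<^sub>n\<close>, \<open>f v\<^sub>n d\<close>, \<open>u f v\<^sub>n\<close> and \<open>f v\<^sub>n u\<close>; \<open>cc n\<close> is \<open>\<sigma>\<^sup>n(c)\<close>.\<close>

definition ld :: "int \<Rightarrow> 'k poly poly \<Rightarrow> 'k poly poly" where
  "ld n f = (if n \<ge> 0 then sg 1 f else cc 0 * sg 1 f)"
definition rd :: "int \<Rightarrow> 'k poly poly \<Rightarrow> 'k poly poly" where
  "rd n f = (if n \<ge> 0 then f else cc n * f)"
definition lu :: "int \<Rightarrow> 'k poly poly \<Rightarrow> 'k poly poly" where
  "lu n f = (if n \<le> 0 then sg (-1) f else sg (-1) (cc 0 * f))"
definition ru :: "int \<Rightarrow> 'k poly poly \<Rightarrow> 'k poly poly" where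
  "ru n f = (if n \<le> 0 then f else cc (n - 1) * f)"

lemmas ops_def = ld_def rd_def lu_def ru_def

lemma op_hom:
  "ld n 0 = 0" "rd n 0 = 0" "lu n 0 = 0" "ru n 0 = 0"
  "ld n (f + g) = ld n f + ld n g" "rd n (f + g) = rd n f + rd n g"
  "lu n (f + g) = lu n f + lu n g" "ru n (f + g) = ru n f + ru n g"
  "ld n (f - g) = ld n f - ld n g" "rd n (f - g) = rd n f - rd n g"
  "lu n (f - g) = lu n f - lu n g" "ru n (f - g) = ru n f - ru n g"
  "ld n (const2 a * f) = const2 a * ld n f" "rd n (const2 a * f) = const2 a * rd n f"
  "lu n (const2 a * f) = const2 a * lu n f" "ru n (const2 a * f) = const2 a * ru n f"
  by (simp_all add: ops_def sg_hom algebra_simps)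

text \<open>Associativity of a product t v t' with t and t' among d and u. Weights near 0 are
  separate cases, because there a multiplication may pass from cancelling a letter to lengthening
  v_n.\<close>

lemma op_commute:
  "rd (n + 1) (ld n f) = ld (n + 1) (rd n f)" 
  "ru (n + 1) (ld n f) = ld (n - 1) (ru n f)" 
  "rd (n - 1) (lu n f) = lu (n + 1) (rd n f)" 
  "ru (n - 1) (lu n f) = lu (n - 1) (ru n f)" 
proof -
  consider "n \<ge> 1" | "n = 0" | "n = -1" | "n \<le> -2" by linarith
  then show "rd (n + 1) (ld n f) = ld (n + 1) (rd n f)" "ru (n + 1) (ld n f) = ld (n - 1) (ru n f)"
    "rd (n - 1) (lu n f) = lu (n + 1) (rd n f)" "ru (n - 1) (lu n f) = lu (n - 1) (ru n f)"
    by (cases; simp add: ops_def sg_hom algebra_simps)+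
qed

lemma cc_1: "cc 1 = const2 \<alpha> * cc 0 + const2 \<beta> * cc (-1)"
  using cc_rec[of "-1"] by simp

lemma cc_0_rec: "cc 0 = const2 \<alpha> * cc (-1) + const2 \<beta> * cc (-2)"
  using cc_rec[of "-2"] by simp

lemma cc_suc: "cc (n + 1) = const2 \<alpha> * cc n + const2 \<beta> * cc (n - 1)"
  using cc_rec[of "n - 1"] by (simp add: add.commute)

lemma cc_n: "cc n = const2 \<alpha> * cc (n - 1) + const2 \<beta> * cc (n - 2)"
  using cc_rec[of "n - 2"] by simp

lemma cc_suc': "cc (1 + n) = const2 \<alpha> * cc n + const2 \<beta> * cc (n - 1)"
  using cc_suc[of n] by (simp add: add.commute)

lemma cc_2: "cc 2 = const2 \<alpha> * cc 1 + const2 \<beta> * cc 0"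
  using cc_rec[of 0] by simp

text \<open>The two relations of the algebra, for left and for right multiplication. Once the
  operators are expanded, what remains is the recursion for \<open>cc\<close>; weights near 0 are
  separate because the intermediate weights may cross 0.\<close>

lemma op_relations:
  "ld n (ld (n - 1) (lu n f)) = const2 \<alpha> * ld n (lu (n + 1) (ld n f)) + const2 \<beta> * lu (n + 2) (ld (n + 1) (ld n f))"
  "ld (n - 2) (lu (n - 1) (lu n f)) = const2 \<alpha> * lu n (ld (n - 1) (lu n f)) + const2 \<beta> * lu n (lu (n + 1) (ld n f))"
  "ru (n + 2) (rd (n + 1) (rd n f)) = const2 \<alpha> * rd n (ru (n + 1) (rd n f)) + const2 \<beta> * rd n (rd (n - 1) (ru n f))"
  "ru n (ru (n + 1) (rd n f)) = const2 \<alpha> * ru n (rd (n - 1) (ru n f)) + const2 \<beta> * rd (n - 2) (ru (n - 1) (ru n f))"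
proof -
  consider "n \<ge> 2" | "n = 1" | "n = 0" | "n = -1" | "n \<le> -2" by linarith
  then show "ld n (ld (n - 1) (lu n f)) = const2 \<alpha> * ld n (lu (n + 1) (ld n f)) + const2 \<beta> * lu (n + 2) (ld (n + 1) (ld n f))"
  "ld (n - 2) (lu (n - 1) (lu n f)) = const2 \<alpha> * lu n (ld (n - 1) (lu n f)) + const2 \<beta> * lu n (lu (n + 1) (ld n f))"
    by (cases; simp add: ops_def sg_hom cc_1; simp add: cc_0_rec algebra_simps)+
  consider "n \<ge> 2" | "n = 1" | "n = 0" | "n = -1" | "n \<le> -2" by linarith
  then show "ru (n + 2) (rd (n + 1) (rd n f)) = const2 \<alpha> * rd n (ru (n + 1) (rd n f)) + const2 \<beta> * rd n (rd (n - 1) (ru n f))"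
    by (cases; simp add: ops_def cc_suc cc_suc' cc_1 cc_2 cc_0_rec; simp add: algebra_simps)
  consider "n \<ge> 2" | "n = 1" | "n = 0" | "n = -1" | "n \<le> -2" by linarith
  then show "ru n (ru (n + 1) (rd n f)) = const2 \<alpha> * ru n (rd (n - 1) (ru n f)) + const2 \<beta> * rd (n - 2) (ru (n - 1) (ru n f))"
    by (cases; simp add: ops_def cc_n[of n] cc_1 cc_0_rec cc_rec[of "-3", simplified]; simp add: algebra_simps)
qed

text \<open>Here \<beta> sigma^-1(c) + r c equals x for r = r1 and y for r = r2, because \<beta> /
  r2 = - r1 and kappa = 1 / (r1 - r2). So the two variables act as w1 and w2.\<close>

lemma op_w1: "const2 \<beta> * lu (n + 1) (ld n f) + const2 r1 * ld (n - 1) (lu n f) = lin 1 0 * f"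
  and op_w2: "const2 \<beta> * lu (n + 1) (ld n f) + const2 r2 * ld (n - 1) (lu n f) = lin 0 1 * f"
proof -
  have 1: "const2 \<beta> * cc (-1) + const2 r1 * cc 0 = lin 1 0" "const2 \<beta> * cc (-1) + const2 r2 * cc 0 = lin 0 1"
    using kappa(1) by (auto intro!: poly2_eqI simp: cc_def co_lin beta field_simps) 
  have "const2 \<beta> * lu (n + 1) (ld n f) + const2 r * ld (n - 1) (lu n f) = (const2 \<beta> * cc (-1) + const2 r * cc 0) * f" for r
    by (simp add: ops_def sg_hom algebra_simps)
  then show "const2 \<beta> * lu (n + 1) (ld n f) + const2 r1 * ld (n - 1) (lu n f) = lin 1 0 * f"
    "const2 \<beta> * lu (n + 1) (ld n f) + const2 r2 * ld (n - 1) (lu n f) = lin 0 1 * f"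
    using 1 by simp_all
qed

text \<open>The differentials in weight \<open>n\<close>. An element \<open>U|a + D|a'\<close> of weight \<open>n\<close> has \<open>a\<close> of weight \<open>n - 1\<close> and
  \<open>a'\<close> of weight \<open>n + 1\<close>; an element \<open>D\<^sup>2U|a + DU\<^sup>2|a'\<close> of weight \<open>n\<close> has \<open>a\<close> of weight \<open>n + 1\<close> and \<open>a'\<close> of
  weight \<open>n - 1\<close>.\<close>

definition D0u where "D0u n f = lu n f - ru n f"
definition D0d where "D0d n f = ld n f - rd n f"

definition D1a where
  "D1a n g g' = ld n (ld (n - 1) g) + ru (n + 2) (rd (n + 1) g') + ru (n + 2) (ld (n + 1) g')
     - const2 \<alpha> * (rd n (ld (n - 1) g) + rd n (ru (n + 1) g') + ld n (lu (n + 1) g'))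
     - const2 \<beta> * (rd n (rd (n - 1) g) + rd n (lu (n + 1) g') + lu (n + 2) (ld (n + 1) g'))"

definition D1b where
  "D1b n g g' = ru n (ld (n - 1) g) + ld (n - 2) (lu (n - 1) g) + ru n (ru (n + 1) g')
     - const2 \<alpha> * (ru n (rd (n - 1) g) + lu n (ld (n - 1) g) + ru n (lu (n + 1) g'))
     - const2 \<beta> * (rd (n - 2) (ru (n - 1) g) + rd (n - 2) (lu (n - 1) g) + lu n (lu (n + 1) g'))"

definition D2 where
  "D2 n h h' = ld (n - 1) h' + const2 \<beta> * rd (n - 1) h' - ru (n + 1) h - const2 \<beta> * lu (n + 1) h"

lemmas D_def = D0u_def D0d_def D1a_def D1b_def D2_def

lemma D_zero [simp]: "D0u n 0 = 0" "D0d n 0 = 0" "D1a n 0 0 = 0" "D1b n 0 0 = 0" "D2 n 0 0 = 0"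
  by (simp_all add: D_def op_hom)

lemma D_diff:
  "D0u n (f - f') = D0u n f - D0u n f'" "D0d n (f - f') = D0d n f - D0d n f'"
  "D1a n (g - h) (g' - h') = D1a n g g' - D1a n h h'"
  "D1b n (g - h) (g' - h') = D1b n g g' - D1b n h h'"
  "D2 n (g - h) (g' - h') = D2 n g g' - D2 n h h'"
  by (simp_all add: D_def op_hom algebra_simps)

lemma D_add:
  "D0u n (f + f') = D0u n f + D0u n f'" "D0d n (f + f') = D0d n f + D0d n f'"
  "D1a n (g + h) (g' + h') = D1a n g g' + D1a n h h'"
  "D1b n (g + h) (g' + h') = D1b n g g' + D1b n h h'"
  "D2 n (g + h) (g' + h') = D2 n g g' + D2 n h h'"
  by (simp_all add: D_def op_hom algebra_simps)

text \<open>The anti-automorphism exchanging \<open>d\<close> and \<open>u\<close> reverses weights.\<close>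

lemma op_flip:
  "sg (- n - 1) (ld n f) = ru (- n) (sg (- n) f)" "sg (- n - 1) (rd n f) = lu (- n) (sg (- n) f)"
  "sg (1 - n) (lu n f) = rd (- n) (sg (- n) f)" "sg (1 - n) (ru n f) = ld (- n) (sg (- n) f)"
  by (auto simp: ops_def sg_hom minus_diff_commute)

text \<open>The anti-automorphism sends f v_n to v_{-n} f, whose coefficient is
  \<open>sg (- n) f\<close>. It reverses commutators, hence the signs, and exchanges the U and D
  components.\<close>

lemma D0_flip:
  "sg (1 - n) (D0u n f) = - D0d (- n) (sg (- n) f)" "sg (- n - 1) (D0d n f) = - D0u (- n) (sg (- n) f)"
  by (simp_all add: D_def sg_hom op_flip)

lemma op_flip':
  "sg m (ld n f) = ru (- n) (sg (- n) f)" "sg m (rd n f) = lu (- n) (sg (- n) f)" if "m = - n - 1"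
  using that op_flip by simp_all

lemma op_flip'':
  "sg m (lu n f) = rd (- n) (sg (- n) f)" "sg m (ru n f) = ld (- n) (sg (- n) f)" if "m = 1 - n"
  using that op_flip by simp_all

text \<open>Exchanging d and u while reversing words maps d^2 u to d u^2, so the two components
  trade places. \<open>op_commute\<close> then restores a common order of left and right
  multiplications.\<close>

lemma D1_flip:
  "sg (- n - 1) (D1a n g g') = D1b (- n) (sg (- n - 1) g') (sg (1 - n) g)"
  "sg (1 - n) (D1b n g g') = D1a (- n) (sg (- n - 1) g') (sg (1 - n) g)"
proof -
  have e: "- 1 - n = - n - 1" by simp
  show "sg (- n - 1) (D1a n g g') = D1b (- n) (sg (- n - 1) g') (sg (1 - n) g)"
    "sg (1 - n) (D1b n g g') = D1a (- n) (sg (- n - 1) g') (sg (1 - n) g)"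
    using op_commute[of "1 - n"] op_commute[of "- n - 1"]
    by (simp_all add: D_def sg_hom op_flip' op_flip'' algebra_simps e)
qed

lemma D2_flip: "sg (- n) (D2 n h h') = - D2 (- n) (sg (1 - n) h') (sg (- n - 1) h)"
proof -
  have e: "- 1 - n = - n - 1" by simp
  show ?thesis
    by (simp_all add: D_def sg_hom op_flip' op_flip'' algebra_simps e)
qed

section \<open>Exactness in positive weights\<close>

lemma D_pos:
  assumes "n \<ge> 1"
  shows "D0u n f = cc (-1) * sg (-1) f - cc (n - 1) * f"
    and "D0d n f = sg 1 f - f"
    and "D1a n g g' = sg 2 g - const2 \<alpha> * sg 1 g - const2 \<beta> * g + cc (n + 1) * (g' + sg 1 g')
      - const2 \<alpha> * (cc n * g' + cc 0 * g') - const2 \<beta> * cc (-1) * (sg (-1) g' + g')"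
    and "D1b n g g' = cc (n - 1) * sg 1 g + cc 0 * g + cc n * cc (n - 1) * g'
      - const2 \<alpha> * (cc (n - 1) * g + cc (-1) * g + cc (n - 1) * cc (-1) * sg (-1) g')
      - const2 \<beta> * (cc (n - 2) * g + cc (-1) * sg (-1) g + cc (-1) * cc (-2) * sg (-2) g')"
    and "D2 n h h' = sg 1 h' + const2 \<beta> * h' - cc n * h - const2 \<beta> * cc (-1) * sg (-1) h"
proof -
  show "D0u n f = cc (-1) * sg (-1) f - cc (n - 1) * f" "D0d n f = sg 1 f - f"
    "D2 n h h' = sg 1 h' + const2 \<beta> * h' - cc n * h - const2 \<beta> * cc (-1) * sg (-1) h"
    using assms by (simp_all add: D_def ops_def sg_hom)
  \<comment> \<open>For n = 1 the U component sits in weight 0, where \<open>lu\<close> and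
    \<open>ru\<close> take their other branch.\<close>
  consider "n = 1" | "n \<ge> 2" using assms by linarith
  then show "D1a n g g' = sg 2 g - const2 \<alpha> * sg 1 g - const2 \<beta> * g + cc (n + 1) * (g' + sg 1 g')
      - const2 \<alpha> * (cc n * g' + cc 0 * g') - const2 \<beta> * cc (-1) * (sg (-1) g' + g')"
    "D1b n g g' = cc (n - 1) * sg 1 g + cc 0 * g + cc n * cc (n - 1) * g'
      - const2 \<alpha> * (cc (n - 1) * g + cc (-1) * g + cc (n - 1) * cc (-1) * sg (-1) g')
      - const2 \<beta> * (cc (n - 2) * g + cc (-1) * sg (-1) g + cc (-1) * cc (-2) * sg (-2) g')"
    by (cases; simp add: D_def ops_def sg_hom algebra_simps)+
qed

lemma D1_D0_pos:
  assumes "n \<ge> 1"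
  shows "D1a n (D0u n f) (D0d n f) = 0" "D1b n (D0u n f) (D0d n f) = 0"
proof -
  have s: "1 + (n - 1) = n" "2 + (n - 1) = n + 1" "- 1 + (n - 1) = n - 2" by auto
  show "D1a n (D0u n f) (D0d n f) = 0" "D1b n (D0u n f) (D0d n f) = 0"
    \<comment> \<open>The remaining identity is polynomial in shifted copies of f and of c, and
      follows from instances of the recursion for \<open>cc\<close>.\<close>
    unfolding D_pos[OF assms]
    by (simp add: sg_hom s, Groebner_Basis.algebra add: cc_suc[of n] cc_suc'[of n] cc_n[of n] cc_1 cc_0_rec cc_2)+
qed

lemma D2_D1_pos:
  assumes "n \<ge> 1"
  shows "D2 n (D1a n g g') (D1b n g g') = 0"
proof -
  have s: "1 + (n - 1) = n" "2 + (n - 1) = n + 1" "- 1 + (n - 1) = n - 2" "1 + (n - 2) = n - 1" by auto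
  show ?thesis
    unfolding D_pos[OF assms]
    by (simp add: sg_hom s, Groebner_Basis.algebra add: cc_suc[of n] cc_suc'[of n] cc_n[of n] cc_1 cc_0_rec cc_2)
qed

end

text \<open>Relies on \<open>inverse 0 = 0\<close>: dividing by the eigenvalues inverts a diagonal
  operator up to the monomials it kills. The reductions below all start this way.\<close>

lemma diag_inverse: "co (diag e (diag (\<lambda>i j. inverse (e i j)) f)) i j = (if e i j = 0 then 0 else co f i j)"
  for e :: "nat \<Rightarrow> nat \<Rightarrow> 'a::field"
  by simp

context F1 begin

text \<open>The eigenvalues, on the monomial \<open>x\<^sup>i y\<^sup>j\<close>, of \<open>\<sigma> - 1\<close>, of \<open>(\<sigma> - r\<^sub>1)(\<sigma> - r\<^sub>2)\<close> and of \<open>\<sigma> + \<beta>\<close>.\<close>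

definition e1 :: "nat \<Rightarrow> nat \<Rightarrow> 'k" where "e1 i j = ev i j - 1"
definition e2 :: "nat \<Rightarrow> nat \<Rightarrow> 'k" where "e2 i j = (ev i j - r1) * (ev i j - r2)"
definition e3 :: "nat \<Rightarrow> nat \<Rightarrow> 'k" where "e3 i j = ev i j + \<beta>"

text \<open>The numbers 1, r1, r2 and - \<beta> = r1 r2 are themselves the eigenvalues of sigma at
  1, x, y and xy, so \<open>ev_inj\<close> locates the zeros.\<close>

lemma e_zero_iff:
  "e1 i j = 0 \<longleftrightarrow> i = 0 \<and> j = 0"
  "e2 i j = 0 \<longleftrightarrow> i = 1 \<and> j = 0 \<or> i = 0 \<and> j = 1"
  "e3 i j = 0 \<longleftrightarrow> i = 1 \<and> j = 1"
proof -
  show "e1 i j = 0 \<longleftrightarrow> i = 0 \<and> j = 0"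
    using ev_inj[of i j 0 0] by (simp add: e1_def ev_simps)
  show "e2 i j = 0 \<longleftrightarrow> i = 1 \<and> j = 0 \<or> i = 0 \<and> j = 1"
    using ev_inj[of i j 1 0] ev_inj[of i j 0 1] by (simp only: e2_def ev_simps) simp
  have "e3 i j = 0 \<longleftrightarrow> ev i j = ev 1 1" by (simp only: e3_def ev_simps add_eq_0_iff2)
  then show "e3 i j = 0 \<longleftrightarrow> i = 1 \<and> j = 1"
    by (simp only: ev_inj)
qed

lemma sg_eigen:
  "sg 1 f - f = diag e1 f"
  "sg 2 f - const2 \<alpha> * sg 1 f - const2 \<beta> * f = diag e2 f"
  "sg 1 f + const2 \<beta> * f = diag e3 f"
proof -
  have p2: "(r1 powi 2) ^ i * (r2 powi 2) ^ j = ev i j * ev i j" for i j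
    by (simp add: ev_def power_mult_distrib power2_eq_square mult_ac)
  have p1: "(r1 powi 1) ^ i * (r2 powi 1) ^ j = ev i j" for i j
    by (simp add: ev_def)
  show "sg 1 f - f = diag e1 f" "sg 1 f + const2 \<beta> * f = diag e3 f"
    by (rule poly2_eqI, simp only: co_simps co_sg_1 co_const2_mult co_diag e1_def e3_def,
        simp add: algebra_simps)+
  show "sg 2 f - const2 \<alpha> * sg 1 f - const2 \<beta> * f = diag e2 f"
    by (rule poly2_eqI, simp only: co_simps co_sg p2 p1 co_const2_mult co_diag)
      (simp add: e2_def alpha beta algebra_simps)
qed

lemma lin_arith:
  "lin p q + lin p' q' = lin (p + p') (q + q')" "lin p q - lin p' q' = lin (p - p') (q - q')"
  "const2 a * lin p q = lin (a * p) (a * q)"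
  "quad p q s + quad p' q' s' = quad (p + p') (q + q') (s + s')"
  "quad p q s - quad p' q' s' = quad (p - p') (q - q') (s - s')"
  "const2 a * quad p q s = quad (a * p) (a * q) (a * s)"
  for a p q p' q' :: 'k
  by (simp_all add: lin_def quad_def const2_def)

lemma lin_double: "2 * lin p q = lin (2 * p) (2 * q)" for p q :: 'k
  unfolding mult_2 by (rule lin_arith)

lemma quad_cong: "p = p' \<Longrightarrow> q = q' \<Longrightarrow> s = s' \<Longrightarrow> quad p q s = quad p' q' s'"
  by simp

text \<open>Constants are what sigma - 1 misses in the D component. Their contribution is linear in
  x and y, exactly where \<open>diag e2\<close> vanishes, so no g can compensate for it.\<close>

lemma D1a_const:
  assumes "n \<ge> 1"
  shows "D1a n g (const2 l) = diag e2 g + const2 l * lin (r1 powi n - 1) (r2 powi n - 1)"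
proof -
  have "D1a n g (const2 l) = diag e2 g + const2 l * 
    (2 * cc (n + 1) - const2 \<alpha> * (cc n + cc 0) - 2 * const2 \<beta> * cc (-1))"
    unfolding D_pos(3)[OF assms] sg_const2 sg_eigen(2)[symmetric] by (simp add: algebra_simps)
  also have "2 * cc (n + 1) - const2 \<alpha> * (cc n + cc 0) - 2 * const2 \<beta> * cc (-1) =
     lin (r1 powi n - 1) (r2 powi n - 1)"
    unfolding cc_def alpha beta lin_arith lin_double mult.assoc
  proof (rule arg_cong2[where f = lin], goal_cases)
    case 1
    \<comment> \<open>R and i stand for r1^n and 1 / r1; as unknowns with i r1 = 1 they turn the
      claim into a polynomial identity.\<close>
    have "2 * (kappa * (R * r1)) - (r1 + r2) * (kappa * R + kappa) + 2 * (r1 * r2 * (kappa * i)) = R - 1"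
      if "i * r1 = 1" for R i :: 'k
      using that kappa(1) by Groebner_Basis.algebra
    from this[of "inverse r1" "r1 powi n"] show ?case by (simp add: power_int_add)
  next
    case 2
    have "(r1 + r2) * (kappa * R + kappa) - 2 * (kappa * (r2 * R)) - 2 * (r1 * r2 * (kappa * i)) = R - 1"
      if "i * r2 = 1" for R i :: 'k
      using that kappa(1) by Groebner_Basis.algebra
    from this[of "inverse r2" "r2 powi n"] show ?case
      by (simp add: power_int_add) (simp add: algebra_simps)
  qed
  finally show ?thesis .
qed

text \<open>The kernel of \<open>diag e2\<close> is spanned by x and y. The terms in x^2 and y^2
  cancel because r1 and r2 are roots; what survives is a multiple of xy, the monomial killed by
  \<open>diag e3\<close>.\<close>

lemma D1b_lin:
  assumes "n \<ge> 1"
  shows "D1b n (lin p q) 0 = quad 0 (p * (inverse r2 - r2 powi (n - 1)) + q * (inverse r1 - r1 powi (n - 1))) 0"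
proof -
  have pn: "r * r powi (n - 2) = r powi (n - 1)" if "r \<noteq> 0" for r :: 'k
    using that by (simp add: power_int_diff power2_eq_square field_simps)
  have rel: "r1 * r1 powi (n - 2) = r1 powi (n - 1)" "r2 * r2 powi (n - 2) = r2 powi (n - 1)"
    "inverse r1 * r1 = 1" "inverse r2 * r2 = 1" "kappa * (r1 - r2) = 1"
    by (simp_all add: pn kappa)
  show ?thesis
    unfolding D_pos(4)[OF assms] sg_lin cc_def
  proof (simp add: lin_arith lin_mult_lin mult.assoc, rule quad_cong, goal_cases)
    case 1
    \<comment> \<open>M, N and i stand for r1^(n-2), r1^(n-1) and 1 / r1.\<close>
    have "kappa * (N * (r1 * p)) + kappa * p - \<alpha> * (kappa * (N * p) + kappa * (i * p)) - \<beta> * (kappa * (M * p) + kappa * (i * (i * p))) = 0"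
      if "i * r1 = 1" "r1 * M = N" for i M N
      using that alpha beta by Groebner_Basis.algebra
    from this[OF rel(3) rel(1)] show ?case .
  next
    case 2
    have "kappa * (N1 * (r2 * q)) - kappa * (N2 * (r1 * p)) + (kappa * q - kappa * p)
        - \<alpha> * (kappa * (N1 * q) - kappa * (N2 * p) + (kappa * (i1 * q) - kappa * (i2 * p)))
        - \<beta> * (kappa * (M1 * q) - kappa * (M2 * p) + (kappa * (i1 * (i2 * q)) - kappa * (i2 * (i1 * p))))
        = p * (i2 - N2) + q * (i1 - N1)"
      if "i1 * r1 = 1" "r1 * M1 = N1" "i2 * r2 = 1" "r2 * M2 = N2" for i1 M1 N1 i2 M2 N2
      using that alpha beta kappa(1) by Groebner_Basis.algebra
    from this[OF rel(3) rel(1) rel(4) rel(2)] show ?case .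
  next
    case 3
    have "- (kappa * (N * (r2 * q))) - kappa * q - \<alpha> * (- (kappa * (N * q)) - kappa * (i * q))
        - \<beta> * (- (kappa * (M * q)) - kappa * (i * (i * q))) = 0"
      if "i * r2 = 1" "r2 * M = N" for i M N
      using that alpha beta by Groebner_Basis.algebra
    from this[OF rel(4) rel(2)] show ?case .
  qed
qed

lemma D0u_const:
  assumes "n \<ge> 1"
  shows "D0u n (const2 l) = const2 (l * kappa) * lin (inverse r1 - r1 powi (n - 1)) (- (inverse r2 - r2 powi (n - 1)))"
  unfolding D_pos[OF assms]
  by (rule poly2_eqI) (simp add: cc_def co_lin algebra_simps)

text \<open>Equality would give r^n = 1, against (F1).\<close>

lemma pow_nz:
  assumes "n \<ge> 1"
  shows "inverse r1 - r1 powi (n - 1) \<noteq> 0" "inverse r2 - r2 powi (n - 1) \<noteq> 0"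
proof -
  have "r powi n = 1" if "r \<noteq> 0" "inverse r = r powi (n - 1)" for r :: 'k
    using that by (simp add: power_int_diff field_simps)
  then show "inverse r1 - r1 powi (n - 1) \<noteq> 0" "inverse r2 - r2 powi (n - 1) \<noteq> 0"
    using r1_powi_ne_1[of n] r2_powi_ne_1[of n] assms by auto
qed

lemma eq_lin: "f = lin p q" if "\<And>i j. co f i j = (if i = 1 \<and> j = 0 then p else if i = 0 \<and> j = 1 then q else 0)"
  by (rule poly2_eqI) (simp add: that co_lin)

lemma exact0_pos:
  assumes "n \<ge> 1" "D0u n f = 0" "D0d n f = 0"
  shows "f = 0"
proof -
  have "diag e1 f = 0" using assms by (simp add: D_pos sg_eigen)
  then have "e1 i j * co f i j = 0" for i j by (metis co_diag co_simps(1))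
  then have f: "f = const2 (co f 0 0)"
    using e_zero_iff(1) by (intro poly2_eqI) (metis co_const2 mult_eq_0_iff)
  have "co (D0u n f) 1 0 = 0" by (simp add: assms)
  then have "co f 0 0 = 0"
    using pow_nz[OF assms(1)] kappa(2) by (subst (asm) f) (simp add: D0u_const assms(1) co_lin)
  then show ?thesis using f by (simp add: const2_hom)
qed

lemma exact1_pos:
  assumes n: "n \<ge> 1" and "D1a n g g' = 0" "D1b n g g' = 0"
  shows "\<exists>f. D0u n f = g \<and> D0d n f = g'"
proof -
  \<comment> \<open>Solves \<open>D0d n F = g'\<close> up to the constant term, the only part
    outside the image of sigma - 1.\<close>
  define F where "F = diag (\<lambda>i j. inverse (e1 i j)) g'"
  define l where "l = co g' 0 0"
  define g1 where "g1 = g - D0u n F"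
  have g': "g' - D0d n F = const2 l"
    unfolding D_pos(2)[OF n] sg_eigen F_def
    by (rule poly2_eqI) (simp only: co_simps diag_inverse, auto simp: e_zero_iff l_def co_const2)
  have 1: "D1a n g1 (const2 l) = 0" "D1b n g1 (const2 l) = 0"
    by (simp_all add: g1_def flip: g', simp_all add: D_diff assms D1_D0_pos)
  \<comment> \<open>At the monomial x the term \<open>diag e2 g1\<close> vanishes, which leaves l
    (r1^n - 1).\<close>
  have "co (D1a n g1 (const2 l)) 1 0 = 0" by (simp add: 1)
  moreover have "r1 powi n - 1 \<noteq> 0" using r1_powi_ne_1[of n] n by simp
  moreover have "e2 1 0 = 0" by (simp add: e_zero_iff del: One_nat_def)
  ultimately have l: "l = 0"
    by (simp add: D1a_const[OF n] co_lin)
  with 1(1) have "diag e2 g1 = 0" using D1a_const[OF n, of g1 0] by (simp add: const2_hom)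
  then have "e2 i j * co g1 i j = 0" for i j by (metis co_diag co_simps(1))
  then have "co g1 i j = 0" if "\<not> (i = 1 \<and> j = 0 \<or> i = 0 \<and> j = 1)" for i j
    using e_zero_iff(2) that by (metis mult_eq_0_iff)
  then obtain p q where g1: "g1 = lin p q"
    by (metis (mono_tags, lifting) eq_lin)
  let ?a = "inverse r1 - r1 powi (n - 1)" and ?b = "inverse r2 - r2 powi (n - 1)"
  \<comment> \<open>The xy coefficient is the one linear condition that makes \<open>lin p q\<close>
    proportional to the value of \<open>D0u\<close> at a constant.\<close>
  have "co (D1b n g1 (const2 l)) 1 1 = 0" by (simp add: 1)
  then have pq: "p * ?b + q * ?a = 0"
    by (simp add: l g1 const2_hom D1b_lin[OF n] co_quad)
  \<comment> \<open>The constant is chosen to match the coefficient of x; the relation between p and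
    q takes care of y.\<close>
  have "D0u n (const2 (p / (kappa * ?a))) = lin p q"
  proof -
    have "q = - (p / ?a * ?b)"
      using pq pow_nz(1)[OF n] by (simp add: divide_simps) (simp add: algebra_simps add_eq_0_iff2)
    then show ?thesis
      unfolding D0u_const[OF n] lin_arith using kappa(2) pow_nz(1)[OF n]
      by (intro arg_cong2[where f = lin]; simp) (metis minus_diff_eq mult_minus_right minus_divide_left)
  qed
  moreover have "D0d n (const2 (p / (kappa * ?a))) = 0" by (simp add: D_pos[OF n])
  ultimately have "D0u n (F + const2 (p / (kappa * ?a))) = g" "D0d n (F + const2 (p / (kappa * ?a))) = g'"
    using g' g1 by (simp_all add: D_add g1_def l const2_hom algebra_simps)
  then show ?thesis by blast
qed

text \<open>The xy coefficient does not see h', since \<open>diag e3\<close> kills xy. This isolates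
  the obstruction carried by q.\<close>

lemma D2_lin:
  assumes "n \<ge> 1"
  shows "co (D2 n (lin 0 q) h') 1 1 = - (kappa * q * (r1 powi n - 1))"
proof -
  have "co (diag e3 h') 1 1 = 0" by (simp add: e_zero_iff(3)[of 1 1, simplified])
  then have "co (sg 1 h' + const2 \<beta> * h') 1 1 = 0" by (simp only: sg_eigen)
  then show ?thesis
    unfolding D_pos(5)[OF assms] co_simps mult.assoc co_const2_mult
    by (simp add: cc_def co_lin co_lin_mult) (simp add: beta field_simps)
qed

lemma exact2_pos:
  assumes n: "n \<ge> 1" and "D2 n h h' = 0"
  shows "\<exists>g g'. D1a n g g' = h \<and> D1b n g g' = h'"
proof -
  define g where "g = diag (\<lambda>i j. inverse (e2 i j)) h"
  have nz: "r1 powi n - 1 \<noteq> 0" using r1_powi_ne_1[of n] n by simp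
  \<comment> \<open>The x coefficient of h is out of reach of \<open>diag e2\<close>; the constant l
    in the D component supplies it.\<close>
  define l where "l = co h 1 0 / (r1 powi n - 1)"
  define h1 where "h1 = h' - D1b n g (const2 l)"
  define q where "q = co h 0 1 - l * (r2 powi n - 1)"
  have h: "h - D1a n g (const2 l) = lin 0 q"
    unfolding D1a_const[OF n] g_def
    by (rule eq_lin) (simp only: co_simps diag_inverse, use nz in \<open>auto simp: e_zero_iff l_def co_lin q_def\<close>)
  have 1: "D2 n (lin 0 q) h1 = 0"
    by (simp add: h1_def flip: h, simp add: D_diff assms D2_D1_pos)
  then have "kappa * q * (r1 powi n - 1) = 0"
    using D2_lin[OF n, of q h1] by simp
  then have q: "q = 0" using nz kappa(2) by simp
  with 1 have "diag e3 h1 = 0"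
    by (simp add: D_pos(5)[OF n] sg_eigen lin_def)
  then have "e3 i j * co h1 i j = 0" for i j by (metis co_diag co_simps(1))
  then have "co h1 i j = 0" if "\<not> (i = 1 \<and> j = 1)" for i j
    using e_zero_iff(3) that by (metis mult_eq_0_iff)
  then have h1: "h1 = quad 0 (co h1 1 1) 0"
    by (intro poly2_eqI) (auto simp: co_quad)
  let ?b = "inverse r2 - r2 powi (n - 1)"
  \<comment> \<open>A multiple of x is invisible to \<open>D1a\<close> and changes
    \<open>D1b\<close> by a multiple of xy, which is all that is left of \<open>h1\<close>.\<close>
  have "D1a n (lin (co h1 1 1 / ?b) 0) 0 = 0"
    using D1a_const[OF n, of "lin (co h1 1 1 / ?b) 0" 0]
    by (simp add: const2_hom) (rule poly2_eqI, use e_zero_iff(2) in \<open>simp add: co_lin\<close>)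
  moreover have "D1b n (lin (co h1 1 1 / ?b) 0) 0 = h1"
    using pow_nz(2)[OF n] by (subst (2) h1) (simp add: D1b_lin[OF n])
  ultimately have "D1a n (g + lin (co h1 1 1 / ?b) 0) (const2 l + 0) = h"
    "D1b n (g + lin (co h1 1 1 / ?b) 0) (const2 l + 0) = h'"
    unfolding D_add using h q by (simp_all add: h1_def lin_def)
  then show ?thesis by blast
qed

lemma exact3_pos:
  assumes n: "n \<ge> 1"
  shows "\<exists>h h'. D2 n h h' = p"
proof -
  have nz: "kappa * (r1 powi n - 1) \<noteq> 0" using r1_powi_ne_1[of n] n kappa(2) by simp
  \<comment> \<open>Makes the xy coefficient of \<open>p'\<close> vanish; every other monomial lies
    in the image of \<open>diag e3\<close>.\<close>
  define q where "q = - co p 1 1 / (kappa * (r1 powi n - 1))"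
  define p' where "p' = p - D2 n (lin 0 q) 0"
  have "co p' 1 1 = 0" using nz unfolding p'_def co_simps D2_lin[OF n] q_def by simp
  then have "p' = D2 n 0 (diag (\<lambda>i j. inverse (e3 i j)) p')"
    by (simp add: D_pos(5)[OF n] sg_eigen) (rule poly2_eqI, simp only: diag_inverse, auto simp: e_zero_iff)
  then have "D2 n (lin 0 q + 0) (0 + diag (\<lambda>i j. inverse (e3 i j)) p') = p"
    unfolding D_add by (simp add: p'_def)
  then show ?thesis by blast
qed

section \<open>Exactness in negative weights, through the anti-automorphism\<close>

lemma sg_inj: "sg m f = sg m g \<longleftrightarrow> f = g"
proof
  assume "sg m f = sg m g"
  then have "sg (- m) (sg m f) = sg (- m) (sg m g)" by (rule arg_cong)
  then show "f = g" by (simp only: sg_sg) simp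
qed simp

lemma D_minus: "D0u n (- f) = - D0u n f" "D0d n (- f) = - D0d n f"
  using D_diff(1,2)[of n 0 f] by simp_all

lemma exact0:
  assumes "n \<noteq> 0" "D0u n f = 0" "D0d n f = 0"
  shows "f = 0"
proof (cases "n \<ge> 1")
  case True then show ?thesis using exact0_pos assms by blast
next
  case False
  have "D0d (- n) (sg (- n) f) = 0" "D0u (- n) (sg (- n) f) = 0"
    using D0_flip[of n f] unfolding assms sg_0 by (metis neg_equal_0_iff_equal)+
  then have "sg (- n) f = sg (- n) 0"
    using exact0_pos[of "- n" "sg (- n) f"] False assms(1) by simp
  then show ?thesis by (simp only: sg_inj)
qed

lemma exact1:
  assumes "n \<noteq> 0" "D1a n g g' = 0" "D1b n g g' = 0"
  shows "\<exists>f. D0u n f = g \<and> D0d n f = g'"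
proof (cases "n \<ge> 1")
  case True then show ?thesis using exact1_pos assms by blast
next
  case False
  then obtain f where f: "D0u (- n) f = sg (- n - 1) g'" "D0d (- n) f = sg (1 - n) g"
    using assms D1_flip[of n g g'] exact1_pos[of "- n" "sg (- n - 1) g'" "sg (1 - n) g"] by auto
  have "sg (1 - n) (D0u n (- sg n f)) = sg (1 - n) g" "sg (- n - 1) (D0d n (- sg n f)) = sg (- n - 1) g'"
    unfolding D0_flip by (simp_all add: f D_minus sg_minus)
  then show ?thesis by (auto simp only: sg_inj)
qed

lemma exact2:
  assumes "n \<noteq> 0" "D2 n h h' = 0"
  shows "\<exists>g g'. D1a n g g' = h \<and> D1b n g g' = h'"
proof (cases "n \<ge> 1")
  case True then show ?thesis using exact2_pos assms by blast
next
  case False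
  then obtain g g' where g: "D1a (- n) g g' = sg (1 - n) h'" "D1b (- n) g g' = sg (- n - 1) h"
    using assms D2_flip[of n h h'] exact2_pos[of "- n" "sg (1 - n) h'" "sg (- n - 1) h"] by auto
  have "sg (- n - 1) (D1a n (sg (n - 1) g') (sg (n + 1) g)) = sg (- n - 1) h"
    "sg (1 - n) (D1b n (sg (n - 1) g') (sg (n + 1) g)) = sg (1 - n) h'"
    unfolding D1_flip using g by simp_all
  then show ?thesis by (auto simp only: sg_inj)
qed

lemma exact3:
  assumes "n \<noteq> 0"
  shows "\<exists>h h'. D2 n h h' = p"
proof (cases "n \<ge> 1")
  case True then show ?thesis using exact3_pos assms by blast
next
  case False
  then obtain h h' where h: "D2 (- n) h h' = - sg (- n) p"
    using assms exact3_pos[of "- n" "- sg (- n) p"] by auto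
  have "sg (- n) (D2 n (sg (n + 1) h') (sg (n - 1) h)) = sg (- n) p"
    unfolding D2_flip using h by simp
  then show ?thesis by (auto simp only: sg_inj)
qed

end

section \<open>Weight zero\<close>

lemma co_mult_const2 [simp]: "co (f * const2 a) i j = co f i j * a"
  for a :: "'a::comm_semiring_1"
  by (simp add: mult.commute[of _ "const2 a"] mult.commute[of _ a])

lemma co_pCons0: "co [:q:] i j = (if j = 0 then coeff q i else 0)"
  by (simp add: co_def coeff_pCons split: nat.split)

text \<open>Polynomials in x alone are preserved by diagonal operators, so powers of x remain usable
  as representatives after P or its partial inverse is applied.\<close>

lemma diag_pCons0: "\<exists>q'. diag e [:q:] = [:q':] \<and> (\<forall>i. coeff q' i = e i 0 * coeff q i)"
proof (intro exI conjI allI)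
  let ?q = "coeff (diag e [:q:]) 0"
  show "coeff ?q i = e i 0 * coeff q i" for i
    using co_diag[of e "[:q:]" i 0] by (simp only: co_def[of "diag e [:q:]"] co_pCons0 refl if_True)
  then show "diag e [:q:] = [:?q:]"
    by (intro poly2_eqI) (simp add: co_pCons0)
qed

lemma diag_inverse': "co (diag (\<lambda>i j. inverse (e i j)) (diag e f)) i j = (if e i j = 0 then 0 else co f i j)"
  for e :: "nat \<Rightarrow> nat \<Rightarrow> 'a::field"
  by simp

context F1 begin

text \<open>The eigenvalues of \<open>\<sigma> - \<alpha> - \<beta> \<sigma>\<inverse>\<close> and of \<open>1 + \<beta> \<sigma>\<inverse>\<close>.\<close>

definition pe :: "nat \<Rightarrow> nat \<Rightarrow> 'k" where "pe i j = e2 i j / ev i j"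
definition ke :: "nat \<Rightarrow> nat \<Rightarrow> 'k" where "ke i j = e3 i j / ev i j"

lemma pe_zero_iff: "pe i j = 0 \<longleftrightarrow> i = 1 \<and> j = 0 \<or> i = 0 \<and> j = 1"
  and ke_zero_iff: "ke i j = 0 \<longleftrightarrow> i = 1 \<and> j = 1"
  using e_zero_iff[of i j] by (simp_all add: pe_def ke_def)

lemma diag_pe: "diag pe f = sg 1 f - const2 \<alpha> * f - const2 \<beta> * sg (-1) f"
  and diag_ke: "diag ke f = f + const2 \<beta> * sg (-1) f"
proof -
  show "diag pe f = sg 1 f - const2 \<alpha> * f - const2 \<beta> * sg (-1) f"
    by (rule poly2_eqI, simp only: co_simps co_sg_1 co_sg_m1 co_const2_mult co_diag)
      (simp add: pe_def e2_def alpha beta divide_simps, simp add: algebra_simps)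
  show "diag ke f = f + const2 \<beta> * sg (-1) f"
    by (rule poly2_eqI, simp only: co_simps co_sg_1 co_sg_m1 co_const2_mult co_diag)
      (simp add: ke_def e3_def divide_simps, simp add: algebra_simps)
qed

lemma D0_zero: "D0u 0 f = sg (-1) f - f" "D0d 0 f = sg 1 f - f"
  by (simp_all add: D_def ops_def)

text \<open>Both components depend only on \<open>sg 1 g + g'\<close>, which takes every value (put
  g = 0). So the coboundaries of weight 0 are a copy of P(c K[x, y]), embedded by f and
  \<open>sg (-1) f\<close>.\<close>

lemma D1_zero:
  "D1a 0 g g' = diag pe (cc 0 * (sg 1 g + g'))"
  "D1b 0 g g' = sg (-1) (diag pe (cc 0 * (sg 1 g + g')))"
  unfolding diag_pe
  by (simp_all add: D_def ops_def sg_hom) (simp_all add: cc_1 cc_0_rec algebra_simps)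

text \<open>The difference \<open>sg 1 h' - h\<close> takes every value, which yields the whole of
  P(c K[x, y]) with P = 1 + \<beta> sigma^-1.\<close>

lemma D2_zero: "D2 0 h h' = diag ke (cc 0 * (sg 1 h' - h))"
  unfolding diag_ke by (simp_all add: D_def ops_def sg_hom; simp add: algebra_simps)

lemma D2_D1: "D2 n (D1a n g g') (D1b n g g') = 0"
proof -
  consider "n \<ge> 1" | "n = 0" | "- n \<ge> 1" by linarith
  then show ?thesis
  proof cases
    case 3
    have "sg (- n) (D2 n (D1a n g g') (D1b n g g')) = sg (- n) 0"
      unfolding D2_flip D1_flip D2_D1_pos[OF 3] by simp
    then show ?thesis by (simp only: sg_inj)
  qed (simp_all add: D2_D1_pos D2_zero D1_zero)
qed

lemma D1_D0: "D1a n (D0u n f) (D0d n f) = 0" "D1b n (D0u n f) (D0d n f) = 0"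
proof -
  have "D1a n (D0u n f) (D0d n f) = 0 \<and> D1b n (D0u n f) (D0d n f) = 0"
  proof -
    consider "n \<ge> 1" | "n = 0" | "- n \<ge> 1" by linarith
    then show ?thesis
    proof cases
      case 3
      have *: "D1a n (D0u n f) (D0d n f) = - D1a n (- D0u n f) (- D0d n f)"
        "D1b n (D0u n f) (D0d n f) = - D1b n (- D0u n f) (- D0d n f)"
        using D_diff(3,4)[of n 0 _ 0] by simp_all
      have "sg (- n - 1) (D1a n (D0u n f) (D0d n f)) = sg (- n - 1) 0"
        "sg (1 - n) (D1b n (D0u n f) (D0d n f)) = sg (1 - n) 0"
        unfolding * sg_minus D1_flip D0_flip minus_minus D1_D0_pos[OF 3] by simp_all
      then show ?thesis by (simp only: sg_inj)
    qed (simp_all add: D1_D0_pos D1_zero D0_zero sg_hom)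
  qed
  then show "D1a n (D0u n f) (D0d n f) = 0" "D1b n (D0u n f) (D0d n f) = 0" by auto
qed

lemma cc_0_nz: "cc 0 \<noteq> 0"
  using kappa(2) by (simp add: cc_def lin_def)

lemma ediag_cc_0 [simp]: "ediag (cc 0) = 0"
  by (simp add: cc_def)

lemma ediag_eq_0D:
  assumes "ediag f = 0"
  shows "\<exists>g. f = cc 0 * g"
proof -
  obtain g where "f = lin 1 (-1) * g" using assms unfolding ediag_eq_0_iff by blast
  then have "f = cc 0 * (const2 (inverse kappa) * g)"
    using kappa(2) by (simp add: cc_0 mult_ac) (simp add: const2_def one_pCons)
  then show ?thesis by blast
qed

lemma zeroth_cocycle: "D0u 0 f = 0 \<and> D0d 0 f = 0 \<longleftrightarrow> f = const2 (co f 0 0)"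
proof
  assume "D0u 0 f = 0 \<and> D0d 0 f = 0"
  then have "diag e1 f = 0" by (simp add: D0_zero sg_eigen)
  then have "e1 i j * co f i j = 0" for i j by (metis co_diag co_simps(1))
  then show "f = const2 (co f 0 0)"
    using e_zero_iff(1) by (intro poly2_eqI) (metis co_const2 mult_eq_0_iff)
next
  assume *: "f = const2 (co f 0 0)"
  show "D0u 0 f = 0 \<and> D0d 0 f = 0"
    by (subst (1 2) *) (simp add: D0_zero)
qed

text \<open>c is a combination of x and y, both killed by P.\<close>

lemma first_cocycle_const: "D1a 0 (const2 l) (const2 m) = 0" "D1b 0 (const2 l) (const2 m) = 0"
proof -
  have "diag pe (cc 0 * const2 a) = 0" for a
    unfolding mult.commute[of _ "const2 a"] diag_const2_mult
    by (rule poly2_eqI) (auto simp: cc_def co_lin pe_zero_iff simp del: One_nat_def)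
  then show "D1a 0 (const2 l) (const2 m) = 0" "D1b 0 (const2 l) (const2 m) = 0"
    by (simp_all add: D1_zero flip: const2_hom)
qed

text \<open>P kills only x and y, so c G is linear in x and y; being divisible by c it vanishes for
  x = y, hence it is a scalar multiple of c and G is constant. As sigma - 1 reaches everything but
  constants, two scalars remain.\<close>

lemma first_cocycle:
  assumes "D1a 0 g g' = 0"
  shows "\<exists>f l m. g = D0u 0 f + const2 l \<and> g' = D0d 0 f + const2 m"
proof -
  define G where "G = sg 1 g + g'"
  have "diag pe (cc 0 * G) = 0" using assms by (simp add: D1_zero G_def)
  then have "pe i j * co (cc 0 * G) i j = 0" for i j by (metis co_diag co_simps(1))
  then have "co (cc 0 * G) i j = 0" if "\<not> (i = 1 \<and> j = 0 \<or> i = 0 \<and> j = 1)" for i j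
    using pe_zero_iff that by (metis mult_eq_0_iff)
  then obtain p q where pq: "cc 0 * G = lin p q"
    by (metis (mono_tags, lifting) eq_lin)
  then have "ediag (lin p q) = 0" by (simp flip: pq)
  then have "q = - p" by (simp add: add_eq_0_iff)
  then have "cc 0 * G = cc 0 * const2 (p / kappa)"
    unfolding pq using kappa(2) by (intro poly2_eqI) (simp add: cc_0 mult_ac, simp add: co_lin flip: mult.assoc const2_hom)
  then have G: "G = const2 (p / kappa)" using cc_0_nz by simp
  define f where "f = diag (\<lambda>i j. inverse (e1 i j)) g'"
  define m where "m = co g' 0 0"
  have g': "g' - D0d 0 f = const2 m"
    unfolding D0_zero sg_eigen f_def
    by (rule poly2_eqI) (simp only: co_simps diag_inverse, auto simp: e_zero_iff m_def co_const2)
  have "sg 1 (g - D0u 0 f) = G - (g' - D0d 0 f)"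
    by (simp add: D0_zero sg_hom G_def)
  also have "\<dots> = sg 1 (const2 (p / kappa - m))"
    by (simp only: g' G sg_const2 const2_hom(5) sg_diff)
  finally have "g - D0u 0 f = const2 (p / kappa - m)" by (simp only: sg_inj)
  with g' have "g = D0u 0 f + const2 (p / kappa - m)" "g' = D0d 0 f + const2 m"
    by (metis add.commute diff_add_cancel)+
  then show ?thesis by blast
qed

lemma co_D0_zero: "co (D0u 0 f) 0 0 = 0" "co (D0d 0 f) 0 0 = 0"
  by (simp_all add: D0_zero)

text \<open>P kills only multiples of xy, and a nonzero one is not divisible by c because xy
  restricts to x^2 on x = y. So c G = 0.\<close>

lemma second_cocycle: "D2 0 h h' = 0 \<longleftrightarrow> h = sg 1 h'"
proof
  assume "D2 0 h h' = 0"
  define G where "G = sg 1 h' - h"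
  have "diag ke (cc 0 * G) = 0" using \<open>D2 0 h h' = 0\<close> by (simp add: D2_zero G_def)
  then have "ke i j * co (cc 0 * G) i j = 0" for i j by (metis co_diag co_simps(1))
  then have "co (cc 0 * G) i j = 0" if "\<not> (i = 1 \<and> j = 1)" for i j
    using ke_zero_iff that by (metis mult_eq_0_iff)
  then have q: "cc 0 * G = quad 0 (co (cc 0 * G) 1 1) 0"
    by (intro poly2_eqI) (auto simp: co_quad)
  then have "ediag (quad 0 (co (cc 0 * G) 1 1) 0) = 0"
    by (metis ediag_cc_0 ediag_simps(4) mult_zero_left)
  then have "co (cc 0 * G) 1 1 = 0" by (simp only: ediag_simps) simp
  then have "cc 0 * G = 0" by (subst q) (simp add: quad_def)
  then show "h = sg 1 h'" using cc_0_nz by (simp add: G_def)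
qed (simp add: D2_zero)

text \<open>Only x and y lie outside the image of P. The rest is P(f), and modulo multiples of c the
  polynomial f may be replaced by its restriction to x = y.\<close>

lemma second_normal_form:
  "\<exists>q B g. h = [:q:] + const2 B * cc (-1) + diag pe (cc 0 * g)"
proof -
  define f where "f = diag (\<lambda>i j. inverse (pe i j)) h"
  have f: "h = lin (co h 1 0) (co h 0 1) + diag pe f"
    unfolding f_def
    by (rule poly2_eqI) (simp only: co_simps diag_inverse, auto simp: pe_zero_iff co_lin)
  have "ediag (f - [:ediag f:]) = 0" by simp
  then obtain g where g: "f - [:ediag f:] = cc 0 * g" using ediag_eq_0D by blast
  obtain q where q: "diag pe [:ediag f:] = [:q:]" using diag_pCons0 by blast
  have df: "diag pe f = [:q:] + diag pe (cc 0 * g)"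
    by (simp add: diag_diff flip: q g)
  \<comment> \<open>The y coefficient of \<open>cc (-1)\<close> is - kappa / r2, which fixes B; A
    then corrects the x coefficient.\<close>
  define B where "B = - (r2 * co h 0 1 / kappa)"
  define A where "A = co h 1 0 - B * kappa / r1"
  have "lin (co h 1 0) (co h 0 1) = [:[:0, A:]:] + const2 B * cc (-1)"
    using kappa(2) by (intro poly2_eqI) (auto simp: co_lin co_pCons0 cc_def A_def B_def coeff_pCons field_simps split: nat.split)
  then have "h = [:q + [:0, A:]:] + const2 B * cc (-1) + diag pe (cc 0 * g)"
    using f df by simp
  then show ?thesis by blast
qed

lemma second_unique:
  assumes "[:q:] + const2 B * cc (-1) = diag pe (cc 0 * g)"
  shows "q = 0 \<and> B = 0"
proof -
  have "co ([:q:] + const2 B * cc (-1)) 0 1 = 0"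
    unfolding assms co_diag using pe_zero_iff[of 0 1] by simp
  then have B: "B = 0" using kappa(2) by (simp add: co_pCons0 cc_def co_lin)
  then have q: "[:q:] = diag pe (cc 0 * g)" using assms by (simp add: const2_hom)
  have "co [:q:] 1 0 = 0"
    unfolding q co_diag using pe_zero_iff[of 1 0] by simp
  then have q1: "coeff q 1 = 0" by (simp add: co_pCons0)
  obtain q' where q': "diag (\<lambda>i j. inverse (pe i j)) [:q:] = [:q':]" "\<And>i. coeff q' i = inverse (pe i 0) * coeff q i"
    using diag_pCons0[of "\<lambda>i j. inverse (pe i j)" q] by auto
  \<comment> \<open>Dividing by the eigenvalues of P loses the linear part of c g. That part is
    \<open>co g 0 0\<close> times c, so the result still vanishes for x = y.\<close>
  have "[:q':] = cc 0 * g - lin (kappa * co g 0 0) (- (kappa * co g 0 0))"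
    unfolding q'(1)[symmetric] q
  proof (rule poly2_eqI)
    fix i j
    have "co (cc 0 * g) 1 0 = kappa * co g 0 0" "co (cc 0 * g) 0 1 = - (kappa * co g 0 0)"
      by (simp_all add: cc_def co_lin_mult)
    then show "co (diag (\<lambda>i j. inverse (pe i j)) (diag pe (cc 0 * g))) i j =
      co (cc 0 * g - lin (kappa * co g 0 0) (- (kappa * co g 0 0))) i j"
      unfolding diag_inverse' pe_zero_iff co_simps co_lin by (simp del: One_nat_def)
  qed
  then have "ediag [:q':] = 0" by simp
  then have "inverse (pe i 0) * coeff q i = 0" for i by (simp flip: q'(2))
  then have "coeff q i = 0" for i
    using pe_zero_iff[of i 0] q1 by (cases "i = 1") auto
  then show ?thesis using B by (simp add: poly_eq_iff)
qed

lemma lu_x: "lu 1 (lin 1 0) = quad (kappa / (r1 * r1)) (- (kappa / (r1 * r2))) 0"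
  by (rule poly2_eqI)
    (simp add: lu_def sg_mult cc_def lin_mult_lin co_quad divide_simps power2_eq_square)

lemma third_normal_form:
  "\<exists>q B g. p = [:q:] + const2 B * lu 1 (lin 1 0) + diag ke (cc 0 * g) \<and> coeff q 2 = 0"
proof -
  define f where "f = diag (\<lambda>i j. inverse (ke i j)) p"
  have f: "p = quad 0 (co p 1 1) 0 + diag ke f"
    unfolding f_def
    by (rule poly2_eqI) (simp only: co_simps diag_inverse, auto simp: ke_zero_iff co_quad)
  have "ediag (f - [:ediag f:]) = 0" by simp
  then obtain g where g: "f - [:ediag f:] = cc 0 * g" using ediag_eq_0D by blast
  obtain q where q: "diag ke [:ediag f:] = [:q:]" using diag_pCons0 by blast
  have df: "diag ke f = [:q:] + diag ke (cc 0 * g)"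
    by (simp add: diag_diff flip: q g)
  \<comment> \<open>The xy coefficient of \<open>lu 1 (lin 1 0)\<close> is - kappa / (r1 r2), which
    fixes B; m is the coefficient of x^2 that is then left over.\<close>
  define B where "B = - (r1 * r2 * co p 1 1 / kappa)"
  define m where "m = coeff q 2 - B * kappa / (r1 * r1)"
  have nz: "ke 2 0 \<noteq> 0" by (simp add: ke_zero_iff)
  \<comment> \<open>c x is kappa (x^2 - xy) and P kills xy, so P(c x) is a nonzero multiple of x^2.
    This disposes of the x^2 term.\<close>
  define g2 where "g2 = const2 (m / (kappa * ke 2 0)) * lin 1 0"
  have g2: "diag ke (cc 0 * g2) = quad m 0 0"
  proof (rule poly2_eqI)
    fix i j
    have "cc 0 * g2 = const2 (m / (kappa * ke 2 0)) * (cc 0 * lin 1 0)"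
      by (simp add: g2_def mult_ac)
    then show "co (diag ke (cc 0 * g2)) i j = co (quad m 0 0) i j"
      using kappa(2) nz ke_zero_iff[of 1 1] by (simp add: cc_def lin_mult_lin co_quad)
  qed
  define q1 where "q1 = q - Polynomial.monom (coeff q 2) 2"
  have "quad 0 (co p 1 1) 0 + [:q:] = [:q1:] + const2 B * lu 1 (lin 1 0) + quad m 0 0"
    using kappa(2) unfolding lu_x
    by (intro poly2_eqI) (auto simp: co_quad co_pCons0 q1_def m_def B_def field_simps)
  then have "p = [:q1:] + const2 B * lu 1 (lin 1 0) + diag ke (cc 0 * (g + g2))"
  proof -
    have "p = (quad 0 (co p 1 1) 0 + [:q:]) + diag ke (cc 0 * g)"
      using f unfolding df by (simp only: add.assoc)
    also have "\<dots> = [:q1:] + const2 B * lu 1 (lin 1 0) + diag ke (cc 0 * (g + g2))"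
      unfolding \<open>_ + [:q:] = _\<close> distrib_left diag_add g2 by (simp only: add_ac)
    finally show ?thesis .
  qed
  moreover have "coeff q1 2 = 0" by (simp add: q1_def)
  ultimately show ?thesis by blast
qed

lemma third_unique:
  assumes "[:q:] + const2 B * lu 1 (lin 1 0) = diag ke (cc 0 * g)" "coeff q 2 = 0"
  shows "q = 0 \<and> B = 0"
proof -
  have "co ([:q:] + const2 B * lu 1 (lin 1 0)) 1 1 = 0"
    unfolding assms co_diag using ke_zero_iff[of 1 1] by simp
  then have B: "B = 0" using kappa(2) by (simp add: co_pCons0 lu_x co_quad)
  then have q: "[:q:] = diag ke (cc 0 * g)" using assms by (simp add: const2_hom)
  obtain q' where q': "diag (\<lambda>i j. inverse (ke i j)) [:q:] = [:q':]" "\<And>i. coeff q' i = inverse (ke i 0) * coeff q i"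
    using diag_pCons0[of "\<lambda>i j. inverse (ke i j)" q] by auto
  let ?m = "co (cc 0 * g) 1 1"
  have "[:q':] = cc 0 * g - quad 0 ?m 0"
    unfolding q'(1)[symmetric] q
    by (rule poly2_eqI, unfold diag_inverse' ke_zero_iff co_simps co_quad) (simp del: One_nat_def)
  \<comment> \<open>The lost xy term restricts to x^2, so only the coefficient of x^2 is left open,
    and it is zero by assumption.\<close>
  then have "ediag [:q':] = [:0, 0, - ?m:]" by simp
  then have "inverse (ke i 0) * coeff q i = 0" if "i \<noteq> 2" for i
    using that unfolding ediag_simps q'(2)[symmetric]
    by (auto simp: coeff_pCons numeral_2_eq_2 split: nat.splits)
  then have "coeff q i = 0" for i
    using ke_zero_iff[of i 0] assms(2) by (cases "i = 2") auto
  then show ?thesis using B by (simp add: poly_eq_iff)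
qed

end

section \<open>Normal forms in the down-up algebra\<close>

lemma lookup_Abs_finite:
  assumes "finite A" "\<And>k. k \<notin> A \<Longrightarrow> f k = 0"
  shows "Poly_Mapping.lookup (Abs_poly_mapping f) = f"
proof (rule lookup_Abs_poly_mapping)
  show "finite {k. f k \<noteq> 0}" using assms by (auto intro: finite_subset[of _ A])
qed

definition shift_map :: "int \<Rightarrow> (int \<Rightarrow> 'a \<Rightarrow> 'b) \<Rightarrow> (int \<Rightarrow>\<^sub>0 'a::zero) \<Rightarrow> (int \<Rightarrow>\<^sub>0 'b::zero)" where
  "shift_map s F m = Abs_poly_mapping (\<lambda>n. F (n - s) (Poly_Mapping.lookup m (n - s)))"

lemma lookup_shift_map:
  assumes "\<And>n. F n 0 = 0"
  shows "Poly_Mapping.lookup (shift_map s F m) n = F (n - s) (Poly_Mapping.lookup m (n - s))"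
  unfolding shift_map_def
proof (subst lookup_Abs_finite[of "(\<lambda>n. n + s) ` Poly_Mapping.keys m"])
  fix k assume k: "k \<notin> (\<lambda>n. n + s) ` Poly_Mapping.keys m"
  then have "k - s \<notin> Poly_Mapping.keys m"
    by (metis diff_add_cancel imageI)
  then show "F (k - s) (Poly_Mapping.lookup m (k - s)) = 0"
    by (simp add: assms in_keys_iff)
qed auto

lemma poly_mapping_as_sum: "p = (\<Sum>w\<in>Poly_Mapping.keys p. Poly_Mapping.single w (Poly_Mapping.lookup p w))"
proof (rule poly_mapping_eqI)
  fix k
  show "Poly_Mapping.lookup p k = Poly_Mapping.lookup (\<Sum>w\<in>Poly_Mapping.keys p. Poly_Mapping.single w (Poly_Mapping.lookup p w)) k"
    by (simp add: lookup_sum lookup_single when_def sum.delta in_keys_iff)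
qed

lemma poly_mapping_add_induct:
  fixes p :: "'b \<Rightarrow>\<^sub>0 'a::comm_monoid_add"
  assumes "\<And>w c. P (Poly_Mapping.single w c)" "\<And>p q. P p \<Longrightarrow> P q \<Longrightarrow> P (p + q)"
  shows "P p"
proof -
  have P0: "P 0" using assms(1)[of _ 0] by simp
  have "finite A \<Longrightarrow> (\<And>w. P (f w)) \<Longrightarrow> P (\<Sum>w\<in>A. f w)" for A and f :: "'b \<Rightarrow> ('b \<Rightarrow>\<^sub>0 'a)"
    by (induction A rule: finite_induct) (auto intro: assms(2) P0)
  then show ?thesis
    by (subst poly_mapping_as_sum) (simp add: assms(1))
qed

definition lext :: "('c \<Rightarrow> 'a \<Rightarrow> 'b) \<Rightarrow> ('c \<Rightarrow>\<^sub>0 'a::zero) \<Rightarrow> 'b::comm_monoid_add" where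
  "lext h p = (\<Sum>w\<in>Poly_Mapping.keys p. h w (Poly_Mapping.lookup p w))"

lemma lext_add:
  fixes h :: "'c \<Rightarrow> 'a::comm_monoid_add \<Rightarrow> 'b::comm_monoid_add"
  assumes "\<And>w. h w 0 = 0" "\<And>w a b. h w (a + b) = h w a + h w b"
  shows "lext h (p + q) = lext h p + lext h q"
proof -
  let ?A = "Poly_Mapping.keys p \<union> Poly_Mapping.keys q"
  have *: "lext h r = (\<Sum>w\<in>?A. h w (Poly_Mapping.lookup r w))" if "Poly_Mapping.keys r \<subseteq> ?A" for r
    unfolding lext_def using that assms(1) by (intro sum.mono_neutral_left) (auto simp: in_keys_iff)
  show ?thesis
    using *[of p] *[of q] *[OF Poly_Mapping.keys_add] assms by (simp add: lookup_add sum.distrib)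
qed

lemma lext_single: "h w 0 = 0 \<Longrightarrow> lext h (Poly_Mapping.single w c) = h w c"
  by (cases "c = 0") (simp_all add: lext_def)

text \<open>Such a family \<open>m\<close> stands for \<open>\<Sum>n. m n v\<^sub>n\<close>.\<close>

type_synonym 'k wpoly = "int \<Rightarrow>\<^sub>0 'k poly poly"

definition sM :: "'k \<Rightarrow> 'k wpoly \<Rightarrow> 'k::comm_ring_1 wpoly" where
  "sM a m = Poly_Mapping.map ((*) (const2 a)) m"

lemma lookup_sM [simp]: "Poly_Mapping.lookup (sM a m) n = const2 a * Poly_Mapping.lookup m n"
  by (simp add: sM_def map.rep_eq when_def)

lemma sM_simps:
  "sM a (m + m') = sM a m + sM a m'" "sM (a + b) m = sM a m + sM b m" "sM a (sM b m) = sM (a * b) m"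
  "sM 1 m = m" "sM 0 m = 0" "sM a 0 = 0" "sM a (m - m') = sM a m - sM a m'"
  by (rule poly_mapping_eqI; simp add: lookup_add lookup_minus const2_hom algebra_simps)+

lemma sM_single: "sM a (Poly_Mapping.single n f) = Poly_Mapping.single n (const2 a * f)"
  by (simp add: sM_def)

section \<open>Arithmetic of the free algebra\<close>

abbreviation genD :: "word \<Rightarrow>\<^sub>0 'k::field" where "genD \<equiv> monom_word [Dn]"
abbreviation genU :: "word \<Rightarrow>\<^sub>0 'k::field" where "genU \<equiv> monom_word [Up]"
definition scal :: "'k \<Rightarrow> word \<Rightarrow>\<^sub>0 'k::field" where "scal c = Poly_Mapping.single 0 c"

lemma word_plus: "Word v + Word w = Word (v @ w)" "(0 :: word) = Word []"
  by (simp_all add: plus_word_def zero_word_def)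

lemma scal_central: "p * scal c = scal c * p"
  by (induction p rule: poly_mapping_add_induct)
    (simp_all add: scal_def mult_single mult.commute distrib_left distrib_right)

lemma scal_simps:
  "scal a * scal b = scal (a * b)" "scal a * (scal b * p) = scal (a * b) * p" "scal 1 = 1" "scal 0 = 0"
  "scal (a + b) = scal a + scal b"
  by (simp_all add: scal_def mult_single single_add flip: mult.assoc)

lemma scal_left: "p * (scal c * q) = scal c * (p * q)"
  by (metis mult.assoc scal_central)

lemma scal_minus: "scal (- a) = - scal a" "scal (a - b) = scal a - scal b"
  by (simp_all add: scal_def single_uminus single_diff)

lemma single_scal: "Poly_Mapping.single (Word ws) c = scal c * monom_word ws"
  by (simp add: scal_def monom_word_def mult_single)

lemma monom_word_simps: "monom_word [] = 1" "monom_word (v @ w) = monom_word v * monom_word w"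
  by (simp_all add: monom_word_def mult_single word_plus flip: single_one)

lemma free_algebra_simps:
  "carrier free_algebra = UNIV" "mult free_algebra = (*)" "one free_algebra = 1"
  "zero free_algebra = 0" "add free_algebra = (+)" "smult free_algebra c p = scal c * p"
  by (simp_all add: free_algebra_def scal_def mult_map_scale_conv_mult)

lemma ring_free_algebra: "ring (free_algebra :: ('k::field, word \<Rightarrow>\<^sub>0 'k) module)"
proof (rule ringI)
  show "abelian_group (free_algebra :: ('k, word \<Rightarrow>\<^sub>0 'k) module)"
  proof (rule abelian_groupI)
    fix x :: "word \<Rightarrow>\<^sub>0 'k"
    show "\<exists>y\<in>carrier free_algebra. y \<oplus>\<^bsub>free_algebra\<^esub> x = \<zero>\<^bsub>free_algebra\<^esub>"
      by (simp add: free_algebra_simps) (metis add.left_inverse)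
  qed (simp_all add: free_algebra_simps add_ac)
  show "monoid (free_algebra :: ('k, word \<Rightarrow>\<^sub>0 'k) module)"
    by (rule monoidI) (simp_all add: free_algebra_simps mult.assoc)
qed (simp_all add: free_algebra_simps algebra_simps)

context F1 begin

section \<open>Multiplication operators on families of coefficients, and the map from the free
  algebra\<close>

definition Ld where "Ld = shift_map 1 ld"
definition Rd where "Rd = shift_map 1 rd"
definition Lu where "Lu = shift_map (-1) lu"
definition Ru where "Ru = shift_map (-1) ru"

lemma lookup_ops [simp]:
  "Poly_Mapping.lookup (Ld m) n = ld (n - 1) (Poly_Mapping.lookup m (n - 1))"
  "Poly_Mapping.lookup (Rd m) n = rd (n - 1) (Poly_Mapping.lookup m (n - 1))"
  "Poly_Mapping.lookup (Lu m) n = lu (n + 1) (Poly_Mapping.lookup m (n + 1))"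
  "Poly_Mapping.lookup (Ru m) n = ru (n + 1) (Poly_Mapping.lookup m (n + 1))"
  by (simp_all add: Ld_def Rd_def Lu_def Ru_def lookup_shift_map op_hom)

lemma Op_hom:
  "Ld (m + m') = Ld m + Ld m'" "Rd (m + m') = Rd m + Rd m'" "Lu (m + m') = Lu m + Lu m'" "Ru (m + m') = Ru m + Ru m'"
  "Ld (sM a m) = sM a (Ld m)" "Rd (sM a m) = sM a (Rd m)" "Lu (sM a m) = sM a (Lu m)" "Ru (sM a m) = sM a (Ru m)"
  "Ld 0 = 0" "Rd 0 = 0" "Lu 0 = 0" "Ru 0 = 0"
  "Ld (m - m') = Ld m - Ld m'" "Rd (m - m') = Rd m - Rd m'" "Lu (m - m') = Lu m - Lu m'" "Ru (m - m') = Ru m - Ru m'"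
  by (rule poly_mapping_eqI; simp add: lookup_add lookup_minus op_hom)+

lemma Op_single:
  "Ld (Poly_Mapping.single n f) = Poly_Mapping.single (n + 1) (ld n f)"
  "Rd (Poly_Mapping.single n f) = Poly_Mapping.single (n + 1) (rd n f)"
  "Lu (Poly_Mapping.single n f) = Poly_Mapping.single (n - 1) (lu n f)"
  "Ru (Poly_Mapping.single n f) = Poly_Mapping.single (n - 1) (ru n f)"
  by (rule poly_mapping_eqI; auto simp: lookup_single when_def op_hom)+

lemma Op_commute: "Rd (Ld m) = Ld (Rd m)" "Ru (Ld m) = Ld (Ru m)" "Rd (Lu m) = Lu (Rd m)" "Ru (Lu m) = Lu (Ru m)"
proof -
  have "rd (n - 1) (ld (n - 2) f) = ld (n - 1) (rd (n - 2) f)"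
    "ru (n + 1) (ld n f) = ld (n - 1) (ru n f)" "rd (n - 1) (lu n f) = lu (n + 1) (rd n f)"
    "ru (n + 1) (lu (n + 2) f) = lu (n + 1) (ru (n + 2) f)" for n f
    using op_commute(1)[of "n - 2"] op_commute(2,3)[of n] op_commute(4)[of "n + 2"] by (simp_all add: add.commute)
  then show "Rd (Ld m) = Ld (Rd m)" "Ru (Ld m) = Ld (Ru m)" "Rd (Lu m) = Lu (Rd m)" "Ru (Lu m) = Lu (Ru m)"
    by (auto intro!: poly_mapping_eqI simp: add.commute)
qed

lemma Op_relations:
  "Ld (Ld (Lu m)) = sM \<alpha> (Ld (Lu (Ld m))) + sM \<beta> (Lu (Ld (Ld m)))"
  "Ld (Lu (Lu m)) = sM \<alpha> (Lu (Ld (Lu m))) + sM \<beta> (Lu (Lu (Ld m)))"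
  "Ru (Rd (Rd m)) = sM \<alpha> (Rd (Ru (Rd m))) + sM \<beta> (Rd (Rd (Ru m)))"
  "Ru (Ru (Rd m)) = sM \<alpha> (Ru (Rd (Ru m))) + sM \<beta> (Rd (Ru (Ru m)))"
proof (rule_tac [!] poly_mapping_eqI)
  fix k
  let ?f = "\<lambda>i. Poly_Mapping.lookup m i"
  show "Poly_Mapping.lookup (Ld (Ld (Lu m))) k = Poly_Mapping.lookup (sM \<alpha> (Ld (Lu (Ld m))) + sM \<beta> (Lu (Ld (Ld m)))) k"
    using op_relations(1)[of "k - 1" "?f (k - 1)"] by (simp add: lookup_add add.commute)
  show "Poly_Mapping.lookup (Ld (Lu (Lu m))) k = Poly_Mapping.lookup (sM \<alpha> (Lu (Ld (Lu m))) + sM \<beta> (Lu (Lu (Ld m)))) k"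
    using op_relations(2)[of "k + 1" "?f (k + 1)"] by (simp add: lookup_add add.commute)
  show "Poly_Mapping.lookup (Ru (Rd (Rd m))) k = Poly_Mapping.lookup (sM \<alpha> (Rd (Ru (Rd m))) + sM \<beta> (Rd (Rd (Ru m)))) k"
    using op_relations(3)[of "k - 1" "?f (k - 1)"] by (simp add: lookup_add add.commute)
  show "Poly_Mapping.lookup (Ru (Ru (Rd m))) k = Poly_Mapping.lookup (sM \<alpha> (Ru (Rd (Ru m))) + sM \<beta> (Rd (Ru (Ru m)))) k"
    using op_relations(4)[of "k + 1" "?f (k + 1)"] by (simp add: lookup_add add.commute)
qed

definition v0 :: "'k wpoly" where "v0 = Poly_Mapping.single 0 1"

lemma sg_1 [simp]: "sg n 1 = 1"
  using sg_const2[of n 1] by (simp add: const2_hom)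

lemma Op_v0: "Ld v0 = Rd v0" "Lu v0 = Ru v0"
  unfolding v0_def Op_single by (simp_all add: ops_def)

fun lgen where "lgen Dn = Ld" | "lgen Up = Lu"
fun rgen where "rgen Dn = Rd" | "rgen Up = Ru"

text \<open>A word acts on the unit \<open>v0\<close> through the operators of left multiplication,
  so compatibility with left multiplication is built in.\<close>

definition Phi :: "(word \<Rightarrow>\<^sub>0 'k) \<Rightarrow> 'k wpoly" where
  "Phi = lext (\<lambda>w c. sM c (foldr lgen (letters w) v0))"

lemma Phi_add: "Phi (p + q) = Phi p + Phi q"
  unfolding Phi_def by (rule lext_add) (simp_all add: sM_simps)

lemma Phi_single: "Phi (Poly_Mapping.single w c) = sM c (foldr lgen (letters w) v0)"
  unfolding Phi_def by (rule lext_single) (simp add: sM_simps)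

lemma Phi_0 [simp]: "Phi 0 = 0"
  by (simp add: Phi_def lext_def)

lemma Phi_diff: "Phi (p - q) = Phi p - Phi q"
  using Phi_add[of "p - q" q] by simp

lemma Phi_1: "Phi 1 = v0"
  by (simp add: Phi_single word_plus sM_simps flip: single_one)

lemma Phi_scal: "Phi (scal c * p) = sM c (Phi p)"
  by (induction p rule: poly_mapping_add_induct)
    (simp_all add: scal_def mult_single Phi_single Phi_add sM_simps distrib_left)

lemma Phi_left: "Phi (genD * p) = Ld (Phi p)" "Phi (genU * p) = Lu (Phi p)"
proof -
  have *: "letters (Word v + w) = v @ letters w" for v w by (simp add: plus_word_def)
  show "Phi (genD * p) = Ld (Phi p)" "Phi (genU * p) = Lu (Phi p)"
    by (induction p rule: poly_mapping_add_induct)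
      (simp_all add: monom_word_def mult_single Phi_single Phi_add Op_hom distrib_left *)
qed

text \<open>The right operators commute with the left ones and agree with them on \<open>v0\<close>,
  so a last letter can be carried out through the whole word.\<close>

lemma Phi_right: "Phi (p * genD) = Rd (Phi p)" "Phi (p * genU) = Ru (Phi p)"
proof -
  have *: "letters (w + Word v) = letters w @ v" for v w by (simp add: plus_word_def)
  have r: "foldr lgen ws (Rd m) = Rd (foldr lgen ws m)" "foldr lgen ws (Ru m) = Ru (foldr lgen ws m)" for ws m
  proof (induction ws)
    case (Cons g ws) case 1 from Cons show ?case by (cases g) (simp_all add: Op_commute)
  next
    case (Cons g ws) case 2 from Cons show ?case by (cases g) (simp_all add: Op_commute)
  qed simp_all
  show "Phi (p * genD) = Rd (Phi p)" "Phi (p * genU) = Ru (Phi p)"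
    by (induction p rule: poly_mapping_add_induct)
      (simp_all add: monom_word_def mult_single Phi_single Phi_add Op_hom distrib_right * Op_v0 r)
qed

lemma Phi_word_left: "Phi (monom_word ws * p) = foldr lgen ws (Phi p)"
proof (induction ws)
  case (Cons g ws)
  have "monom_word (g # ws) = monom_word [g] * monom_word ws"
    using monom_word_simps(2)[of "[g]" ws] by simp
  then show ?case unfolding \<open>monom_word (g # ws) = _\<close> mult.assoc
    using Cons Phi_left by (cases g) simp_all
qed (simp add: monom_word_simps)

lemma Phi_word_right: "Phi (p * monom_word ws) = fold rgen ws (Phi p)"
proof (induction ws arbitrary: p)
  case (Cons g ws)
  have "monom_word (g # ws) = monom_word [g] * monom_word ws"
    using monom_word_simps(2)[of "[g]" ws] by simp
  then show ?case unfolding \<open>monom_word (g # ws) = _\<close> mult.assoc[symmetric] Cons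
    using Phi_right by (cases g) simp_all
qed (simp add: monom_word_simps)

text \<open>With its right-hand counterpart this makes the kernel of \<open>Phi\<close> a two-sided
  ideal, without any product on normal forms.\<close>

lemma Phi_ker_left: "Phi p = 0 \<Longrightarrow> Phi (q * p) = 0"
proof (induction q rule: poly_mapping_add_induct)
  case (1 w c)
  have "foldr lgen ws 0 = 0" for ws
  proof (induction ws)
    case (Cons g ws) then show ?case by (cases g) (simp_all add: Op_hom)
  qed simp
  with 1 show ?case by (cases w) (simp add: single_scal mult.assoc Phi_scal Phi_word_left sM_simps)
qed (simp add: distrib_right Phi_add)

lemma Phi_ker_right: "Phi p = 0 \<Longrightarrow> Phi (p * q) = 0"
proof (induction q rule: poly_mapping_add_induct)
  case (1 w c)
  have "fold rgen ws 0 = 0" for ws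
  proof (induction ws)
    case (Cons g ws) then show ?case by (cases g) (simp_all add: Op_hom)
  qed simp
  with 1 show ?case
    by (cases w) (simp add: single_scal scal_left Phi_scal Phi_word_right sM_simps)
qed (simp add: distrib_left Phi_add)

section \<open>The defining ideal lies in the kernel of \<open>Phi\<close>\<close>

abbreviation DU where "DU \<equiv> down_up_ideal \<alpha> \<beta>"

definition rel1 where "rel1 = genD * genD * genU - (scal \<alpha> * (genD * genU * genD) + scal \<beta> * (genU * genD * genD))"
definition rel2 where "rel2 = genD * genU * genU - (scal \<alpha> * (genU * genD * genU) + scal \<beta> * (genU * genU * genD))"

lemma DU_alt: "DU = genideal free_algebra {rel1, rel2}"
  by (simp add: down_up_ideal_def Let_def rel1_def rel2_def scal_def flip: monom_word_simps(2))

lemma ideal_DU: "ideal DU free_algebra"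
  unfolding DU_alt by (rule ring.genideal_ideal[OF ring_free_algebra]) (simp add: free_algebra_simps)

lemma rel_in_DU: "rel1 \<in> DU" "rel2 \<in> DU"
  using ring.genideal_self[OF ring_free_algebra, of "{rel1, rel2}"]
  by (auto simp: DU_alt free_algebra_simps)

lemma DU_0: "0 \<in> DU" and DU_add: "p \<in> DU \<Longrightarrow> q \<in> DU \<Longrightarrow> p + q \<in> DU"
  and DU_left: "p \<in> DU \<Longrightarrow> q * p \<in> DU" and DU_right: "p \<in> DU \<Longrightarrow> p * q \<in> DU"
proof -
  interpret ideal DU free_algebra by (rule ideal_DU)
  show "0 \<in> DU" "p \<in> DU \<Longrightarrow> q \<in> DU \<Longrightarrow> p + q \<in> DU" "p \<in> DU \<Longrightarrow> q * p \<in> DU" "p \<in> DU \<Longrightarrow> p * q \<in> DU"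
    using a_closed zero_closed I_l_closed[of p q] I_r_closed[of p q] additive_subgroup.zero_closed[OF is_additive_subgroup]
      additive_subgroup.a_closed[OF is_additive_subgroup, of p q]
    by (simp_all add: free_algebra_simps)
qed

lemma DU_minus: "p \<in> DU \<Longrightarrow> - p \<in> DU"
  using DU_left[of p "- 1"] by simp

lemma Phi_DU: "p \<in> DU \<Longrightarrow> Phi p = 0"
proof -
  have "ideal {p. Phi p = 0} free_algebra"
  proof (rule idealI[OF ring_free_algebra])
    have "group (add_monoid free_algebra)"
      using ring_free_algebra by (metis abelian_group.a_group ring.is_abelian_group)
    then show "subgroup {p. Phi p = 0} (add_monoid free_algebra)"
    proof (rule group.subgroupI)
      fix a :: "word \<Rightarrow>\<^sub>0 'k" assume a: "a \<in> {p. Phi p = 0}"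
      have "inv\<^bsub>add_monoid free_algebra\<^esub> a = - a"
        using \<open>group (add_monoid free_algebra)\<close>
        by (intro group.inv_equality) (simp_all add: free_algebra_simps)
      then show "inv\<^bsub>add_monoid free_algebra\<^esub> a \<in> {p. Phi p = 0}"
        using a Phi_diff[of 0 a] by simp
    qed (auto simp: free_algebra_simps Phi_add intro: exI[of _ 0])
  qed (simp_all add: Phi_ker_left Phi_ker_right free_algebra_simps)
  moreover have "{rel1, rel2} \<subseteq> {p. Phi p = 0}"
    by (simp add: rel1_def rel2_def Phi_diff Phi_add Phi_scal mult.assoc Phi_left Op_relations)
      (metis Op_relations(1,2) Phi_1 Phi_left mult.right_neutral)
  ultimately have "DU \<subseteq> {p. Phi p = 0}"
    unfolding DU_alt by (rule ring.genideal_minimal[OF ring_free_algebra])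
  then show "p \<in> DU \<Longrightarrow> Phi p = 0" by blast
qed

text \<open>Congruences between elements of the free algebra replace equations between cosets, so
  that ordinary ring rewriting stays available.\<close>

definition cg where "cg p q \<longleftrightarrow> p - q \<in> DU"

lemma cg_refl [simp]: "cg p p" by (simp add: cg_def DU_0)

lemma cg_sym: "cg p q \<Longrightarrow> cg q p"
  using DU_minus[of "p - q"] by (simp add: cg_def)

lemma cg_trans [trans]: "cg p q \<Longrightarrow> cg q r \<Longrightarrow> cg p r"
  using DU_add[of "p - q" "q - r"] by (simp add: cg_def)

lemma cg_add: "cg p q \<Longrightarrow> cg p' q' \<Longrightarrow> cg (p + p') (q + q')"
  using DU_add[of "p - q" "p' - q'"] by (simp add: cg_def algebra_simps)

lemma cg_left: "cg p q \<Longrightarrow> cg (r * p) (r * q)"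
  using DU_left[of "p - q" r] by (simp add: cg_def right_diff_distrib)

lemma cg_right: "cg p q \<Longrightarrow> cg (p * r) (q * r)"
  using DU_right[of "p - q" r] by (simp add: cg_def left_diff_distrib)

section \<open>Rewriting words to normal form modulo the ideal\<close>

definition wt where "wt r = scal \<beta> * (genU * genD) + scal r * (genD * genU)"

lemma roots: "r1 * r1 = \<alpha> * r1 + \<beta>" "r2 * r2 = \<alpha> * r2 + \<beta>"
  by (simp_all add: alpha beta algebra_simps)

text \<open>The difference of the two sides is r times the first relation: the coefficient \<beta> -
  r^2 of dud equals - \<alpha> r because r is a root.\<close>

lemma D_wt: "cg (genD * wt r) (scal r * (wt r * genD))" if "r * r = \<alpha> * r + \<beta>"
proof -
  have "genD * wt r - scal r * (wt r * genD) = scal r * rel1"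
    by (simp add: wt_def rel1_def distrib_left distrib_right right_diff_distrib mult.assoc
        scal_left[of genD] scal_left[of genU]
        scal_simps that scal_minus) (simp add: mult.commute scal_simps distrib_right)
  then show ?thesis
    unfolding cg_def using DU_left[OF rel_in_DU(1)] by metis
qed

lemma wt_U: "cg (wt r * genU) (scal r * (genU * wt r))" if "r * r = \<alpha> * r + \<beta>"
proof -
  have "wt r * genU - scal r * (genU * wt r) = scal r * rel2"
    by (simp add: wt_def rel2_def distrib_left distrib_right right_diff_distrib mult.assoc
        scal_left[of genD] scal_left[of genU]
        scal_simps that scal_minus) (simp add: mult.commute scal_simps distrib_right)
  then show ?thesis
    unfolding cg_def using DU_left[OF rel_in_DU(2)] by metis
qed

lemma U_wt: "cg (genU * wt r) (scal (inverse r) * (wt r * genU))" if "r * r = \<alpha> * r + \<beta>" "r \<noteq> 0"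
proof -
  have "genU * wt r = scal (inverse r) * (scal r * (genU * wt r))"
    using that(2) by (simp add: scal_simps)
  also have "cg \<dots> (scal (inverse r) * (wt r * genU))"
    by (rule cg_left, rule cg_sym, rule wt_U) (rule that)
  finally show ?thesis .
qed

definition w1_elem where "w1_elem = wt r1"
definition w2_elem where "w2_elem = wt r2"

lemma genD_genU: "genD * genU = scal kappa * w1_elem + scal (- kappa) * w2_elem"
proof -
  have "scal kappa * w1_elem + scal (- kappa) * w2_elem = scal (kappa * \<beta> - kappa * \<beta>) * (genU * genD) + scal (kappa * (r1 - r2)) * (genD * genU)"
    by (simp add: w1_elem_def w2_elem_def wt_def distrib_left distrib_right scal_simps scal_minus left_diff_distrib right_diff_distrib)
  then show ?thesis by (simp add: kappa scal_simps)
qed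

lemma genU_genD: "genU * genD = scal (kappa * inverse r1) * w1_elem + scal (- (kappa * inverse r2)) * w2_elem"
proof -
  have "scal (kappa * inverse r1) * w1_elem + scal (- (kappa * inverse r2)) * w2_elem
      = scal (kappa * inverse r1 * \<beta> - kappa * inverse r2 * \<beta>) * (genU * genD) + scal (kappa * inverse r1 * r1 - kappa * inverse r2 * r2) * (genD * genU)"
    by (simp add: w1_elem_def w2_elem_def wt_def distrib_left distrib_right scal_simps scal_minus left_diff_distrib del: left_inverse)
  moreover have "kappa * inverse r1 * \<beta> - kappa * inverse r2 * \<beta> = 1"
    using kappa(1) by (simp add: beta field_simps)
  moreover have "kappa * inverse r1 * r1 - kappa * inverse r2 * r2 = 0" by (simp add: mult.assoc)
  ultimately show ?thesis by (simp add: scal_simps)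
qed

text \<open>w1 commutes with du, since the factors 1 / r1 and r1 picked up at u and d cancel, and w2
  is w1 minus a multiple of du.\<close>

lemma W_commute: "cg (w1_elem * w2_elem) (w2_elem * w1_elem)"
proof -
  have "genD * genU * w1_elem = genD * (genU * w1_elem)" by (simp add: mult.assoc)
  also have "cg \<dots> (genD * (scal (inverse r1) * (w1_elem * genU)))"
    unfolding w1_elem_def by (intro cg_left U_wt roots) simp
  also have "genD * (scal (inverse r1) * (w1_elem * genU)) = scal (inverse r1) * ((genD * w1_elem) * genU)"
    by (simp add: scal_left[of genD] mult.assoc)
  also have "cg \<dots> (scal (inverse r1) * (scal r1 * (w1_elem * genD) * genU))"
    unfolding w1_elem_def by (intro cg_left cg_right D_wt roots)
  also have "scal (inverse r1) * (scal r1 * (w1_elem * genD) * genU) = w1_elem * (genD * genU)"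
    by (simp add: scal_simps mult.assoc)
  finally have "cg (scal (- inverse kappa) * (genD * genU * w1_elem)) (scal (- inverse kappa) * (w1_elem * (genD * genU)))"
    by (rule cg_left)
  then have "cg (w1_elem * w1_elem + scal (- inverse kappa) * (w1_elem * (genD * genU))) (w1_elem * w1_elem + scal (- inverse kappa) * (genD * genU * w1_elem))"
    by (metis cg_add cg_refl cg_sym)
  moreover have "w2_elem = w1_elem + scal (- inverse kappa) * (genD * genU)"
    using kappa(2) by (simp add: genD_genU distrib_left right_diff_distrib scal_simps scal_minus)
  ultimately show ?thesis
    by (simp add: distrib_left distrib_right scal_left[of w1_elem] mult.assoc)
qed

lemma cg_power: "cg (t * w) (scal a * (w * t)) \<Longrightarrow> cg (t * w ^ i) (scal (a ^ i) * (w ^ i * t))"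
proof (induction i)
  case (Suc i)
  have "t * w ^ Suc i = (t * w) * w ^ i" by (simp add: mult.assoc)
  also have "cg \<dots> (scal a * (w * t) * w ^ i)" by (intro cg_right Suc.prems)
  also have "scal a * (w * t) * w ^ i = scal a * w * (t * w ^ i)" by (simp add: mult.assoc)
  also have "cg \<dots> (scal a * w * (scal (a ^ i) * (w ^ i * t)))" by (intro cg_left Suc)
  also have "\<dots> = scal (a ^ Suc i) * (w ^ Suc i * t)" by (simp add: mult.assoc scal_left[of w] scal_simps)
  finally show ?case .
qed (simp add: scal_simps)

lemma cg_power2:
  assumes "cg (t * w1_elem) (scal a * (w1_elem * t))" "cg (t * w2_elem) (scal b * (w2_elem * t))"
  shows "cg (t * (w1_elem ^ i * w2_elem ^ j)) (scal (a ^ i * b ^ j) * (w1_elem ^ i * w2_elem ^ j * t))"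
proof -
  have "t * (w1_elem ^ i * w2_elem ^ j) = t * w1_elem ^ i * w2_elem ^ j" by (simp add: mult.assoc)
  also have "cg \<dots> (scal (a ^ i) * (w1_elem ^ i * t) * w2_elem ^ j)" by (intro cg_right cg_power assms)
  also have "\<dots> = scal (a ^ i) * w1_elem ^ i * (t * w2_elem ^ j)" by (simp add: mult.assoc)
  also have "cg \<dots> (scal (a ^ i) * w1_elem ^ i * (scal (b ^ j) * (w2_elem ^ j * t)))" by (intro cg_left cg_power assms)
  also have "\<dots> = scal (a ^ i * b ^ j) * (w1_elem ^ i * w2_elem ^ j * t)" by (simp add: mult.assoc scal_left[of "w1_elem ^ i"] scal_simps)
  finally show ?thesis .
qed

lemma W_mult_W1: "cg (w1_elem ^ i * w2_elem ^ j * w1_elem) (w1_elem ^ Suc i * w2_elem ^ j)"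
proof -
  have "cg (w1_elem * w2_elem ^ j) (scal (1 ^ j) * (w2_elem ^ j * w1_elem))"
    by (rule cg_power) (simp add: scal_simps W_commute)
  then have "cg (w2_elem ^ j * w1_elem) (w1_elem * w2_elem ^ j)" by (simp add: scal_simps cg_sym)
  then have "cg (w1_elem ^ i * (w2_elem ^ j * w1_elem)) (w1_elem ^ i * (w1_elem * w2_elem ^ j))" by (rule cg_left)
  then show ?thesis by (simp add: mult.assoc power_Suc2 del: power_Suc)
qed

definition vv :: "int \<Rightarrow> word \<Rightarrow>\<^sub>0 'k" where
  "vv n = (if n \<ge> 0 then genD ^ nat n else genU ^ nat (- n))"

lemma vv_step:
  "n \<ge> 0 \<Longrightarrow> genD * vv n = vv (n + 1)" "n < 0 \<Longrightarrow> vv n = genU * vv (n + 1)"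
  "n \<le> 0 \<Longrightarrow> genU * vv n = vv (n - 1)" "n > 0 \<Longrightarrow> vv n = genD * vv (n - 1)"
proof -
  show "n \<ge> 0 \<Longrightarrow> genD * vv n = vv (n + 1)"
    by (simp add: vv_def nat_add_distrib flip: power_Suc)
  show "n < 0 \<Longrightarrow> vv n = genU * vv (n + 1)"
    by (cases "n = -1") (simp_all add: vv_def Suc_nat_eq_nat_zadd1 flip: power_Suc)
  show "n \<le> 0 \<Longrightarrow> genU * vv n = vv (n - 1)"
    by (cases "n = 0") (simp_all add: vv_def Suc_nat_eq_nat_zadd1 flip: power_Suc)
  show "n > 0 \<Longrightarrow> vv n = genD * vv (n - 1)"
    by (simp add: vv_def Suc_nat_eq_nat_zadd1 flip: power_Suc)
qed

text \<open>The element f v_n lifted to the free algebra. The order w1 before w2 is a choice, as the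
  two commute only modulo the ideal.\<close>

definition Nf :: "int \<Rightarrow> 'k poly poly \<Rightarrow> word \<Rightarrow>\<^sub>0 'k" where
  "Nf n f = psum (\<lambda>j. psum (\<lambda>i c. scal c * (w1_elem ^ i * w2_elem ^ j))) f * vv n"

lemma Nf_add: "Nf n (f + g) = Nf n f + Nf n g"
proof -
  have 1: "psum (\<lambda>i c. scal c * (w1_elem ^ i * w2_elem ^ j)) (p + q) = psum (\<lambda>i c. scal c * (w1_elem ^ i * w2_elem ^ j)) p + psum (\<lambda>i c. scal c * (w1_elem ^ i * w2_elem ^ j)) q" for j p q
    by (rule psum_add) (simp_all add: scal_simps distrib_right)
  show ?thesis
    unfolding Nf_def distrib_right[symmetric]
    by (rule arg_cong[where f = "\<lambda>x. x * vv n"], rule psum_add) (simp_all add: 1, simp add: psum_def scal_simps)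
qed

lemma Nf_monom: "Nf n (Polynomial.monom (Polynomial.monom c i) j) = scal c * (w1_elem ^ i * w2_elem ^ j) * vv n"
proof -
  have 0: "psum (\<lambda>i c. scal c * (w1_elem ^ i * w2_elem ^ j)) 0 = 0" for j by (simp add: psum_def scal_simps)
  have "psum (\<lambda>j. psum (\<lambda>i c. scal c * (w1_elem ^ i * w2_elem ^ j))) (Polynomial.monom (Polynomial.monom c i) j)
     = psum (\<lambda>i c. scal c * (w1_elem ^ i * w2_elem ^ j)) (Polynomial.monom c i)"
    by (rule psum_monom) (rule 0)
  also have "\<dots> = scal c * (w1_elem ^ i * w2_elem ^ j)"
    by (rule psum_monom) (simp add: scal_simps)
  finally show ?thesis by (simp add: Nf_def)
qed

lemma Nf_0: "Nf n 0 = 0"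
  using Nf_add[of n 0 0] by simp

lemma diag_monom: "diag e (Polynomial.monom (Polynomial.monom c i) j) = Polynomial.monom (Polynomial.monom (e i j * c) i) j"
  by (rule poly2_eqI) (simp add: co_monom)

lemma lin_monom: "lin p q * Polynomial.monom (Polynomial.monom c i) j
    = Polynomial.monom (Polynomial.monom (p * c) (Suc i)) j + Polynomial.monom (Polynomial.monom (q * c) i) (Suc j)"
  for p :: "'a::comm_ring_1"
  by (rule poly2_eqI) (auto simp: co_lin_mult co_monom)

lemma lin_monom':
  "lin 1 0 * Polynomial.monom (Polynomial.monom c i) j = Polynomial.monom (Polynomial.monom c (Suc i)) j"
  "lin 0 1 * Polynomial.monom (Polynomial.monom c i) j = Polynomial.monom (Polynomial.monom c i) (Suc j)"
  for c :: "'a::comm_ring_1"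
  by (simp_all add: lin_monom)

text \<open>The case where t cancels against the first letter of v_n: the product du or ud is a
  linear form in w1 and w2, hence the factor \<open>lin p q\<close>.\<close>

lemma Nf_step:
  assumes t: "cg (t * w1_elem) (scal a * (w1_elem * t))" "cg (t * w2_elem) (scal b * (w2_elem * t))"
    and v: "t * vv n = (scal p * w1_elem + scal q * w2_elem) * vv n'"
  shows "cg (t * Nf n f) (Nf n' (lin p q * diag (\<lambda>i j. a ^ i * b ^ j) f))"
proof (induction f rule: poly2_induct)
  case (1 c i j)
  let ?w = "w1_elem ^ i * w2_elem ^ j" and ?c = "a ^ i * b ^ j * c"
  have "t * (scal c * ?w * vv n) = scal c * (t * ?w) * vv n"
    by (simp add: scal_left[of t] mult.assoc)
  also have "cg \<dots> (scal c * (scal (a ^ i * b ^ j) * (?w * t)) * vv n)"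
    by (intro cg_left cg_right cg_power2 t)
  also have "\<dots> = scal ?c * ?w * (t * vv n)"
    by (simp add: scal_simps mult.assoc mult.commute[of c] mult.left_commute[of c])
  also have "\<dots> = scal (p * ?c) * (?w * w1_elem) * vv n' + scal (q * ?c) * (w1_elem ^ i * w2_elem ^ Suc j) * vv n'"
    unfolding v by (simp add: distrib_left distrib_right mult.assoc scal_simps power_Suc2
        scal_left[of "w1_elem ^ i"] scal_left[of "w2_elem ^ j"]
        mult.commute[of p] mult.commute[of q] del: power_Suc)
  also have "cg \<dots> (scal (p * ?c) * (w1_elem ^ Suc i * w2_elem ^ j) * vv n' + scal (q * ?c) * (w1_elem ^ i * w2_elem ^ Suc j) * vv n')"
    by (intro cg_left cg_right cg_add cg_refl W_mult_W1)
  finally show ?case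
    by (simp only: Nf_monom diag_monom lin_monom Nf_add)
qed (simp add: Nf_add diag_add distrib_left cg_add)

lemma Nf_step1:
  assumes t: "cg (t * w1_elem) (scal a * (w1_elem * t))" "cg (t * w2_elem) (scal b * (w2_elem * t))"
    and v: "t * vv n = vv n'"
  shows "cg (t * Nf n f) (Nf n' (diag (\<lambda>i j. a ^ i * b ^ j) f))"
proof (induction f rule: poly2_induct)
  case (1 c i j)
  let ?w = "w1_elem ^ i * w2_elem ^ j" and ?c = "a ^ i * b ^ j * c"
  have "t * (scal c * ?w * vv n) = scal c * (t * ?w) * vv n"
    by (simp add: scal_left[of t] mult.assoc)
  also have "cg \<dots> (scal c * (scal (a ^ i * b ^ j) * (?w * t)) * vv n)"
    by (intro cg_left cg_right cg_power2 t)
  also have "\<dots> = scal ?c * ?w * (t * vv n)"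
    by (simp add: scal_simps mult.assoc mult.commute[of c] mult.left_commute[of c])
  finally show ?case
    by (simp only: Nf_monom diag_monom v)
qed (simp add: Nf_add diag_add distrib_left cg_add)

lemma D_W: "cg (genD * w1_elem) (scal r1 * (w1_elem * genD))" "cg (genD * w2_elem) (scal r2 * (w2_elem * genD))"
  and U_W: "cg (genU * w1_elem) (scal (inverse r1) * (w1_elem * genU))" "cg (genU * w2_elem) (scal (inverse r2) * (w2_elem * genU))"
  unfolding w1_elem_def w2_elem_def by (intro D_wt U_wt roots r_nz)+

lemma Nf_ld: "cg (genD * Nf n f) (Nf (n + 1) (ld n f))"
proof (cases "n \<ge> 0")
  case True
  then show ?thesis
    using Nf_step1[OF D_W vv_step(1), of n f] by (simp add: ld_def sg_def)
next
  case False
  have "genD * vv n = (scal kappa * w1_elem + scal (- kappa) * w2_elem) * vv (n + 1)"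
    using False vv_step(2)[of n] by (simp add: mult.assoc flip: genD_genU)
  from Nf_step[OF D_W this, of f] False show ?thesis by (simp add: ld_def sg_def cc_def)
qed

lemma Nf_lu: "cg (genU * Nf n f) (Nf (n - 1) (lu n f))"
proof (cases "n \<le> 0")
  case True
  then show ?thesis
    using Nf_step1[OF U_W vv_step(3), of n f] by (simp add: lu_def sg_def)
next
  case False
  have "genU * vv n = (scal (kappa * inverse r1) * w1_elem + scal (- (kappa * inverse r2)) * w2_elem) * vv (n - 1)"
    using False vv_step(4)[of n] by (simp add: mult.assoc flip: genU_genD)
  from Nf_step[OF U_W this, of f] False show ?thesis
    unfolding lu_def sg_mult sg_cc by (simp add: sg_def cc_def)
qed

definition Psi :: "'k wpoly \<Rightarrow> word \<Rightarrow>\<^sub>0 'k" where "Psi = lext Nf"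

lemma Psi_add: "Psi (m + m') = Psi m + Psi m'"
  unfolding Psi_def by (rule lext_add) (simp_all add: Nf_add Nf_0)

lemma Psi_single: "Psi (Poly_Mapping.single n f) = Nf n f"
  unfolding Psi_def by (rule lext_single) (simp add: Nf_0)

lemma Psi_Op: "cg (genD * Psi m) (Psi (Ld m))" "cg (genU * Psi m) (Psi (Lu m))"
proof -
  show "cg (genD * Psi m) (Psi (Ld m))"
    by (induction m rule: poly_mapping_add_induct)
      (simp_all add: Op_single Psi_single Nf_ld Op_hom Psi_add distrib_left cg_add)
  show "cg (genU * Psi m) (Psi (Lu m))"
    by (induction m rule: poly_mapping_add_induct)
      (simp_all add: Op_single Psi_single Nf_lu Op_hom Psi_add distrib_left cg_add)
qed

text \<open>Every word is congruent to its normal form, by induction on its letters. Together with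
  \<open>Phi_DU\<close> this identifies the ideal with the kernel of \<open>Phi\<close>.\<close>

lemma Psi_Phi: "cg p (Psi (Phi p))"
proof (induction p rule: poly_mapping_add_induct)
  case (1 w c)
  have "cg (Poly_Mapping.single (Word ws) c) (Psi (Phi (Poly_Mapping.single (Word ws) c)))" for ws
  proof (induction ws)
    case Nil
    have "const2 c * 1 = Polynomial.monom (Polynomial.monom c 0) 0"
      by (simp add: const2_def monom_0)
    then have "Psi (Phi (Poly_Mapping.single (Word []) c)) = scal c"
      unfolding Phi_single v0_def
      by (simp add: sM_single Psi_single Nf_monom vv_def del: mult.right_neutral single_one)
    then show ?case by (simp add: scal_def word_plus)
  next
    case (Cons g ws)
    have s: "Poly_Mapping.single (Word (g # ws)) c = monom_word [g] * Poly_Mapping.single (Word ws) c"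
      by (simp add: monom_word_def mult_single word_plus)
    have "cg (monom_word [g] * Poly_Mapping.single (Word ws) c) (monom_word [g] * Psi (Phi (Poly_Mapping.single (Word ws) c)))"
      by (intro cg_left Cons)
    also have "cg \<dots> (Psi (Phi (monom_word [g] * Poly_Mapping.single (Word ws) c)))"
      by (cases g) (simp_all add: Phi_left Psi_Op)
    finally show ?case by (simp add: s)
  qed
  then show ?case by (cases w) simp
qed (simp add: Phi_add Psi_add cg_add)

lemma DU_iff: "p \<in> DU \<longleftrightarrow> Phi p = 0"
proof
  assume "Phi p = 0"
  then have "cg p 0" using Psi_Phi[of p] by (simp add: Psi_def lext_def)
  then show "p \<in> DU" by (simp add: cg_def)
qed (rule Phi_DU)

lemma Phi_W:
  "Phi (w1_elem * p) = sM \<beta> (Lu (Ld (Phi p))) + sM r1 (Ld (Lu (Phi p)))"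
  "Phi (w2_elem * p) = sM \<beta> (Lu (Ld (Phi p))) + sM r2 (Ld (Lu (Phi p)))"
  by (simp_all add: w1_elem_def w2_elem_def wt_def distrib_right mult.assoc Phi_add Phi_scal Phi_left)

lemma Phi_W_single:
  assumes "Phi p = Poly_Mapping.single n f"
  shows "Phi (w1_elem * p) = Poly_Mapping.single n (lin 1 0 * f)" "Phi (w2_elem * p) = Poly_Mapping.single n (lin 0 1 * f)"
  by (simp_all add: Phi_W assms Op_single sM_single op_w1 op_w2 flip: single_add)

lemma Phi_vv: "Phi (vv n) = Poly_Mapping.single n 1"
proof -
  have D: "Phi (genD ^ k) = Poly_Mapping.single (int k) 1" for k
  proof (induction k)
    case (Suc k)
    then show ?case by (simp add: Phi_left Op_single ld_def add.commute)
  qed (simp add: Phi_1 v0_def)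
  have U: "Phi (genU ^ k) = Poly_Mapping.single (- int k) 1" for k
  proof (induction k)
    case (Suc k)
    then show ?case by (simp add: Phi_left Op_single lu_def minus_diff_commute)
  qed (simp add: Phi_1 v0_def)
  show ?thesis using D[of "nat n"] U[of "nat (- n)"] by (auto simp: vv_def)
qed

lemma Phi_Nf: "Phi (Nf n f) = Poly_Mapping.single n f"
proof (induction f rule: poly2_induct)
  case (1 c i j)
  have 0: "(1 :: 'k poly poly) = Polynomial.monom (Polynomial.monom 1 0) 0"
    by (simp add: monom_0 one_pCons)
  have 1: "Phi (w2_elem ^ j * vv n) = Poly_Mapping.single n (Polynomial.monom (Polynomial.monom 1 0) j)"
  proof (induction j)
    case 0 show ?case by (simp add: Phi_vv flip: 0)
  next
    case (Suc j) show ?case using Phi_W_single(2)[OF Suc] by (simp only: power_Suc mult.assoc lin_monom')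
  qed
  have "Phi (w1_elem ^ i * (w2_elem ^ j * vv n)) = Poly_Mapping.single n (Polynomial.monom (Polynomial.monom 1 i) j)"
  proof (induction i)
    case 0 show ?case by (simp add: 1)
  next
    case (Suc i) show ?case using Phi_W_single(1)[OF Suc] by (simp only: power_Suc mult.assoc lin_monom')
  qed
  then have "Phi (Nf n (Polynomial.monom (Polynomial.monom c i) j)) = Poly_Mapping.single n (const2 c * Polynomial.monom (Polynomial.monom 1 i) j)"
    by (simp add: Nf_monom mult.assoc Phi_scal sM_single)
  also have "const2 c * Polynomial.monom (Polynomial.monom 1 i) j = Polynomial.monom (Polynomial.monom c i) j"
    by (rule poly2_eqI) (simp add: co_monom)
  finally show ?case .
qed (simp add: Nf_add Phi_add single_add)

lemma Phi_Psi: "Phi (Psi m) = m"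
  by (induction m rule: poly_mapping_add_induct) (simp_all add: Psi_single Phi_Nf Psi_add Phi_add)

section \<open>The quotient algebra in normal form coordinates\<close>

abbreviation AA where "AA \<equiv> down_up \<alpha> \<beta>"

definition cl :: "(word \<Rightarrow>\<^sub>0 'k) \<Rightarrow> (word \<Rightarrow>\<^sub>0 'k) set" where "cl p = DU +>\<^bsub>free_algebra\<^esub> p"

text \<open>The element of the quotient algebra with normal form \<open>m\<close>.\<close>

definition Gam :: "'k wpoly \<Rightarrow> (word \<Rightarrow>\<^sub>0 'k) set" where "Gam m = {p. Phi p = m}"

text \<open>The ideal is the kernel of \<open>Phi\<close>, so its cosets are the fibres of
  \<open>Phi\<close>.\<close>

lemma cl_eq: "cl p = Gam (Phi p)"
proof -
  have "q \<in> cl p \<longleftrightarrow> (\<exists>h. Phi h = 0 \<and> q = h + p)" for q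
    unfolding cl_def a_r_coset_def' free_algebra_simps DU_iff[symmetric] by blast
  moreover have "(\<exists>h. Phi h = 0 \<and> q = h + p) \<longleftrightarrow> Phi q = Phi p" for q
  proof
    assume "Phi q = Phi p"
    then have "Phi (q - p) = 0 \<and> q = (q - p) + p" by (simp add: Phi_diff)
    then show "\<exists>h. Phi h = 0 \<and> q = h + p" ..
  qed (auto simp: Phi_add)
  ultimately show ?thesis unfolding Gam_def by blast
qed

lemma Gam_eq_cl: "Gam m = cl (Psi m)" by (simp add: cl_eq Phi_Psi)

lemma Gam_inj: "Gam m = Gam m' \<longleftrightarrow> m = m'"
  using Phi_Psi[of m] by (auto simp: Gam_def)

lemma cl_ops:
  "carrier AA = range cl" "\<zero>\<^bsub>AA\<^esub> = cl 0" "\<one>\<^bsub>AA\<^esub> = cl 1"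
  "cl p \<oplus>\<^bsub>AA\<^esub> cl q = cl (p + q)" "cl p \<otimes>\<^bsub>AA\<^esub> cl q = cl (p * q)" "c \<odot>\<^bsub>AA\<^esub> cl p = cl (scal c * p)"
proof -
  note s = down_up_def quot_module_def ring.defs module.defs FactRing_def
  interpret ideal DU free_algebra by (rule ideal_DU)
  show "carrier AA = range cl"
    by (auto simp: s A_RCOSETS_def' cl_def free_algebra_simps)
  show "\<one>\<^bsub>AA\<^esub> = cl 1" by (simp add: s cl_def free_algebra_simps)
  show "\<zero>\<^bsub>AA\<^esub> = cl 0"
    by (auto simp: s cl_eq Gam_def DU_iff)
  show "cl p \<otimes>\<^bsub>AA\<^esub> cl q = cl (p * q)"
    using rcoset_mult_add[of p q] by (simp add: s cl_def free_algebra_simps)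
  show "cl p \<oplus>\<^bsub>AA\<^esub> cl q = cl (p + q)"
    using a_rcos_sum[of p q] by (simp add: s cl_def free_algebra_simps)
  have "c \<odot>\<^bsub>AA\<^esub> cl p = (\<Union>x\<in>cl p. cl (scal c * x))"
    by (simp add: s cl_def free_algebra_simps)
  \<comment> \<open>The quotient defines scalar multiplication as a union over representatives; its
    members all coincide because \<open>Phi\<close> is linear.\<close>
  also have "\<dots> = (\<Union>x\<in>cl p. cl (scal c * p))"
    by (rule SUP_cong) (auto simp: cl_eq Gam_def Phi_scal)
  also have "\<dots> = cl (scal c * p)"
    by (auto simp: cl_eq Gam_def)
  finally show "c \<odot>\<^bsub>AA\<^esub> cl p = cl (scal c * p)" .
qed

lemma gens_cl: "du_d \<alpha> \<beta> = cl genD" "du_u \<alpha> \<beta> = cl genU"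
  by (simp_all add: du_d_def du_u_def cl_def)

lemma Gam_ops:
  "carrier AA = range Gam" "\<zero>\<^bsub>AA\<^esub> = Gam 0" 
  "Gam m \<oplus>\<^bsub>AA\<^esub> Gam m' = Gam (m + m')" "c \<odot>\<^bsub>AA\<^esub> Gam m = Gam (sM c m)"
proof -
  show "carrier AA = range Gam"
    unfolding cl_ops cl_eq using Phi_Psi by (auto simp: image_iff) metis
  show "\<zero>\<^bsub>AA\<^esub> = Gam 0" by (simp add: cl_ops cl_eq)
  show "Gam m \<oplus>\<^bsub>AA\<^esub> Gam m' = Gam (m + m')"
    unfolding Gam_eq_cl[of m] Gam_eq_cl[of m'] cl_ops by (simp add: cl_eq Phi_add Phi_Psi)
  show "c \<odot>\<^bsub>AA\<^esub> Gam m = Gam (sM c m)"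
    unfolding Gam_eq_cl[of m] cl_ops by (simp add: cl_eq Phi_scal Phi_Psi)
qed

lemma cl_mult_Gam: "cl p \<otimes>\<^bsub>AA\<^esub> Gam m = Gam (Phi (p * Psi m))" "Gam m \<otimes>\<^bsub>AA\<^esub> cl p = Gam (Phi (Psi m * p))"
  by (simp_all add: Gam_eq_cl[of m] cl_ops) (simp_all add: cl_eq)

lemma gens_mult_Gam:
  "cl genD \<otimes>\<^bsub>AA\<^esub> Gam m = Gam (Ld m)" "cl genU \<otimes>\<^bsub>AA\<^esub> Gam m = Gam (Lu m)"
  "Gam m \<otimes>\<^bsub>AA\<^esub> cl genD = Gam (Rd m)" "Gam m \<otimes>\<^bsub>AA\<^esub> cl genU = Gam (Ru m)"
  "cl genD \<otimes>\<^bsub>AA\<^esub> cl genD \<otimes>\<^bsub>AA\<^esub> Gam m = Gam (Ld (Ld m))" "cl genD \<otimes>\<^bsub>AA\<^esub> cl genU \<otimes>\<^bsub>AA\<^esub> Gam m = Gam (Ld (Lu m))"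
  "cl genU \<otimes>\<^bsub>AA\<^esub> cl genD \<otimes>\<^bsub>AA\<^esub> Gam m = Gam (Lu (Ld m))" "cl genU \<otimes>\<^bsub>AA\<^esub> cl genU \<otimes>\<^bsub>AA\<^esub> Gam m = Gam (Lu (Lu m))"
  by (simp_all add: cl_mult_Gam cl_ops Phi_left Phi_right mult.assoc Phi_Psi)

lemma abelian_group_AA: "abelian_group AA"
proof (rule abelian_groupI)
  show "\<exists>y\<in>carrier AA. y \<oplus>\<^bsub>AA\<^esub> x = \<zero>\<^bsub>AA\<^esub>" if "x \<in> carrier AA" for x
  proof -
    obtain m where "x = Gam m" using \<open>x \<in> carrier AA\<close> by (auto simp: Gam_ops)
    then show ?thesis by (intro bexI[of _ "Gam (- m)"]) (simp_all add: Gam_ops)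
  qed
qed (auto simp: Gam_ops add_ac)

lemma Gam_minus: "Gam m \<ominus>\<^bsub>AA\<^esub> Gam m' = Gam (m - m')"
proof -
  have "\<ominus>\<^bsub>AA\<^esub> Gam m' = Gam (- m')"
    by (rule abelian_group.minus_equality[OF abelian_group_AA]) (simp_all add: Gam_ops)
  then show ?thesis by (simp add: a_minus_def Gam_ops)
qed

section \<open>The differentials on normal forms\<close>

definition M0u where "M0u m = Lu m - Ru m"
definition M0d where "M0d m = Ld m - Rd m"

definition M1a where
  "M1a g g' = Ld (Ld g) + Ru (Rd g') + Ru (Ld g')
     - sM \<alpha> (Rd (Ld g) + Rd (Ru g') + Ld (Lu g'))
     - sM \<beta> (Rd (Rd g) + Rd (Lu g') + Lu (Ld g'))"

definition M1b where
  "M1b g g' = Ru (Ld g) + Ld (Lu g) + Ru (Ru g')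
     - sM \<alpha> (Ru (Rd g) + Lu (Ld g) + Ru (Lu g'))
     - sM \<beta> (Rd (Ru g) + Rd (Lu g) + Lu (Lu g'))"

definition M2 where "M2 h h' = Ld h' + sM \<beta> (Rd h') - Ru h - sM \<beta> (Lu h)"

lemmas M_def = M0u_def M0d_def M1a_def M1b_def M2_def

lemma M_hom:
  "M0u (m + m') = M0u m + M0u m'" "M0d (m + m') = M0d m + M0d m'"
  "M1a (g + h) (g' + h') = M1a g g' + M1a h h'" "M1b (g + h) (g' + h') = M1b g g' + M1b h h'"
  "M2 (g + h) (g' + h') = M2 g g' + M2 h h'"
  "M0u (sM a m) = sM a (M0u m)" "M0d (sM a m) = sM a (M0d m)"
  "M1a (sM a g) (sM a g') = sM a (M1a g g')" "M1b (sM a g) (sM a g') = sM a (M1b g g')"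
  "M2 (sM a g) (sM a g') = sM a (M2 g g')"
  by (simp_all add: M_def Op_hom sM_simps mult.commute[of a] algebra_simps)

lemma lookup_M:
  "Poly_Mapping.lookup (M0u m) (n - 1) = D0u n (Poly_Mapping.lookup m n)"
  "Poly_Mapping.lookup (M0d m) (n + 1) = D0d n (Poly_Mapping.lookup m n)"
  "Poly_Mapping.lookup (M1a g g') (n + 1) = D1a n (Poly_Mapping.lookup g (n - 1)) (Poly_Mapping.lookup g' (n + 1))"
  "Poly_Mapping.lookup (M1b g g') (n - 1) = D1b n (Poly_Mapping.lookup g (n - 1)) (Poly_Mapping.lookup g' (n + 1))"
  "Poly_Mapping.lookup (M2 h h') n = D2 n (Poly_Mapping.lookup h (n + 1)) (Poly_Mapping.lookup h' (n - 1))"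
  by (simp_all add: M_def D_def lookup_add lookup_minus add.commute)

lemma Delta_Gam:
  "Delta1 AA \<alpha> \<beta> (cl genD) (cl genU) (Gam g) (Gam g') = Gam (M1a g g')"
  "Delta2 AA \<alpha> \<beta> (cl genD) (cl genU) (Gam g) (Gam g') = Gam (M1b g g')"
  by (simp_all add: Delta1_def Delta2_def gens_mult_Gam Gam_ops Gam_minus M_def)

lemma pow_W1: "cl p [^]\<^bsub>AA\<^esub> (k :: nat) = cl (p ^ k)"
  by (induction k) (simp_all add: nat_pow_def cl_ops power_Suc2 del: power_Suc)

lemma w1_cl: "\<beta> \<odot>\<^bsub>AA\<^esub> (cl genU \<otimes>\<^bsub>AA\<^esub> cl genD) \<oplus>\<^bsub>AA\<^esub> r1 \<odot>\<^bsub>AA\<^esub> (cl genD \<otimes>\<^bsub>AA\<^esub> cl genU) = cl w1_elem"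
  by (simp add: cl_ops w1_elem_def wt_def)

lemma Phi_W1_pow: "Phi (w1_elem ^ k) = Poly_Mapping.single 0 [:Polynomial.monom 1 k:]"
  using Phi_Nf[of 0 "Polynomial.monom (Polynomial.monom 1 k) 0", unfolded Nf_monom]
  by (simp add: scal_simps vv_def monom_0)

section \<open>The usual grading\<close>

definition homog_word :: "int \<Rightarrow> (word \<Rightarrow>\<^sub>0 'k) \<Rightarrow> bool" where
  "homog_word D p \<longleftrightarrow> (\<forall>w\<in>Poly_Mapping.keys p. int (length (letters w)) = D)"

lemma hw_add: "homog_word D p \<Longrightarrow> homog_word D q \<Longrightarrow> homog_word D (p + q)"
  using Poly_Mapping.keys_add[of p q] by (auto simp: homog_word_def)

lemma hw_mult: "homog_word D p \<Longrightarrow> homog_word E q \<Longrightarrow> homog_word (D + E) (p * q)"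
  using Poly_Mapping.keys_mult[of p q] by (fastforce simp: homog_word_def plus_word_def)

lemma hw_simps [simp]: "homog_word D 0" "homog_word 1 genD" "homog_word 1 genU" "homog_word 0 1" "homog_word 0 (scal c)"
  by (auto simp: homog_word_def monom_word_def scal_def word_plus simp flip: single_one split: if_splits)

lemma hw_scal: "homog_word D p \<Longrightarrow> homog_word D (scal c * p)"
  using hw_mult[of 0 "scal c" D p] by simp

lemma hw_W1_pow: "homog_word (2 * int k) (w1_elem ^ k)"
proof (induction k)
  case (Suc k)
  have "homog_word (1 + 1) w1_elem" unfolding w1_elem_def wt_def by (intro hw_add hw_scal hw_mult hw_simps)
  then have "homog_word (1 + 1 + 2 * int k) (w1_elem * w1_elem ^ k)" using Suc by (rule hw_mult)
  then show ?case by (simp add: algebra_simps)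
qed simp

lemma du_deg_iff: "cl p \<in> du_deg \<alpha> \<beta> D \<longleftrightarrow> (\<exists>q. cl q = cl p \<and> homog_word D q)"
  by (auto simp: du_deg_def homog_word_def cl_def)

definition hdeg :: "int \<Rightarrow> 'k wpoly \<Rightarrow> bool" where "hdeg D m \<longleftrightarrow> Gam m \<in> du_deg \<alpha> \<beta> D"

lemma hdeg_iff: "hdeg D m \<longleftrightarrow> (\<exists>q. Phi q = m \<and> homog_word D q)"
  unfolding hdeg_def Gam_eq_cl du_deg_iff by (simp add: cl_eq Gam_inj Phi_Psi)

lemma hdeg_add: "hdeg D m \<Longrightarrow> hdeg D m' \<Longrightarrow> hdeg D (m + m')"
  by (metis hdeg_iff hw_add Phi_add)

lemma hdeg_sM: "hdeg D m \<Longrightarrow> hdeg D (sM c m)"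
  by (metis hdeg_iff hw_scal Phi_scal)

lemma hdeg_0: "hdeg D 0"
  unfolding hdeg_iff by (rule exI[of _ 0]) simp

text \<open>Homogeneity in coordinates: x and y have degree 2, and v_n has degree |n|.\<close>

definition homog :: "int \<Rightarrow> 'k wpoly \<Rightarrow> bool" where
  "homog D m \<longleftrightarrow> (\<forall>n i j. co (Poly_Mapping.lookup m n) i j \<noteq> 0 \<longrightarrow> 2 * (int i + int j) + \<bar>n\<bar> = D)"

lemma hom_add: "homog D m \<Longrightarrow> homog D m' \<Longrightarrow> homog D (m + m')"
  unfolding homog_def by (metis co_simps(2) lookup_add add.right_neutral)

text \<open>Either d lengthens v_n, or it cancels a letter u: then |n| drops by 1 while the factor c
  adds 2. Both raise the degree by 1.\<close>

lemma hom_Ld: "homog D m \<Longrightarrow> homog (D + 1) (Ld m)"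
  unfolding homog_def
proof (intro allI impI)
  fix n i j
  assume h: "\<forall>n i j. co (Poly_Mapping.lookup m n) i j \<noteq> 0 \<longrightarrow> 2 * (int i + int j) + \<bar>n\<bar> = D"
    and c: "co (Poly_Mapping.lookup (Ld m) n) i j \<noteq> 0"
  show "2 * (int i + int j) + \<bar>n\<bar> = D + 1"
  proof (cases "n \<ge> 1")
    case True
    then have "co (Poly_Mapping.lookup m (n - 1)) i j \<noteq> 0" using c by (auto simp: ld_def)
    then show ?thesis using h True by fastforce
  next
    case False
    then have "i \<noteq> 0 \<and> co (Poly_Mapping.lookup m (n - 1)) (i - 1) j \<noteq> 0 \<or> j \<noteq> 0 \<and> co (Poly_Mapping.lookup m (n - 1)) i (j - 1) \<noteq> 0"
      using c by (auto simp: ld_def cc_def co_lin_mult split: if_splits)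
    then show ?thesis
      using h[rule_format, of "n - 1" "i - 1" j] h[rule_format, of "n - 1" i "j - 1"] False
      by (auto simp: of_nat_diff)
  qed
qed

lemma hom_Lu: "homog D m \<Longrightarrow> homog (D + 1) (Lu m)"
  unfolding homog_def
proof (intro allI impI)
  fix n i j
  assume h: "\<forall>n i j. co (Poly_Mapping.lookup m n) i j \<noteq> 0 \<longrightarrow> 2 * (int i + int j) + \<bar>n\<bar> = D"
    and c: "co (Poly_Mapping.lookup (Lu m) n) i j \<noteq> 0"
  show "2 * (int i + int j) + \<bar>n\<bar> = D + 1"
  proof (cases "n \<le> -1")
    case True
    then have "co (Poly_Mapping.lookup m (n + 1)) i j \<noteq> 0" using c by (auto simp: lu_def)
    then show ?thesis using h True by fastforce
  next
    case False
    then have "i \<noteq> 0 \<and> co (Poly_Mapping.lookup m (n + 1)) (i - 1) j \<noteq> 0 \<or> j \<noteq> 0 \<and> co (Poly_Mapping.lookup m (n + 1)) i (j - 1) \<noteq> 0"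
      using c by (auto simp: lu_def cc_def co_lin_mult split: if_splits)
    then show ?thesis
      using h[rule_format, of "n + 1" "i - 1" j] h[rule_format, of "n + 1" i "j - 1"] False
      by (auto simp: of_nat_diff)
  qed
qed

lemma hom_foldr: "homog (int (length ws)) (foldr lgen ws v0)"
proof (induction ws)
  case Nil show ?case
    by (auto simp: homog_def v0_def lookup_single when_def co_const2 simp flip: const2_hom(2) split: if_splits)
next
  case (Cons g ws) then show ?case
    using hom_Ld[OF Cons] hom_Lu[OF Cons] by (cases g) (simp_all add: add.commute)
qed

lemma hw_hom: "homog_word D p \<Longrightarrow> homog D (Phi p)"
proof -
  assume D: "homog_word D p"
  have "homog D (\<Sum>w\<in>A. sM (Poly_Mapping.lookup p w) (foldr lgen (letters w) v0))"
    if "finite A" "A \<subseteq> Poly_Mapping.keys p" for A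
    using that
  proof (induction A rule: finite_induct)
    case empty show ?case by (simp add: homog_def)
  next
    case (insert w A)
    have "homog D (foldr lgen (letters w) v0)"
      using hom_foldr[of "letters w"] D insert by (auto simp: homog_word_def)
    then have "homog D (sM (Poly_Mapping.lookup p w) (foldr lgen (letters w) v0))"
      by (auto simp: homog_def)
    then show ?case using insert by (simp add: hom_add)
  qed
  then show ?thesis by (simp add: Phi_def lext_def)
qed

lemma hdeg_hom: "hdeg D m \<Longrightarrow> homog D m"
  using hw_hom by (auto simp: hdeg_iff)

end

section \<open>Bases of quotient modules\<close>

text \<open>The module \<open>C\<close> of cochains is a copy, through \<open>\<theta>\<close>, of a type carrying a vector space structure.\<close>

locale quot_transport = vector_space sc
  for sc :: "'k::field \<Rightarrow> 'v::ab_group_add \<Rightarrow> 'v" +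
  fixes C :: "('k, 'c) module" and \<theta> :: "'v \<Rightarrow> 'c" and Z B :: "'v set"
  assumes C: "carrier C = range \<theta>" "\<zero>\<^bsub>C\<^esub> = \<theta> 0" "\<And>x y. \<theta> x \<oplus>\<^bsub>C\<^esub> \<theta> y = \<theta> (x + y)" "\<And>c x. c \<odot>\<^bsub>C\<^esub> \<theta> x = \<theta> (sc c x)"
    and \<theta>_inj: "inj \<theta>"
    and Z: "subspace Z" and B: "subspace B" and BZ: "B \<subseteq> Z"
begin

definition H :: "('k, 'c set) module" where "H = quot_module (C\<lparr>carrier := \<theta> ` Z\<rparr>) (\<theta> ` B)"

definition pr :: "'v \<Rightarrow> 'c set" where "pr x = \<theta> ` B +>\<^bsub>C\<^esub> \<theta> x"

lemma pr_eq: "pr x = \<theta> ` {y. y - x \<in> B}"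
proof -
  have "pr x = \<theta> ` ((\<lambda>b. b + x) ` B)"
    by (auto simp: pr_def a_r_coset_def' C)
  also have "(\<lambda>b. b + x) ` B = {y. y - x \<in> B}"
    by (auto simp: image_iff) (metis diff_add_cancel)
  finally show ?thesis .
qed

lemma pr_eq_iff: "pr x = pr y \<longleftrightarrow> x - y \<in> B"
proof
  assume "pr x = pr y"
  then have "{z. z - x \<in> B} = {z. z - y \<in> B}"
    unfolding pr_eq by (metis \<theta>_inj inj_image_eq_iff)
  moreover have "x \<in> {z. z - x \<in> B}" using subspace_0[OF B] by simp
  ultimately show "x - y \<in> B" by blast
next
  assume "x - y \<in> B"
  then have "z - x \<in> B \<longleftrightarrow> z - y \<in> B" for z
    using subspace_add[OF B, of "z - x" "x - y"] subspace_diff[OF B, of "z - y" "x - y"] by auto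
  then show "pr x = pr y" by (simp add: pr_eq)
qed

lemma pr_diff: "x - y \<in> B \<Longrightarrow> pr x = pr y" by (simp add: pr_eq_iff)

lemma H_ops:
  "carrier H = pr ` Z" "\<zero>\<^bsub>H\<^esub> = pr 0" "pr x \<oplus>\<^bsub>H\<^esub> pr y = pr (x + y)" "c \<odot>\<^bsub>H\<^esub> pr x = pr (sc c x)"
proof -
  note s = H_def quot_module_def ring.defs module.defs FactRing_def
  have coset: "\<theta> ` B +>\<^bsub>C\<lparr>carrier := \<theta> ` Z\<rparr>\<^esub> X = \<theta> ` B +>\<^bsub>C\<^esub> X" for X
    by (simp add: a_r_coset_def')
  show "carrier H = pr ` Z"
    by (auto simp: s A_RCOSETS_def' coset pr_def)
  show "\<zero>\<^bsub>H\<^esub> = pr 0" by (simp add: s pr_eq)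
  have "pr x \<oplus>\<^bsub>H\<^esub> pr y = (\<Union>a\<in>{z. z - x \<in> B}. \<Union>b\<in>{z. z - y \<in> B}. {\<theta> (a + b)})"
    by (simp add: s set_add_def' pr_eq C)
  also have "\<dots> = \<theta> ` {z. z - (x + y) \<in> B}"
  proof (intro equalityI subsetI)
    fix t assume "t \<in> (\<Union>a\<in>{z. z - x \<in> B}. \<Union>b\<in>{z. z - y \<in> B}. {\<theta> (a + b)})"
    then obtain a b where ab: "a - x \<in> B" "b - y \<in> B" "t = \<theta> (a + b)" by blast
    then have "(a + b) - (x + y) \<in> B" using subspace_add[OF B ab(1,2)] by (simp add: algebra_simps)
    then show "t \<in> \<theta> ` {z. z - (x + y) \<in> B}" using ab(3) by blast
  next
    fix t assume "t \<in> \<theta> ` {z. z - (x + y) \<in> B}"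
    then obtain z where z: "z - (x + y) \<in> B" "t = \<theta> z" by blast
    then have "z - y - x \<in> B" "y - y \<in> B" "t = \<theta> ((z - y) + y)"
      using subspace_0[OF B] by (simp_all add: algebra_simps)
    then show "t \<in> (\<Union>a\<in>{z. z - x \<in> B}. \<Union>b\<in>{z. z - y \<in> B}. {\<theta> (a + b)})" by blast
  qed
  finally show "pr x \<oplus>\<^bsub>H\<^esub> pr y = pr (x + y)" by (simp add: pr_eq)
  have "c \<odot>\<^bsub>H\<^esub> pr x = (\<Union>t\<in>pr x. \<theta> ` B +>\<^bsub>C\<^esub> (c \<odot>\<^bsub>C\<^esub> t))"
    by (simp add: s coset)
  also have "\<dots> = (\<Union>z\<in>{z. z - x \<in> B}. pr (sc c z))"
    unfolding pr_eq[of x] by (simp add: pr_def C)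
  also have "\<dots> = (\<Union>z\<in>{z. z - x \<in> B}. pr (sc c x))"
    by (rule SUP_cong) (simp_all add: pr_eq_iff subspace_scale[OF B] flip: scale_right_diff_distrib)
  also have "\<dots> = pr (sc c x)"
  proof -
    have "x \<in> {z. z - x \<in> B}" using subspace_0[OF B] by simp
    then show ?thesis by blast
  qed
  finally show "c \<odot>\<^bsub>H\<^esub> pr x = pr (sc c x)" .
qed

text \<open>For \<open>W = Z\<close> this is the whole cohomology, and for the cocycles of one
  degree a graded piece, so one basis criterion covers both.\<close>

definition HW :: "'v set \<Rightarrow> ('k, 'c set) module" where "HW W = H\<lparr>carrier := pr ` W\<rparr>"

lemma HW_Z: "HW Z = H"
  unfolding HW_def H_ops(1)[symmetric] by simp

lemma HW_ops:
  "carrier (HW W) = pr ` W" "\<zero>\<^bsub>HW W\<^esub> = pr 0" "pr x \<oplus>\<^bsub>HW W\<^esub> pr y = pr (x + y)" "c \<odot>\<^bsub>HW W\<^esub> pr x = pr (sc c x)"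
  by (simp_all add: HW_def H_ops)

lemma vectorspace_HW:
  assumes W: "subspace W"
  shows "vectorspace class_ring (HW W)"
proof -
  have "abelian_group (HW W)"
  proof (rule abelian_groupI)
    fix t assume "t \<in> carrier (HW W)"
    then obtain x where "x \<in> W" "t = pr x" by (auto simp: HW_ops)
    then show "\<exists>y\<in>carrier (HW W). y \<oplus>\<^bsub>HW W\<^esub> t = \<zero>\<^bsub>HW W\<^esub>"
      using subspace_neg[OF W] by (intro bexI[of _ "pr (- x)"]) (auto simp: HW_ops)
  qed (use subspace_add[OF W] subspace_0[OF W] in \<open>auto simp: HW_ops add_ac\<close>)
  moreover have "field (class_ring :: 'k ring)" by (rule class_field)
  ultimately have "module class_ring (HW W)"
    by (intro moduleI fieldE(1)) (auto simp: HW_ops subspace_scale[OF W] scale_left_distrib scale_right_distrib)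
  then show ?thesis using \<open>field class_ring\<close> by (rule vectorspace.intro)
qed

lemma basis_HW:
  assumes W: "subspace W" "W \<subseteq> Z" and e: "\<And>j. j \<in> J \<Longrightarrow> e j \<in> W"
    and span: "\<And>x. x \<in> W \<Longrightarrow> \<exists>F a. finite F \<and> F \<subseteq> J \<and> x - (\<Sum>j\<in>F. sc (a j) (e j)) \<in> B"
    and indep: "\<And>F a. finite F \<Longrightarrow> F \<subseteq> J \<Longrightarrow> (\<Sum>j\<in>F. sc (a j) (e j)) \<in> B \<Longrightarrow> \<forall>j\<in>F. a j = 0"
  shows "inj_on (\<lambda>j. pr (e j)) J" "vectorspace.basis class_ring (HW W) ((\<lambda>j. pr (e j)) ` J)"
proof -
  interpret V: vectorspace class_ring "HW W" by (rule vectorspace_HW[OF W(1)])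
  let ?p = "\<lambda>j. pr (e j)"
  show inj: "inj_on ?p J"
  proof (rule inj_onI, rule ccontr)
    fix i j assume ij: "i \<in> J" "j \<in> J" "?p i = ?p j" "i \<noteq> j"
    \<comment> \<open>Two indices with the same class would give the relation with coefficients 1
      and -1, so injectivity follows from independence.\<close>
    let ?a = "\<lambda>k. if k = i then 1 else -1 :: 'k"
    have "(\<Sum>k\<in>{i, j}. sc (?a k) (e k)) = e i - e j" using ij by auto
    then have "(\<Sum>k\<in>{i, j}. sc (?a k) (e k)) \<in> B" using ij by (simp add: pr_eq_iff)
    from indep[of "{i, j}" ?a, OF _ _ this] ij show False by auto
  qed
  have comb: "V.lincomb a (?p ` F) = pr (\<Sum>j\<in>F. sc (a (?p j)) (e j))" if "finite F" "F \<subseteq> J" for a F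
    using that
  proof (induction F rule: finite_induct)
    case empty show ?case by (simp add: V.lincomb_def HW_ops)
  next
    case (insert j F)
    have "?p j \<notin> ?p ` F"
      using insert inj by (auto simp: inj_on_def)
    moreover have "(\<lambda>v. a v \<odot>\<^bsub>HW W\<^esub> v) \<in> ?p ` F \<rightarrow> carrier (HW W)" "a (?p j) \<odot>\<^bsub>HW W\<^esub> ?p j \<in> carrier (HW W)"
      using insert e by (auto simp: HW_ops subspace_scale[OF W(1)])
    ultimately have "V.lincomb a (?p ` insert j F) = a (?p j) \<odot>\<^bsub>HW W\<^esub> ?p j \<oplus>\<^bsub>HW W\<^esub> V.lincomb a (?p ` F)"
      using insert unfolding V.lincomb_def image_insert by (intro V.finsum_insert) auto
    then show ?case using insert by (simp add: HW_ops)
  qed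
  have sub: "?p ` J \<subseteq> carrier (HW W)" using e by (auto simp: HW_ops)
  have "V.span (?p ` J) = carrier (HW W)"
  proof (intro equalityI subsetI)
    show "v \<in> carrier (HW W)" if "v \<in> V.span (?p ` J)" for v
      using V.span_is_subset2[OF sub] that by blast
  next
    fix v assume "v \<in> carrier (HW W)"
    then obtain x where x: "x \<in> W" "v = pr x" by (auto simp: HW_ops)
    then obtain F a where F: "finite F" "F \<subseteq> J" "x - (\<Sum>j\<in>F. sc (a j) (e j)) \<in> B"
      using span by blast
    \<comment> \<open>Linear combinations take coefficients indexed by classes, so the index is
      recovered from its class by injectivity.\<close>
    let ?a = "\<lambda>v. a (the_inv_into J ?p v)"
    have "V.lincomb ?a (?p ` F) = pr (\<Sum>j\<in>F. sc (?a (?p j)) (e j))" by (rule comb[OF F(1,2)])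
    also have "(\<Sum>j\<in>F. sc (?a (?p j)) (e j)) = (\<Sum>j\<in>F. sc (a j) (e j))"
      using F(2) by (intro sum.cong) (auto simp: the_inv_into_f_f[OF inj])
    also have "pr \<dots> = v" using x F by (metis pr_diff)
    finally show "v \<in> V.span (?p ` J)"
      unfolding V.span_def using F by (auto intro!: exI[of _ ?a] exI[of _ "?p ` F"])
  qed
  moreover have "\<not> V.lin_dep (?p ` J)"
  proof
    assume "V.lin_dep (?p ` J)"
    then obtain A a v where A: "finite A" "A \<subseteq> ?p ` J" "V.lincomb a A = \<zero>\<^bsub>HW W\<^esub>" "v \<in> A" "a v \<noteq> 0"
      unfolding V.lin_dep_def by auto
    then obtain F where F: "finite F" "F \<subseteq> J" "A = ?p ` F" by (meson finite_subset_image)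
    then obtain j where j: "j \<in> F" "v = ?p j" using A by blast
    have "(\<Sum>j\<in>F. sc (a (?p j)) (e j)) \<in> B"
      using comb[OF F(1,2), of a] A(3) F(3) by (simp add: HW_ops pr_eq_iff)
    from indep[OF F(1,2) this] A j show False by simp
  qed
  ultimately show "vectorspace.basis class_ring (HW W) (?p ` J)"
    using sub by (simp add: V.basis_def)
qed

lemma basis_H:
  assumes "\<And>j. j \<in> J \<Longrightarrow> e j \<in> Z"
    and "\<And>x. x \<in> Z \<Longrightarrow> \<exists>F a. finite F \<and> F \<subseteq> J \<and> x - (\<Sum>j\<in>F. sc (a j) (e j)) \<in> B"
    and "\<And>F a. finite F \<Longrightarrow> F \<subseteq> J \<Longrightarrow> (\<Sum>j\<in>F. sc (a j) (e j)) \<in> B \<Longrightarrow> \<forall>j\<in>F. a j = 0"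
  shows "inj_on (\<lambda>f. \<theta> ` B +>\<^bsub>C\<^esub> f) ((\<lambda>j. \<theta> (e j)) ` J)"
    and "vectorspace.basis class_ring H ((\<lambda>f. \<theta> ` B +>\<^bsub>C\<^esub> f) ` (\<lambda>j. \<theta> (e j)) ` J)"
  using basis_HW[where W = Z and J = J and e = e, OF Z order_refl assms]
  unfolding HW_Z pr_def by (auto intro!: inj_on_imageI simp: comp_def image_image)

lemma dim_HW:
  assumes "finite J" "subspace W" "W \<subseteq> Z" and "\<And>j. j \<in> J \<Longrightarrow> e j \<in> W"
    and "\<And>x. x \<in> W \<Longrightarrow> \<exists>F a. finite F \<and> F \<subseteq> J \<and> x - (\<Sum>j\<in>F. sc (a j) (e j)) \<in> B"
    and "\<And>F a. finite F \<Longrightarrow> F \<subseteq> J \<Longrightarrow> (\<Sum>j\<in>F. sc (a j) (e j)) \<in> B \<Longrightarrow> \<forall>j\<in>F. a j = 0"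
  shows "vectorspace.fin_dim class_ring (HW W)" "vectorspace.dim class_ring (HW W) = card J"
proof -
  interpret V: vectorspace class_ring "HW W" by (rule vectorspace_HW[OF assms(2)])
  note b = basis_HW[where W = W and J = J and e = e, OF assms(2-)]
  show "V.fin_dim"
    unfolding V.fin_dim_def using b(2)[unfolded V.basis_def] assms(1)
    by (intro exI[of _ "(\<lambda>j. pr (e j)) ` J"]) simp
  show "V.dim = card J"
    using V.dim_basis[OF _ b(2)] assms(1) card_image[OF b(1)] by simp
qed

end

section \<open>Cohomology\<close>

lemma wpoly_of_fun:
  assumes "finite A" "\<And>n. n \<notin> A \<Longrightarrow> F n = 0"
  shows "\<exists>m. \<forall>n. Poly_Mapping.lookup m (n + s :: int) = F n"
proof -
  have "Poly_Mapping.lookup (Abs_poly_mapping (\<lambda>k. F (k - s))) = (\<lambda>k. F (k - s))"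
  proof (rule lookup_Abs_finite[of "(\<lambda>n. n + s) ` A"])
    fix k assume "k \<notin> (\<lambda>n. n + s) ` A"
    then have "k - s \<notin> A" by (metis diff_add_cancel imageI)
    then show "F (k - s) = 0" by (rule assms(2))
  qed (simp add: assms(1))
  then show ?thesis by (intro exI[of _ "Abs_poly_mapping (\<lambda>k. F (k - s))"]) simp
qed

text \<open>Glues solutions chosen weight by weight. Outside a finite set of weights 0 is a
  solution, which keeps the support finite.\<close>

lemma choose_wpoly:
  assumes "finite A" "\<And>n. \<exists>f. Q n f" "\<And>n. n \<notin> A \<Longrightarrow> Q n 0"
  shows "\<exists>m. \<forall>n :: int. Q n (Poly_Mapping.lookup m n)"
proof -
  define F where "F n = (if n \<in> A then SOME f. Q n f else 0)" for n
  obtain m where "\<And>n. Poly_Mapping.lookup m (n + 0) = F n"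
    using wpoly_of_fun[of A F 0] assms(1) by (auto simp: F_def)
  moreover have "Q n (F n)" for n
    using someI_ex[OF assms(2)[of n]] assms(3)[of n] by (simp add: F_def)
  ultimately show ?thesis by (intro exI[of _ m]) simp
qed

text \<open>The shifts account for the two components of a cochain of weight n being stored at n - 1
  and n + 1.\<close>

lemma choose_wpoly2:
  assumes "finite A" "\<And>n. \<exists>f f'. Q n f f'" "\<And>n. n \<notin> A \<Longrightarrow> Q n 0 0"
  shows "\<exists>m m'. \<forall>n :: int. Q n (Poly_Mapping.lookup m (n + s)) (Poly_Mapping.lookup m' (n + s'))"
proof -
  define P where "P n = (if n \<in> A then SOME x. Q n (fst x) (snd x) else (0, 0))" for n
  obtain m where m: "\<And>n. Poly_Mapping.lookup m (n + s) = fst (P n)"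
    using wpoly_of_fun[of A "\<lambda>n. fst (P n)" s] assms(1) by (auto simp: P_def)
  obtain m' where m': "\<And>n. Poly_Mapping.lookup m' (n + s') = snd (P n)"
    using wpoly_of_fun[of A "\<lambda>n. snd (P n)" s'] assms(1) by (auto simp: P_def)
  have "\<exists>x. Q n (fst x) (snd x)" for n using assms(2)[of n] by auto
  then have "Q n (fst (P n)) (snd (P n))" for n
    using someI_ex[of "\<lambda>x. Q n (fst x) (snd x)"] assms(3)[of n] by (simp add: P_def)
  then show ?thesis using m m' by (intro exI[of _ m] exI[of _ m']) simp
qed

context F1 begin

section \<open>Assembling the weights\<close>

lemma lookup_M':
  "Poly_Mapping.lookup (M0u m) k = D0u (k + 1) (Poly_Mapping.lookup m (k + 1))"
  "Poly_Mapping.lookup (M0d m) k = D0d (k - 1) (Poly_Mapping.lookup m (k - 1))"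
  "Poly_Mapping.lookup (M1a g g') k = D1a (k - 1) (Poly_Mapping.lookup g (k - 2)) (Poly_Mapping.lookup g' k)"
  "Poly_Mapping.lookup (M1b g g') k = D1b (k + 1) (Poly_Mapping.lookup g k) (Poly_Mapping.lookup g' (k + 2))"
  using lookup_M(1)[of m "k + 1"] lookup_M(2)[of m "k - 1"] lookup_M(3)[of g g' "k - 1"] lookup_M(4)[of g g' "k + 1"]
  by (simp_all add: add.commute)

lemma M1_M0: "M1a (M0u m) (M0d m) = 0" "M1b (M0u m) (M0d m) = 0"
proof -
  have "Poly_Mapping.lookup (M1a (M0u m) (M0d m)) (n + 1) = 0" "Poly_Mapping.lookup (M1b (M0u m) (M0d m)) (n - 1) = 0" for n
    unfolding lookup_M by (rule D1_D0)+
  from this(1)[of "k - 1" for k] this(2)[of "k + 1" for k]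
  show "M1a (M0u m) (M0d m) = 0" "M1b (M0u m) (M0d m) = 0"
    by (auto intro!: poly_mapping_eqI)
qed

lemma M2_M1: "M2 (M1a g g') (M1b g g') = 0"
  by (rule poly_mapping_eqI) (simp add: lookup_M D2_D1)

lemma Z0_form:
  assumes "M0u m = 0" "M0d m = 0"
  shows "m = sM (co (Poly_Mapping.lookup m 0) 0 0) v0"
proof (rule poly_mapping_eqI)
  fix n
  have D: "D0u n (Poly_Mapping.lookup m n) = 0" "D0d n (Poly_Mapping.lookup m n) = 0"
    using lookup_M(1,2)[of m n] assms by simp_all
  show "Poly_Mapping.lookup m n = Poly_Mapping.lookup (sM (co (Poly_Mapping.lookup m 0) 0 0) v0) n"
  proof (cases "n = 0")
    case True
    have "Poly_Mapping.lookup m 0 = const2 (co (Poly_Mapping.lookup m 0) 0 0)"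
      using D zeroth_cocycle unfolding True by blast
    then show ?thesis
      unfolding True lookup_sM v0_def lookup_single_eq mult_1_right .
  next
    case False
    then show ?thesis using exact0[OF False D] by (simp add: v0_def lookup_single when_def lookup_one)
  qed
qed

lemma M0_v0: "M0u v0 = 0" "M0d v0 = 0"
  by (simp_all add: M0u_def M0d_def Op_v0)

lemma Z1_form:
  assumes "M1a g g' = 0" "M1b g g' = 0"
  shows "\<exists>m. g = M0u m + Poly_Mapping.single (-1) (const2 (co (Poly_Mapping.lookup g (-1)) 0 0)) \<and>
    g' = M0d m + Poly_Mapping.single 1 (const2 (co (Poly_Mapping.lookup g' 1) 0 0))"
proof -
  define l where "l = co (Poly_Mapping.lookup g (-1)) 0 0"
  define l' where "l' = co (Poly_Mapping.lookup g' 1) 0 0"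
  define Q where "Q n f \<longleftrightarrow> Poly_Mapping.lookup g (n - 1) = D0u n f + (if n = 0 then const2 l else 0) \<and>
    Poly_Mapping.lookup g' (n + 1) = D0d n f + (if n = 0 then const2 l' else 0)" for n f
  \<comment> \<open>Outside A both components of the cocycle vanish; weight 0 is included because it
    carries the two constants.\<close>
  define A where "A = {0} \<union> (\<lambda>k. k + 1) ` Poly_Mapping.keys g \<union> (\<lambda>k. k - 1) ` Poly_Mapping.keys g'"
  have D: "D1a n (Poly_Mapping.lookup g (n - 1)) (Poly_Mapping.lookup g' (n + 1)) = 0"
    "D1b n (Poly_Mapping.lookup g (n - 1)) (Poly_Mapping.lookup g' (n + 1)) = 0" for n
    using lookup_M(3,4)[of g g' n] assms by simp_all
  have "\<exists>m. \<forall>n. Q n (Poly_Mapping.lookup m n)"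
  proof (rule choose_wpoly)
    show "finite A" by (simp add: A_def)
    show "\<exists>f. Q n f" for n
    proof (cases "n = 0")
      case True
      obtain f a b where f: "Poly_Mapping.lookup g (-1) = D0u 0 f + const2 a" "Poly_Mapping.lookup g' 1 = D0d 0 f + const2 b"
        using first_cocycle[of "Poly_Mapping.lookup g (-1)" "Poly_Mapping.lookup g' 1"] D[of 0] by auto
      then have "l = a" "l' = b" by (simp_all add: l_def l'_def co_D0_zero co_const2)
      then show ?thesis using f True by (auto simp: Q_def)
    next
      case False
      obtain f where "D0u n f = Poly_Mapping.lookup g (n - 1)" "D0d n f = Poly_Mapping.lookup g' (n + 1)"
        using exact1[OF False D] by blast
      then show ?thesis using False by (intro exI[of _ f]) (simp add: Q_def)
    qed
    show "Q n 0" if "n \<notin> A" for n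
    proof -
      have "n \<noteq> 0" "n - 1 \<notin> Poly_Mapping.keys g" "n + 1 \<notin> Poly_Mapping.keys g'"
        using that unfolding A_def by (auto simp: image_iff)
      then show ?thesis by (simp add: Q_def in_keys_iff)
    qed
  qed
  then obtain m where m: "\<And>n. Q n (Poly_Mapping.lookup m n)" by blast
  have "g = M0u m + Poly_Mapping.single (-1) (const2 l)"
  proof (rule poly_mapping_eqI)
    fix k show "Poly_Mapping.lookup g k = Poly_Mapping.lookup (M0u m + Poly_Mapping.single (-1) (const2 l)) k"
      using m[of "k + 1"] by (auto simp: Q_def lookup_M' lookup_add lookup_single when_def split: if_splits)
  qed
  moreover have "g' = M0d m + Poly_Mapping.single 1 (const2 l')"
  proof (rule poly_mapping_eqI)
    fix k show "Poly_Mapping.lookup g' k = Poly_Mapping.lookup (M0d m + Poly_Mapping.single 1 (const2 l')) k"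
      using m[of "k - 1"] by (auto simp: Q_def lookup_M' lookup_add lookup_single when_def split: if_splits)
  qed
  ultimately show ?thesis unfolding l_def l'_def by blast
qed

text \<open>Coboundaries of weight 0 have no constant term, since sigma fixes constants.\<close>

lemma B1_unique:
  assumes "Poly_Mapping.single (-1) (const2 l) = M0u m" "Poly_Mapping.single 1 (const2 l') = M0d m"
  shows "l = 0" "l' = 0"
proof -
  have "const2 l = D0u 0 (Poly_Mapping.lookup m 0)" "const2 l' = D0d 0 (Poly_Mapping.lookup m 0)"
    using arg_cong[OF assms(1), of "\<lambda>m. Poly_Mapping.lookup m (-1)"] arg_cong[OF assms(2), of "\<lambda>m. Poly_Mapping.lookup m 1"]
    by (simp_all add: lookup_M')
  then have "co (const2 l) 0 0 = 0" "co (const2 l') 0 0 = 0" by (simp_all add: co_D0_zero)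
  then show "l = 0" "l' = 0" by (simp_all add: co_const2)
qed

lemma Z1_basis: "M1a (Poly_Mapping.single (-1) (const2 l)) (Poly_Mapping.single 1 (const2 l')) = 0"
  "M1b (Poly_Mapping.single (-1) (const2 l)) (Poly_Mapping.single 1 (const2 l')) = 0"
proof -
  show "M1a (Poly_Mapping.single (-1) (const2 l)) (Poly_Mapping.single 1 (const2 l')) = 0"
    by (rule poly_mapping_eqI) (auto simp: lookup_M' lookup_single when_def first_cocycle_const)
  show "M1b (Poly_Mapping.single (-1) (const2 l)) (Poly_Mapping.single 1 (const2 l')) = 0"
  proof (rule poly_mapping_eqI)
    fix k
    show "Poly_Mapping.lookup (M1b (Poly_Mapping.single (-1) (const2 l)) (Poly_Mapping.single 1 (const2 l'))) k = Poly_Mapping.lookup 0 k"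
    proof (cases "k = -1")
      case True
      then show ?thesis by (simp add: lookup_M' first_cocycle_const)
    next
      case False
      then have "1 \<noteq> k + 2" "-1 \<noteq> k" by auto
      then show ?thesis by (simp only: lookup_M' lookup_single when_def if_False D_zero lookup_zero)
    qed
  qed
qed

text \<open>Nonzero weights are exact, and in weight 0 the second component of a cocycle is
  determined by the first. So decomposing the single coefficient
  \<open>Poly_Mapping.lookup h 1\<close> decomposes the cocycle.\<close>

lemma Z2_form:
  assumes "M2 h h' = 0" "Poly_Mapping.lookup h 1 = R + D1a 0 g0 g0'"
  shows "\<exists>g g'. h = M1a g g' + Poly_Mapping.single 1 R \<and> h' = M1b g g' + Poly_Mapping.single (-1) (sg (-1) R)"
proof -
  define Q where "Q n f f' \<longleftrightarrow> Poly_Mapping.lookup h (n + 1) = D1a n f f' + (if n = 0 then R else 0) \<and>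
    Poly_Mapping.lookup h' (n - 1) = D1b n f f' + (if n = 0 then sg (-1) R else 0)" for n f f'
  define A where "A = {0} \<union> (\<lambda>k. k - 1) ` Poly_Mapping.keys h \<union> (\<lambda>k. k + 1) ` Poly_Mapping.keys h'"
  have D: "D2 n (Poly_Mapping.lookup h (n + 1)) (Poly_Mapping.lookup h' (n - 1)) = 0" for n
    using lookup_M(5)[of h h' n] assms by simp
  have "\<exists>g g'. \<forall>n. Q n (Poly_Mapping.lookup g (n + -1)) (Poly_Mapping.lookup g' (n + 1))"
  proof (rule choose_wpoly2)
    show "finite A" by (simp add: A_def)
    show "\<exists>f f'. Q n f f'" for n
    proof (cases "n = 0")
      case True
      have "Poly_Mapping.lookup h 1 = sg 1 (Poly_Mapping.lookup h' (-1))"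
        using D[of 0] second_cocycle by simp
      then have "Poly_Mapping.lookup h' (-1) = sg (-1) (Poly_Mapping.lookup h 1)" by simp
      also have "\<dots> = D1b 0 g0 g0' + sg (-1) R"
        unfolding assms(2) by (simp add: sg_add D1_zero)
      finally show ?thesis using assms(2) True by (auto simp: Q_def add.commute)
    next
      case False
      obtain f f' where "D1a n f f' = Poly_Mapping.lookup h (n + 1)" "D1b n f f' = Poly_Mapping.lookup h' (n - 1)"
        using exact2[OF False D] by blast
      then show ?thesis using False by (intro exI[of _ f] exI[of _ f']) (simp add: Q_def)
    qed
    show "Q n 0 0" if "n \<notin> A" for n
    proof -
      have "n \<noteq> 0" "n + 1 \<notin> Poly_Mapping.keys h" "n - 1 \<notin> Poly_Mapping.keys h'"
        using that unfolding A_def by (auto simp: image_iff)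
      then show ?thesis by (simp add: Q_def in_keys_iff)
    qed
  qed
  then obtain g g' where m: "\<And>n. Q n (Poly_Mapping.lookup g (n - 1)) (Poly_Mapping.lookup g' (n + 1))" by auto
  have "h = M1a g g' + Poly_Mapping.single 1 R"
  proof (rule poly_mapping_eqI)
    fix k show "Poly_Mapping.lookup h k = Poly_Mapping.lookup (M1a g g' + Poly_Mapping.single 1 R) k"
      using m[of "k - 1"] by (auto simp: Q_def lookup_M' lookup_add lookup_single when_def split: if_splits)
  qed
  moreover have "h' = M1b g g' + Poly_Mapping.single (-1) (sg (-1) R)"
  proof (rule poly_mapping_eqI)
    fix k show "Poly_Mapping.lookup h' k = Poly_Mapping.lookup (M1b g g' + Poly_Mapping.single (-1) (sg (-1) R)) k"
      using m[of "k + 1"] by (auto simp: Q_def lookup_M' lookup_add lookup_single when_def add.commute split: if_splits)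
  qed
  ultimately show ?thesis by blast
qed

lemma B2_unique:
  assumes "Poly_Mapping.single 1 R = M1a g g'"
  shows "\<exists>G. R = diag pe (cc 0 * G)"
  using arg_cong[OF assms, of "\<lambda>m. Poly_Mapping.lookup m 1"] by (auto simp: lookup_M' D1_zero)

lemma Z2_basis: "M2 (Poly_Mapping.single 1 R) (Poly_Mapping.single (-1) (sg (-1) R)) = 0"
  by (rule poly_mapping_eqI)
    (auto simp: lookup_M lookup_single when_def second_cocycle)

text \<open>By exactness in nonzero weights, only the weight 0 coefficient has to be brought to
  normal form.\<close>

lemma Z3_form:
  assumes "Poly_Mapping.lookup p 0 = R + D2 0 h0 h0'"
  shows "\<exists>h h'. p = M2 h h' + Poly_Mapping.single 0 R"
proof -
  define Q where "Q n f f' \<longleftrightarrow> Poly_Mapping.lookup p n = D2 n f f' + (if n = 0 then R else 0)" for n f f'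
  have "\<exists>h h'. \<forall>n. Q n (Poly_Mapping.lookup h (n + 1)) (Poly_Mapping.lookup h' (n + -1))"
  proof (rule choose_wpoly2)
    show "finite ({0} \<union> Poly_Mapping.keys p)" by simp
    show "\<exists>f f'. Q n f f'" for n
      using assms exact3[of n "Poly_Mapping.lookup p n"]
      by (cases "n = 0") (auto simp: Q_def add.commute dest: sym)
    show "Q n 0 0" if "n \<notin> {0} \<union> Poly_Mapping.keys p" for n
      using that by (simp add: Q_def in_keys_iff)
  qed
  then obtain h h' where m: "\<And>n. Q n (Poly_Mapping.lookup h (n + 1)) (Poly_Mapping.lookup h' (n - 1))" by auto
  have "p = M2 h h' + Poly_Mapping.single 0 R"
  proof (rule poly_mapping_eqI)
    fix k show "Poly_Mapping.lookup p k = Poly_Mapping.lookup (M2 h h' + Poly_Mapping.single 0 R) k"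
      using m[of k] by (auto simp: Q_def lookup_M lookup_add lookup_single when_def split: if_splits)
  qed
  then show ?thesis by blast
qed

lemma B3_unique:
  assumes "Poly_Mapping.single 0 R = M2 h h'"
  shows "\<exists>G. R = diag ke (cc 0 * G)"
  using arg_cong[OF assms, of "\<lambda>m. Poly_Mapping.lookup m 0"] by (auto simp: lookup_M D2_zero)

text \<open>Projecting a normal form to its component of total degree \<open>s\<close> gives a homogeneous one.\<close>

definition hom_part :: "nat \<Rightarrow> 'k poly poly \<Rightarrow> 'k poly poly" where
  "hom_part s = diag (\<lambda>i j. if i + j = s then 1 else 0)"

text \<open>c is homogeneous of degree 1, so the projection passes through it with s lowered by 1; a
  multiple of c has no part of degree 0.\<close>

lemma hp_cc: "\<exists>g'. hom_part s (cc 0 * g) = cc 0 * g'"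
proof (cases s)
  case 0
  have "hom_part s (cc 0 * g) = 0"
    by (rule poly2_eqI) (simp add: hom_part_def 0 cc_def co_lin_mult)
  then show ?thesis by (intro exI[of _ 0]) simp
next
  case (Suc t)
  have "hom_part s (cc 0 * g) = cc 0 * hom_part t g"
    by (rule poly2_eqI) (auto simp: hom_part_def Suc cc_def co_lin_mult)
  then show ?thesis by blast
qed

lemma hp_simps:
  "hom_part s [:q:] = [:Polynomial.monom (coeff q s) s:]" "hom_part s (cc n) = (if s = 1 then cc n else 0)"
  "hom_part s (lu 1 (lin 1 0)) = (if s = 2 then lu 1 (lin 1 0) else 0)"
  "hom_part s (diag e f) = diag e (hom_part s f)" "hom_part s (f + f') = hom_part s f + hom_part s f'" "hom_part s (const2 a * f) = const2 a * hom_part s f"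
  unfolding lu_x by (rule poly2_eqI; auto simp: hom_part_def co_pCons0 cc_def co_lin co_quad algebra_simps)+

text \<open>Diagonal operators commute with the projection, so projecting a normal form keeps its
  shape; \<open>cc (-1)\<close> has degree 1 and survives only for s = 1.\<close>

lemma second_normal_form_hom:
  assumes "hom_part s h = h"
  shows "\<exists>a B g. h = [:Polynomial.monom a s:] + const2 B * cc (-1) + diag pe (cc 0 * g) \<and> (s \<noteq> 1 \<longrightarrow> B = 0)"
proof -
  obtain q B g where h: "h = [:q:] + const2 B * cc (-1) + diag pe (cc 0 * g)"
    using second_normal_form by blast
  obtain g' where g': "hom_part s (cc 0 * g) = cc 0 * g'" using hp_cc by blast
  have "h = hom_part s ([:q:] + const2 B * cc (-1) + diag pe (cc 0 * g))" using h assms by simp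
  also have "\<dots> = [:Polynomial.monom (coeff q s) s:] + const2 (if s = 1 then B else 0) * cc (-1) + diag pe (cc 0 * g')"
    by (simp add: hp_simps g' const2_hom)
  finally show ?thesis by - (rule exI, rule exI, rule exI, rule conjI, assumption, simp)
qed

text \<open>The same projection; now the extra term has degree 2, and a vanishes there because the
  normal form has no x^2 in its polynomial in x.\<close>

lemma third_normal_form_hom:
  assumes "hom_part s p = p"
  shows "\<exists>a B g. p = [:Polynomial.monom a s:] + const2 B * lu 1 (lin 1 0) + diag ke (cc 0 * g) \<and>
    (s \<noteq> 2 \<longrightarrow> B = 0) \<and> (s = 2 \<longrightarrow> a = 0)"
proof -
  obtain q B g where p: "p = [:q:] + const2 B * lu 1 (lin 1 0) + diag ke (cc 0 * g)" "coeff q 2 = 0"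
    using third_normal_form by blast
  obtain g' where g': "hom_part s (cc 0 * g) = cc 0 * g'" using hp_cc by blast
  have "p = hom_part s ([:q:] + const2 B * lu 1 (lin 1 0) + diag ke (cc 0 * g))" using p assms by simp
  also have "\<dots> = [:Polynomial.monom (coeff q s) s:] + const2 (if s = 2 then B else 0) * lu 1 (lin 1 0) + diag ke (cc 0 * g')"
    by (simp add: hp_simps g' const2_hom)
  finally show ?thesis by - (rule exI, rule exI, rule exI, rule conjI, assumption, simp add: p(2))
qed

lemma hmg_hp:
  assumes "homog D m" "D = 2 * int s + \<bar>n\<bar>"
  shows "hom_part s (Poly_Mapping.lookup m n) = Poly_Mapping.lookup m n"
  using assms by (intro poly2_eqI) (fastforce simp: hom_part_def homog_def)

lemma hmg_zero:
  assumes "homog D m" "\<And>s. D \<noteq> 2 * int s + \<bar>n\<bar>"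
  shows "Poly_Mapping.lookup m n = 0"
proof (rule poly2_eqI)
  fix i j
  have "co (Poly_Mapping.lookup m n) i j = 0"
    using assms(1) assms(2)[of "i + j"] unfolding homog_def by (metis of_nat_add)
  then show "co (Poly_Mapping.lookup m n) i j = co 0 i j" by simp
qed

end

lemma (in vector_space) subspace_range:
  fixes f :: "'d::ab_group_add \<Rightarrow> 'b"
  assumes "\<And>x y. f (x + y) = f x + f y" "\<And>c x. scale c (f x) = f (s c x)"
  shows "subspace (range f)"
proof -
  have "f 0 = 0" using assms(1)[of 0 0] by simp
  then have "0 \<in> range f" by (metis rangeI)
  then show ?thesis using assms by (auto simp: subspace_def simp flip: assms(1))
qed

context F1 begin

section \<open>Identification of cochains with normal forms\<close>

definition sc2 :: "'k \<Rightarrow> 'k wpoly \<times> 'k wpoly \<Rightarrow> 'k wpoly \<times> 'k wpoly" where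
  "sc2 c x = (sM c (fst x), sM c (snd x))"

lemma vector_space_sM: "vector_space (sM :: 'k \<Rightarrow> 'k wpoly \<Rightarrow> 'k wpoly)"
  by unfold_locales (simp_all add: sM_simps)

lemma vector_space_sc2: "vector_space sc2"
  by unfold_locales (simp_all add: sc2_def sM_simps prod_eq_iff)

definition Th0 :: "'k wpoly \<Rightarrow> gen list \<Rightarrow> (word \<Rightarrow>\<^sub>0 'k) set" where
  "Th0 m = (\<lambda>W. if W = [] then Gam m else Gam 0)"
definition Th1 :: "'k wpoly \<times> 'k wpoly \<Rightarrow> gen list \<Rightarrow> (word \<Rightarrow>\<^sub>0 'k) set" where
  "Th1 x = (\<lambda>W. if W = [Up] then Gam (fst x) else if W = [Dn] then Gam (snd x) else Gam 0)"
definition Th2 :: "'k wpoly \<times> 'k wpoly \<Rightarrow> gen list \<Rightarrow> (word \<Rightarrow>\<^sub>0 'k) set" where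
  "Th2 x = (\<lambda>W. if W = [Dn, Dn, Up] then Gam (fst x) else if W = [Dn, Up, Up] then Gam (snd x) else Gam 0)"
definition Th3 :: "'k wpoly \<Rightarrow> gen list \<Rightarrow> (word \<Rightarrow>\<^sub>0 'k) set" where
  "Th3 m = (\<lambda>W. if W = [Dn, Dn, Up, Up] then Gam m else Gam 0)"

lemmas Th_def = Th0_def Th1_def Th2_def Th3_def

lemma dual_words_simps: "dual_words 0 = {[]}" "dual_words 1 = {[Dn], [Up]}" "dual_words (Suc 0) = {[Dn], [Up]}"
  "dual_words 2 = {[Dn, Dn, Up], [Dn, Up, Up]}" "dual_words 3 = {[Dn, Dn, Up, Up]}" "dual_words 4 = {}"
  by (simp_all add: dual_words_def)

lemma Th_carrier:
  "carrier (du_cochains \<alpha> \<beta> 0) = range Th0" "carrier (du_cochains \<alpha> \<beta> 1) = range Th1"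
  "carrier (du_cochains \<alpha> \<beta> 2) = range Th2" "carrier (du_cochains \<alpha> \<beta> 3) = range Th3"
proof -
  show "carrier (du_cochains \<alpha> \<beta> 0) = range Th0"
  proof (intro equalityI subsetI)
    fix f assume f: "f \<in> carrier (du_cochains \<alpha> \<beta> 0)"
    then obtain m where "f [] = Gam m" by (auto simp: cochains_def dual_words_simps Gam_ops)
    then have "f = Th0 m" using f by (intro ext) (simp add: Th_def cochains_def dual_words_simps Gam_ops)
    then show "f \<in> range Th0" by blast
  qed (auto simp: Th_def cochains_def dual_words_simps Gam_ops)
  show "carrier (du_cochains \<alpha> \<beta> 1) = range Th1"
  proof (intro equalityI subsetI)
    fix f assume f: "f \<in> carrier (du_cochains \<alpha> \<beta> 1)"
    then obtain m m' where "f [Up] = Gam m" "f [Dn] = Gam m'" by (auto simp: cochains_def dual_words_simps Gam_ops)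
    then have "f = Th1 (m, m')" using f by (intro ext) (simp add: Th_def cochains_def dual_words_simps Gam_ops)
    then show "f \<in> range Th1" by blast
  qed (auto simp: Th_def cochains_def dual_words_simps Gam_ops)
  show "carrier (du_cochains \<alpha> \<beta> 2) = range Th2"
  proof (intro equalityI subsetI)
    fix f assume f: "f \<in> carrier (du_cochains \<alpha> \<beta> 2)"
    then obtain m m' where "f [Dn, Dn, Up] = Gam m" "f [Dn, Up, Up] = Gam m'" by (auto simp: cochains_def dual_words_simps Gam_ops)
    then have "f = Th2 (m, m')" using f by (intro ext) (simp add: Th_def cochains_def dual_words_simps Gam_ops)
    then show "f \<in> range Th2" by blast
  qed (auto simp: Th_def cochains_def dual_words_simps Gam_ops)
  show "carrier (du_cochains \<alpha> \<beta> 3) = range Th3"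
  proof (intro equalityI subsetI)
    fix f assume f: "f \<in> carrier (du_cochains \<alpha> \<beta> 3)"
    then obtain m where "f [Dn, Dn, Up, Up] = Gam m" by (auto simp: cochains_def dual_words_simps Gam_ops)
    then have "f = Th3 m" using f by (intro ext) (simp add: Th_def cochains_def dual_words_simps Gam_ops)
    then show "f \<in> range Th3" by blast
  qed (auto simp: Th_def cochains_def dual_words_simps Gam_ops)
qed

text \<open>All four encodings send 0 to the same constant function, so each of them names the zero
  cochain in every degree, including degree 4, where the last differential takes its value.\<close>

lemma Th_ops:
  "\<zero>\<^bsub>du_cochains \<alpha> \<beta> n\<^esub> = Th0 0" "\<zero>\<^bsub>du_cochains \<alpha> \<beta> n\<^esub> = Th1 0"
  "\<zero>\<^bsub>du_cochains \<alpha> \<beta> n\<^esub> = Th2 0" "\<zero>\<^bsub>du_cochains \<alpha> \<beta> n\<^esub> = Th3 0"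
  "Th0 m \<oplus>\<^bsub>du_cochains \<alpha> \<beta> n\<^esub> Th0 m' = Th0 (m + m')" "Th1 x \<oplus>\<^bsub>du_cochains \<alpha> \<beta> n\<^esub> Th1 x' = Th1 (x + x')"
  "Th2 x \<oplus>\<^bsub>du_cochains \<alpha> \<beta> n\<^esub> Th2 x' = Th2 (x + x')" "Th3 m \<oplus>\<^bsub>du_cochains \<alpha> \<beta> n\<^esub> Th3 m' = Th3 (m + m')"
  "c \<odot>\<^bsub>du_cochains \<alpha> \<beta> n\<^esub> Th0 m = Th0 (sM c m)" "c \<odot>\<^bsub>du_cochains \<alpha> \<beta> n\<^esub> Th1 x = Th1 (sc2 c x)"
  "c \<odot>\<^bsub>du_cochains \<alpha> \<beta> n\<^esub> Th2 x = Th2 (sc2 c x)" "c \<odot>\<^bsub>du_cochains \<alpha> \<beta> n\<^esub> Th3 m = Th3 (sM c m)"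
  by (auto simp: cochains_def Th_def Gam_ops sc2_def sM_simps zero_prod_def split: if_splits intro!: ext)

lemma Th_inj: "inj Th0" "inj Th1" "inj Th2" "inj Th3"
proof -
  show "inj Th0" by (rule injI) (drule fun_cong[of _ _ "[]"], simp add: Th_def Gam_inj)
  show "inj Th3" by (rule injI) (drule fun_cong[of _ _ "[Dn, Dn, Up, Up]"], simp add: Th_def Gam_inj)
  show "inj Th1"
  proof (rule injI)
    fix x y assume "Th1 x = Th1 y"
    then have "Th1 x [Up] = Th1 y [Up]" "Th1 x [Dn] = Th1 y [Dn]" by simp_all
    then show "x = y" by (simp add: Th_def Gam_inj prod_eq_iff)
  qed
  show "inj Th2"
  proof (rule injI)
    fix x y assume "Th2 x = Th2 y"
    then have "Th2 x [Dn, Dn, Up] = Th2 y [Dn, Dn, Up]" "Th2 x [Dn, Up, Up] = Th2 y [Dn, Up, Up]" by simp_all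
    then show "x = y" by (simp add: Th_def Gam_inj prod_eq_iff)
  qed
qed

lemma Th_differential:
  "du_differential \<alpha> \<beta> 0 (Th0 m) = Th1 (M0u m, M0d m)"
  "du_differential \<alpha> \<beta> 1 (Th1 x) = Th2 (M1a (fst x) (snd x), M1b (fst x) (snd x))"
  "du_differential \<alpha> \<beta> 2 (Th2 x) = Th3 (M2 (fst x) (snd x))"
  "du_differential \<alpha> \<beta> 3 f = Th3 0"
  by (auto intro!: ext simp: differential_def diff0_def diff1_def diff2_def gens_cl tensor_def cochains_def Delta_Gam
      gens_mult_Gam Gam_minus Gam_ops Th_def M0u_def M0d_def M2_def)

definition Z0 where "Z0 = {m. M0u m = 0 \<and> M0d m = 0}"
definition Z1 where "Z1 = {x. M1a (fst x) (snd x) = 0 \<and> M1b (fst x) (snd x) = 0}"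
definition Z2 where "Z2 = {x. M2 (fst x) (snd x) = 0}"
definition B1 where "B1 = range (\<lambda>m. (M0u m, M0d m))"
definition B2 where "B2 = range (\<lambda>x. (M1a (fst x) (snd x), M1b (fst x) (snd x)))"
definition B3 where "B3 = range (\<lambda>x. M2 (fst x) (snd x))"

lemma Th_eq_iff: "Th1 x = Th1 y \<longleftrightarrow> x = y" "Th2 x = Th2 y \<longleftrightarrow> x = y" "Th3 m = Th3 m' \<longleftrightarrow> m = m'"
  using Th_inj by (auto dest: injD)

lemma cocycles_eq:
  "cocycles \<alpha> \<beta> 0 = Th0 ` Z0" "cocycles \<alpha> \<beta> 1 = Th1 ` Z1" "cocycles \<alpha> \<beta> 2 = Th2 ` Z2" "cocycles \<alpha> \<beta> 3 = Th3 ` UNIV"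
proof -
  show "cocycles \<alpha> \<beta> 0 = Th0 ` Z0"
    unfolding cocycles_def Th_carrier Th_ops(2) by (auto simp: Th_differential Th_eq_iff Z0_def zero_prod_def)
  show "cocycles \<alpha> \<beta> 1 = Th1 ` Z1"
    unfolding cocycles_def Th_carrier Th_ops(3) by (auto simp: Th_differential Th_eq_iff Z1_def zero_prod_def simp del: One_nat_def)
  show "cocycles \<alpha> \<beta> 2 = Th2 ` Z2"
    unfolding cocycles_def Th_carrier Th_ops(4) by (auto simp: Th_differential Th_eq_iff Z2_def)
  show "cocycles \<alpha> \<beta> 3 = Th3 ` UNIV"
    unfolding cocycles_def Th_carrier Th_ops(4) by (auto simp: Th_differential)
qed

lemma coboundaries_eq:
  "coboundaries \<alpha> \<beta> 0 = Th0 ` {0}" "coboundaries \<alpha> \<beta> 1 = Th1 ` B1" "coboundaries \<alpha> \<beta> 2 = Th2 ` B2" "coboundaries \<alpha> \<beta> 3 = Th3 ` B3"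
proof -
  show "coboundaries \<alpha> \<beta> 0 = Th0 ` {0}"
    by (simp add: coboundaries_def Th_ops(1))
  have "coboundaries \<alpha> \<beta> 1 = du_differential \<alpha> \<beta> 0 ` carrier (du_cochains \<alpha> \<beta> 0)"
    by (simp add: coboundaries_def)
  then show "coboundaries \<alpha> \<beta> 1 = Th1 ` B1"
    by (simp add: Th_carrier B1_def image_image Th_differential)
  have "coboundaries \<alpha> \<beta> 2 = du_differential \<alpha> \<beta> 1 ` carrier (du_cochains \<alpha> \<beta> 1)"
    by (simp add: coboundaries_def numeral_2_eq_2)
  then show "coboundaries \<alpha> \<beta> 2 = Th2 ` B2"
    by (simp only: Th_carrier B2_def image_image Th_differential)
  have "coboundaries \<alpha> \<beta> 3 = du_differential \<alpha> \<beta> 2 ` carrier (du_cochains \<alpha> \<beta> 2)"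
    by (simp add: coboundaries_def numeral_3_eq_3 numeral_2_eq_2)
  then show "coboundaries \<alpha> \<beta> 3 = Th3 ` B3"
    by (simp only: Th_carrier B3_def image_image Th_differential)
qed

lemma M_zero: "M0u 0 = 0" "M0d 0 = 0" "M1a 0 0 = 0" "M1b 0 0 = 0" "M2 0 0 = 0"
  by (simp_all add: M_def Op_hom sM_simps)

lemma subspaces:
  "module.subspace sM Z0" "module.subspace sc2 Z1" "module.subspace sc2 Z2" "module.subspace sM {0 :: 'k wpoly}"
  "module.subspace sc2 B1" "module.subspace sc2 B2" "module.subspace sM B3"
proof -
  interpret M: vector_space "sM :: 'k \<Rightarrow> 'k wpoly \<Rightarrow> 'k wpoly" by (rule vector_space_sM)
  interpret MM: vector_space sc2 by (rule vector_space_sc2)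
  show "M.subspace Z0" "MM.subspace Z1" "MM.subspace Z2" "M.subspace {0 :: 'k wpoly}"
    by (auto simp: M.subspace_def MM.subspace_def Z0_def Z1_def Z2_def sc2_def M_hom M_zero sM_simps)
  show "MM.subspace B1" unfolding B1_def
    by (rule MM.subspace_range[where s = sM]) (simp_all add: M_hom sc2_def)
  show "MM.subspace B2" unfolding B2_def
    by (rule MM.subspace_range[where s = sc2]) (simp_all add: M_hom sc2_def)
  show "M.subspace B3" unfolding B3_def
    by (rule M.subspace_range[where s = sc2]) (simp_all add: M_hom sc2_def)
qed

lemma Z_UNIV_subspace: "module.subspace sM (UNIV :: 'k wpoly set)"
proof -
  interpret M: vector_space "sM :: 'k \<Rightarrow> 'k wpoly \<Rightarrow> 'k wpoly" by (rule vector_space_sM)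
  show ?thesis by (simp add: M.subspace_def)
qed

sublocale H0: quot_transport sM "du_cochains \<alpha> \<beta> 0" Th0 Z0 "{0}"
  using subspaces vector_space_sM Th_carrier Th_ops Th_inj
  by (intro quot_transport.intro quot_transport_axioms.intro) (auto simp: Z0_def M_zero)

sublocale H1: quot_transport sc2 "du_cochains \<alpha> \<beta> 1" Th1 Z1 B1
  using subspaces vector_space_sc2 Th_carrier Th_ops Th_inj
  by (intro quot_transport.intro quot_transport_axioms.intro) (auto simp: Z1_def B1_def M1_M0)

sublocale H2: quot_transport sc2 "du_cochains \<alpha> \<beta> 2" Th2 Z2 B2
  using subspaces vector_space_sc2 Th_carrier Th_ops Th_inj
  by (intro quot_transport.intro quot_transport_axioms.intro) (auto simp: Z2_def B2_def M2_M1)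

sublocale H3: quot_transport sM "du_cochains \<alpha> \<beta> 3" Th3 UNIV B3
  using subspaces Z_UNIV_subspace vector_space_sM Th_carrier Th_ops Th_inj
  by (intro quot_transport.intro quot_transport_axioms.intro) auto

lemma HH_eq: "HH \<alpha> \<beta> 0 = H0.H" "HH \<alpha> \<beta> 1 = H1.H" "HH \<alpha> \<beta> 2 = H2.H" "HH \<alpha> \<beta> 3 = H3.H"
  unfolding HH_def cocycles_eq coboundaries_eq H0.H_def H1.H_def H2.H_def H3.H_def by (rule refl)+

lemma HH_class_eq:
  "HH_class \<alpha> \<beta> 0 = (\<lambda>f. Th0 ` {0} +>\<^bsub>du_cochains \<alpha> \<beta> 0\<^esub> f)" "HH_class \<alpha> \<beta> 1 = (\<lambda>f. Th1 ` B1 +>\<^bsub>du_cochains \<alpha> \<beta> 1\<^esub> f)"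
  "HH_class \<alpha> \<beta> 2 = (\<lambda>f. Th2 ` B2 +>\<^bsub>du_cochains \<alpha> \<beta> 2\<^esub> f)" "HH_class \<alpha> \<beta> 3 = (\<lambda>f. Th3 ` B3 +>\<^bsub>du_cochains \<alpha> \<beta> 3\<^esub> f)"
  by (intro ext; simp only: HH_class_def coboundaries_eq)+

text \<open>The shifts 1, 3 and 4 in this group undo the degrees -1, -3 and -4 of the dual basis
  elements.\<close>

definition Zdeg0 where "Zdeg0 D = {x \<in> Z0. hdeg D x}"
definition Zdeg1 where "Zdeg1 D = {x \<in> Z1. hdeg (D + 1) (fst x) \<and> hdeg (D + 1) (snd x)}"
definition Zdeg2 where "Zdeg2 D = {x \<in> Z2. hdeg (D + 3) (fst x) \<and> hdeg (D + 3) (snd x)}"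
definition Zdeg3 where "Zdeg3 D = {x. hdeg (D + 4) x}"

lemma HH_deg_eq:
  "HH_deg \<alpha> \<beta> 0 D = H0.HW (Zdeg0 D)" "HH_deg \<alpha> \<beta> 1 D = H1.HW (Zdeg1 D)"
  "HH_deg \<alpha> \<beta> 2 D = H2.HW (Zdeg2 D)" "HH_deg \<alpha> \<beta> 3 D = H3.HW (Zdeg3 D)"
proof -
  have 0: "{f \<in> cocycles \<alpha> \<beta> 0. \<forall>W \<in> dual_words 0. f W \<in> du_deg \<alpha> \<beta> (D + int (length W))} = Th0 ` Zdeg0 D"
    unfolding cocycles_eq Zdeg0_def by (auto simp: dual_words_simps Th_def hdeg_def)
  have 1: "{f \<in> cocycles \<alpha> \<beta> 1. \<forall>W \<in> dual_words 1. f W \<in> du_deg \<alpha> \<beta> (D + int (length W))} = Th1 ` Zdeg1 D"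
    unfolding cocycles_eq Zdeg1_def dual_words_simps by (auto simp: Th_def hdeg_def)
  have 2: "{f \<in> cocycles \<alpha> \<beta> 2. \<forall>W \<in> dual_words 2. f W \<in> du_deg \<alpha> \<beta> (D + int (length W))} = Th2 ` Zdeg2 D"
    unfolding cocycles_eq Zdeg2_def dual_words_simps by (auto simp: Th_def hdeg_def)
  have 3: "{f \<in> cocycles \<alpha> \<beta> 3. \<forall>W \<in> dual_words 3. f W \<in> du_deg \<alpha> \<beta> (D + int (length W))} = Th3 ` Zdeg3 D"
    unfolding cocycles_eq Zdeg3_def dual_words_simps by (auto simp: Th_def hdeg_def)
  show "HH_deg \<alpha> \<beta> 0 D = H0.HW (Zdeg0 D)"
    unfolding HH_deg_def 0 H0.HW_def HH_eq HH_class_eq image_image H0.pr_def ..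
  show "HH_deg \<alpha> \<beta> 1 D = H1.HW (Zdeg1 D)"
    unfolding HH_deg_def 1 H1.HW_def HH_eq HH_class_eq image_image H1.pr_def ..
  show "HH_deg \<alpha> \<beta> 2 D = H2.HW (Zdeg2 D)"
    unfolding HH_deg_def 2 H2.HW_def HH_eq HH_class_eq image_image H2.pr_def ..
  show "HH_deg \<alpha> \<beta> 3 D = H3.HW (Zdeg3 D)"
    unfolding HH_deg_def 3 H3.HW_def HH_eq HH_class_eq image_image H3.pr_def ..
qed

lemma W_subspaces: "module.subspace sM (Zdeg0 D)" "module.subspace sc2 (Zdeg1 D)" "module.subspace sc2 (Zdeg2 D)" "module.subspace sM (Zdeg3 D)"
proof -
  show "module.subspace sM (Zdeg0 D)" "module.subspace sM (Zdeg3 D)"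
    using subspaces(1) unfolding H0.subspace_def Zdeg0_def Zdeg3_def
    by (auto simp: hdeg_0 hdeg_add hdeg_sM)
  show "module.subspace sc2 (Zdeg1 D)" "module.subspace sc2 (Zdeg2 D)"
    using subspaces(2,3) unfolding H1.subspace_def Zdeg1_def Zdeg2_def
    by (auto simp: hdeg_0 hdeg_add hdeg_sM sc2_def)
qed

section \<open>Cohomology in degrees zero and one\<close>

lemma Z0_eq: "x \<in> Z0 \<longleftrightarrow> (\<exists>c. x = sM c v0)"
  using Z0_form[of x] by (auto simp: Z0_def M_hom M0_v0 sM_simps)

lemma v0_ne [simp]: "v0 \<noteq> 0"
  by (simp add: v0_def)

lemma v0_nz: "sM c v0 = 0 \<longleftrightarrow> c = 0"
  by simp

lemma hmg_v0: "sM c v0 = 0" if "hdeg D (sM c v0)" "D \<noteq> 0"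
proof -
  have "co (Poly_Mapping.lookup (sM c v0) 0) 0 0 = 0"
    using hdeg_hom[OF that(1)] that(2) unfolding homog_def by fastforce
  then show ?thesis unfolding v0_nz
    by (simp only: lookup_sM v0_def lookup_single_eq mult_1_right co_const2 if_True simp_thms)
qed

lemma HH0_dim: "vectorspace.fin_dim class_ring (HH_deg \<alpha> \<beta> 0 D)" "vectorspace.dim class_ring (HH_deg \<alpha> \<beta> 0 D) = (if D = 0 then 1 else 0)"
proof -
  let ?J = "if D = 0 then {()} else {}"
  have 1: "v0 \<in> Zdeg0 D" if "j \<in> ?J" for j :: unit
    using that by (auto simp: Zdeg0_def Z0_def M0_v0 hdeg_iff split: if_splits intro!: exI[of _ 1] Phi_1)
  have 2: "\<exists>F a. finite F \<and> F \<subseteq> ?J \<and> x - (\<Sum>j\<in>F. sM (a j) v0) \<in> {0}" if x: "x \<in> Zdeg0 D" for x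
  proof -
    obtain c where c: "x = sM c v0" using x by (auto simp: Zdeg0_def Z0_eq)
    then have "c = 0" if "D \<noteq> 0" using x that hmg_v0[of D c] by (auto simp: Zdeg0_def v0_nz)
    then show ?thesis using c by (intro exI[of _ ?J] exI[of _ "\<lambda>_. c"]) (auto simp: sM_simps)
  qed
  have 3: "\<forall>j\<in>F. a j = 0" if "finite F" "F \<subseteq> ?J" "(\<Sum>j\<in>F. sM (a j) v0) \<in> {0}" for F a
  proof
    fix j assume "j \<in> F"
    then have "F = {j}" by auto
    then show "a j = 0" using that(3) by (simp add: v0_nz)
  qed
  note d = H0.dim_HW[where J = ?J and e = "\<lambda>_. v0" and W = "Zdeg0 D", OF _ W_subspaces(1) _ 1 2 3]
  show "vectorspace.fin_dim class_ring (HH_deg \<alpha> \<beta> 0 D)"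
    unfolding HH_deg_eq by (rule d(1)) (auto simp: Zdeg0_def)
  have "vectorspace.dim class_ring (HH_deg \<alpha> \<beta> 0 D) = card ?J"
    unfolding HH_deg_eq by (rule d(2)) (auto simp: Zdeg0_def)
  then show "vectorspace.dim class_ring (HH_deg \<alpha> \<beta> 0 D) = (if D = 0 then 1 else 0)" by simp
qed

lemma HH0_bij: "bij_betw (\<lambda>c. HH_class \<alpha> \<beta> 0 ([] \<parallel>\<^bsub>AA\<^esub> (c \<odot>\<^bsub>AA\<^esub> \<one>\<^bsub>AA\<^esub>))) UNIV (carrier (HH \<alpha> \<beta> 0))"
proof -
  have one: "\<one>\<^bsub>AA\<^esub> = Gam v0" by (simp add: cl_ops cl_eq Phi_1)
  have "[] \<parallel>\<^bsub>AA\<^esub> (c \<odot>\<^bsub>AA\<^esub> \<one>\<^bsub>AA\<^esub>) = Th0 (sM c v0)" for c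
    by (auto simp: tensor_def Th_def Gam_ops one intro!: ext)
  then have "(\<lambda>c. HH_class \<alpha> \<beta> 0 ([] \<parallel>\<^bsub>AA\<^esub> (c \<odot>\<^bsub>AA\<^esub> \<one>\<^bsub>AA\<^esub>))) = (\<lambda>c. H0.pr (sM c v0))"
    by (simp add: HH_class_eq H0.pr_def)
  moreover have "inj (\<lambda>c. H0.pr (sM c v0))"
  proof (rule injI)
    fix a b assume "H0.pr (sM a v0) = H0.pr (sM b v0)"
    then have "sM (a - b) v0 = 0" by (simp add: H0.pr_eq_iff H0.scale_left_diff_distrib)
    then show "a = b" by (simp add: v0_nz)
  qed
  moreover have "range (\<lambda>c. H0.pr (sM c v0)) = carrier (HH \<alpha> \<beta> 0)"
    unfolding HH_eq H0.H_ops by (auto simp: Z0_eq)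
  ultimately show ?thesis by (simp add: bij_betw_def)
qed

definition rep1 :: "bool \<Rightarrow> 'k wpoly \<times> 'k wpoly" where
  "rep1 b = (if b then (0, Poly_Mapping.single 1 1) else (Poly_Mapping.single (-1) 1, 0))"

definition E1 :: "'k \<Rightarrow> 'k \<Rightarrow> 'k wpoly \<times> 'k wpoly" where
  "E1 l l' = (Poly_Mapping.single (-1) (const2 l), Poly_Mapping.single 1 (const2 l'))"

lemma sum_e1b: "(\<Sum>j\<in>F. sc2 (a j) (rep1 j)) = E1 (if False \<in> F then a False else 0) (if True \<in> F then a True else 0)"
proof -
  have "(\<Sum>j\<in>F. sc2 (a j) (rep1 j)) = (\<Sum>j\<in>UNIV. if j \<in> F then sc2 (a j) (rep1 j) else 0)"
    by (simp add: sum.If_cases)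
  also have "\<dots> = E1 (if False \<in> F then a False else 0) (if True \<in> F then a True else 0)"
    by (auto simp: UNIV_bool rep1_def E1_def sc2_def sM_single const2_hom zero_prod_def sM_simps)
  finally show ?thesis .
qed

lemma E1_B1: "E1 l l' \<in> B1 \<Longrightarrow> l = 0 \<and> l' = 0"
  using B1_unique[of l _ l'] by (auto simp: B1_def E1_def)

lemma E1_Z1: "E1 l l' \<in> Z1"
  by (simp add: Z1_def E1_def Z1_basis)

lemma e1b_E1: "rep1 b = (if b then E1 0 1 else E1 1 0)"
  by (simp add: rep1_def E1_def const2_hom)

lemma Z1_E1: "x \<in> Z1 \<Longrightarrow> x - E1 (co (Poly_Mapping.lookup (fst x) (-1)) 0 0) (co (Poly_Mapping.lookup (snd x) 1) 0 0) \<in> B1"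
proof -
  assume "x \<in> Z1"
  then obtain m where m: "fst x = M0u m + Poly_Mapping.single (-1) (const2 (co (Poly_Mapping.lookup (fst x) (-1)) 0 0))"
    "snd x = M0d m + Poly_Mapping.single 1 (const2 (co (Poly_Mapping.lookup (snd x) 1) 0 0))"
    using Z1_form[of "fst x" "snd x"] by (auto simp: Z1_def)
  have "x - E1 (co (Poly_Mapping.lookup (fst x) (-1)) 0 0) (co (Poly_Mapping.lookup (snd x) 1) 0 0) = (M0u m, M0d m)"
    unfolding E1_def prod_eq_iff using m by (simp add: diff_eq_eq)
  then show ?thesis unfolding B1_def by (intro image_eqI[of _ _ m]) simp_all
qed

lemma Phi_gens: "Phi genD = Poly_Mapping.single 1 1" "Phi genU = Poly_Mapping.single (-1) 1"
  using Phi_left[of 1, unfolded mult_1_right Phi_1 v0_def Op_single] by (simp_all add: ops_def)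

lemma e1b_Phi: "rep1 True = (0, Phi genD)" "rep1 False = (Phi genU, 0)"
  by (simp_all add: rep1_def Phi_gens)

lemma indep1: "\<forall>j\<in>F. a j = 0" if "(\<Sum>j\<in>F. sc2 (a j) (rep1 j)) \<in> B1"
  using E1_B1 that unfolding sum_e1b by (metis (full_types))

lemma span1: "\<exists>F a. finite F \<and> F \<subseteq> UNIV \<and> x - (\<Sum>j\<in>F. sc2 (a j) (rep1 j)) \<in> B1" if "x \<in> Z1"
  using Z1_E1[OF that] by (intro exI[of _ UNIV]
    exI[of _ "\<lambda>b. if b then co (Poly_Mapping.lookup (snd x) 1) 0 0 else co (Poly_Mapping.lookup (fst x) (-1)) 0 0"]) (simp add: sum_e1b)

lemma HH1_dim: "vectorspace.fin_dim class_ring (HH_deg \<alpha> \<beta> 1 D)" "vectorspace.dim class_ring (HH_deg \<alpha> \<beta> 1 D) = (if D = 0 then 2 else 0)"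
proof -
  let ?J = "if D = 0 then UNIV else {} :: bool set"
  have 1: "rep1 j \<in> Zdeg1 D" if "j \<in> ?J" for j
  proof -
    have "rep1 j \<in> Z1" by (simp add: e1b_E1 E1_Z1)
    moreover have "D = 0" using that by (simp split: if_splits)
    ultimately show ?thesis
      using e1b_Phi hdeg_iff hw_simps hdeg_0 by (cases j) (auto simp: Zdeg1_def)
  qed
  have 2: "\<exists>F a. finite F \<and> F \<subseteq> ?J \<and> x - (\<Sum>j\<in>F. sc2 (a j) (rep1 j)) \<in> B1" if x: "x \<in> Zdeg1 D" for x
  proof (cases "D = 0")
    case True
    then show ?thesis using span1[of x] x by (simp add: Zdeg1_def)
  next
    case False
    have "homog (D + 1) (fst x)" "homog (D + 1) (snd x)" using x hdeg_hom by (auto simp: Zdeg1_def)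
    then have "co (Poly_Mapping.lookup (fst x) (-1)) 0 0 = 0" "co (Poly_Mapping.lookup (snd x) 1) 0 0 = 0"
      using False unfolding homog_def by fastforce+
    then have "x - E1 0 0 \<in> B1" using Z1_E1[of x] x by (simp add: Zdeg1_def)
    then have "x \<in> B1" by (simp add: E1_def const2_hom flip: zero_prod_def)
    then show ?thesis using False by (intro exI[of _ "{}"]) simp
  qed
  have 3: "\<forall>j\<in>F. a j = 0" if "finite F" "F \<subseteq> ?J" "(\<Sum>j\<in>F. sc2 (a j) (rep1 j)) \<in> B1" for F a
    using indep1 that by blast
  note d = H1.dim_HW[where J = ?J and e = rep1 and W = "Zdeg1 D", OF _ W_subspaces(2) _ 1 2 3]
  show "vectorspace.fin_dim class_ring (HH_deg \<alpha> \<beta> 1 D)"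
    unfolding HH_deg_eq by (rule d(1)) (auto simp: Zdeg1_def)
  have "vectorspace.dim class_ring (HH_deg \<alpha> \<beta> 1 D) = card ?J"
    unfolding HH_deg_eq by (rule d(2)) (auto simp: Zdeg1_def)
  then show "vectorspace.dim class_ring (HH_deg \<alpha> \<beta> 1 D) = (if D = 0 then 2 else 0)" by simp
qed

lemma HH1_basis: "classes_form_basis \<alpha> \<beta> 1 {[Dn] \<parallel>\<^bsub>AA\<^esub> cl genD, [Up] \<parallel>\<^bsub>AA\<^esub> cl genU}"
proof -
  have E: "{[Dn] \<parallel>\<^bsub>AA\<^esub> cl genD, [Up] \<parallel>\<^bsub>AA\<^esub> cl genU} = (\<lambda>j. Th1 (rep1 j)) ` UNIV"
  proof -
    have "[Dn] \<parallel>\<^bsub>AA\<^esub> cl genD = Th1 (rep1 True)" "[Up] \<parallel>\<^bsub>AA\<^esub> cl genU = Th1 (rep1 False)"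
      by (auto simp: e1b_Phi Th_def tensor_def cl_eq Gam_ops split: if_splits intro!: ext)
    then show ?thesis by (auto simp: UNIV_bool)
  qed
  have Z: "rep1 j \<in> Z1" for j by (simp add: e1b_E1 E1_Z1)
  show ?thesis
    unfolding classes_form_basis_def HH_eq HH_class_eq cocycles_eq E
    using H1.basis_H[where J = UNIV and e = rep1, OF Z span1 indep1] Z by auto
qed

section \<open>Cohomology in degrees two and three\<close>

text \<open>Coordinates of \<open>HH\<^sup>2\<close> and \<open>HH\<^sup>3\<close>: a polynomial in \<open>w\<^sub>1\<close>, and the coefficient of the extra class.\<close>

definition eps :: "'k \<Rightarrow> nat option \<Rightarrow> 'k poly \<times> 'k" where
  "eps c j = (case j of Some k \<Rightarrow> (Polynomial.monom c k, 0) | None \<Rightarrow> (0, c))"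

definition kap :: "nat option \<Rightarrow> 'k poly \<times> 'k \<Rightarrow> 'k" where
  "kap j x = (case j of Some k \<Rightarrow> coeff (fst x) k | None \<Rightarrow> snd x)"

lemma kap_eps: "kap j (eps c i) = (if i = j then c else 0)"
  by (auto simp: kap_def eps_def split: option.split)

lemma kap_sum: "kap j (\<Sum>i\<in>F. f i) = (\<Sum>i\<in>F. kap j (f i))"
  by (induction F rule: infinite_finite_induct) (auto simp: kap_def split: option.splits)

lemma kap_sum_eps: "finite F \<Longrightarrow> j \<in> F \<Longrightarrow> kap j (\<Sum>i\<in>F. eps (a i) i) = a j"
  by (simp add: kap_sum kap_eps)

lemma eps_expansion: "(q, b) = (\<Sum>j\<in>insert None (Some ` {..Polynomial.degree q}). eps (kap j (q, b)) j)"
proof -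
  have "(\<Sum>j\<in>Some ` {..Polynomial.degree q}. eps (kap j (q, b)) j) = (\<Sum>k\<le>Polynomial.degree q. (Polynomial.monom (coeff q k) k, 0))"
    by (subst sum.reindex) (simp_all add: eps_def kap_def)
  also have "\<dots> = (\<Sum>k\<le>Polynomial.degree q. Polynomial.monom (coeff q k) k, 0)"
    by (simp add: prod_eq_iff fst_sum snd_sum)
  finally show ?thesis
    by (subst sum.insert) (auto simp: poly_as_sum_of_monoms, simp add: eps_def kap_def)
qed

text \<open>\<open>cc (-1)\<close> is the coefficient of u d^2, since ud = sigma^-1(c); in
  \<open>R3\<close> the corresponding extra term is the coefficient of u w1 d.\<close>

definition R2 where "R2 x = [:fst x:] + const2 (snd x) * cc (-1)"
definition R3 where "R3 x = [:fst x:] + const2 (snd x) * lu 1 (lin 1 0)"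
text \<open>The second component is the one that \<open>second_cocycle\<close> forces.\<close>

definition E2 :: "'k poly \<times> 'k \<Rightarrow> 'k wpoly \<times> 'k wpoly" where
  "E2 x = (Poly_Mapping.single 1 (R2 x), Poly_Mapping.single (-1) (sg (-1) (R2 x)))"
definition E3 :: "'k poly \<times> 'k \<Rightarrow> 'k wpoly" where
  "E3 x = Poly_Mapping.single 0 (R3 x)"

definition rep2 :: "nat option \<Rightarrow> 'k wpoly \<times> 'k wpoly" where "rep2 j = E2 (eps 1 j)"
definition rep3 :: "nat option \<Rightarrow> 'k wpoly" where "rep3 j = E3 (eps 1 j)"

lemma E_add: "E2 (x + y) = E2 x + E2 y" "E3 (x + y) = E3 x + E3 y"
proof -
  have "R2 (x + y) = R2 x + R2 y" "R3 (x + y) = R3 x + R3 y"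
    by (simp_all add: R2_def R3_def const2_hom distrib_right)
  then show "E2 (x + y) = E2 x + E2 y" "E3 (x + y) = E3 x + E3 y"
    by (simp_all add: E2_def E3_def sg_add single_add)
qed

lemma E_0: "E2 0 = 0" "E3 0 = 0"
  by (simp_all add: E2_def E3_def R2_def R3_def const2_hom zero_prod_def)

lemma E_eps: "sc2 c (rep2 j) = E2 (eps c j)" "sM c (rep3 j) = E3 (eps c j)"
proof -
  have "const2 c * R2 (eps 1 j) = R2 (eps c j)" "const2 c * R3 (eps 1 j) = R3 (eps c j)"
    by (cases j; simp add: R2_def R3_def eps_def const2_hom; simp add: const2_def smult_monom)+
  moreover have s: "const2 c * sg (-1) f = sg (-1) (const2 c * f)" for f
    by (simp add: sg_mult)
  ultimately show "sc2 c (rep2 j) = E2 (eps c j)" "sM c (rep3 j) = E3 (eps c j)"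
    by (simp_all add: rep2_def rep3_def E2_def E3_def sc2_def sM_single s)
qed

lemma sum_E: "(\<Sum>j\<in>F. sc2 (a j) (rep2 j)) = E2 (\<Sum>j\<in>F. eps (a j) j)" "(\<Sum>j\<in>F. sM (a j) (rep3 j)) = E3 (\<Sum>j\<in>F. eps (a j) j)"
  by (induction F rule: infinite_finite_induct) (simp_all add: E_0 E_add E_eps)

lemma E2_B2: "E2 x \<in> B2 \<Longrightarrow> x = 0"
  using B2_unique[of "R2 x"] second_unique[of "fst x" "snd x"] by (force simp: B2_def E2_def R2_def prod_eq_iff)

lemma E3_B3: "E3 x \<in> B3 \<Longrightarrow> coeff (fst x) 2 = 0 \<Longrightarrow> x = 0"
  using B3_unique[of "R3 x"] third_unique[of "fst x" "snd x"] by (force simp: B3_def E3_def R3_def prod_eq_iff)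

lemma E2_Z2: "E2 x \<in> Z2"
  by (simp add: Z2_def E2_def Z2_basis)

lemma Z2_E2:
  assumes "x \<in> Z2" "Poly_Mapping.lookup (fst x) 1 = [:q:] + const2 b * cc (-1) + diag pe (cc 0 * g)"
  shows "x - E2 (q, b) \<in> B2"
proof -
  have "Poly_Mapping.lookup (fst x) 1 = R2 (q, b) + D1a 0 0 g" using assms(2) by (simp add: R2_def D1_zero)
  then obtain h h' where "fst x = M1a h h' + Poly_Mapping.single 1 (R2 (q, b))"
    "snd x = M1b h h' + Poly_Mapping.single (-1) (sg (-1) (R2 (q, b)))"
    using Z2_form[of "fst x" "snd x" "R2 (q, b)" 0 g] assms(1) unfolding Z2_def by blast
  then have "x - E2 (q, b) = (M1a h h', M1b h h')" by (simp add: prod_eq_iff E2_def)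
  then show ?thesis unfolding B2_def by (intro image_eqI[of _ _ "(h, h')"]) simp_all
qed

lemma Z3_E3: "x - E3 (q, b) \<in> B3"
  if "Poly_Mapping.lookup x 0 = [:q:] + const2 b * lu 1 (lin 1 0) + diag ke (cc 0 * g)"
proof -
  have "Poly_Mapping.lookup x 0 = R3 (q, b) + D2 0 (- g) 0" using that by (simp add: R3_def D2_zero)
  then obtain h h' where "x = M2 h h' + Poly_Mapping.single 0 (R3 (q, b))"
    using Z3_form by blast
  then have "x - E3 (q, b) = M2 h h'" by (simp add: E3_def)
  then show ?thesis unfolding B3_def by (intro image_eqI[of _ _ "(h, h')"]) simp_all
qed

text \<open>The index of w1^2 is left out because w1^2 is a coboundary: P(c x) is a nonzero multiple
  of x^2.\<close>

definition J3 :: "nat option set" where "J3 = {j. j \<noteq> Some 2}"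

lemma indep2: "\<forall>j\<in>F. a j = 0" if "finite F" "(\<Sum>j\<in>F. sc2 (a j) (rep2 j)) \<in> B2"
proof
  fix j assume "j \<in> F"
  have "(\<Sum>i\<in>F. eps (a i) i) = 0" using E2_B2 that(2) unfolding sum_E by blast
  then show "a j = 0"
    using kap_sum_eps[OF that(1) \<open>j \<in> F\<close>, of a] by (auto simp: kap_def split: option.splits)
qed

lemma indep3: "\<forall>j\<in>F. a j = 0" if "finite F" "F \<subseteq> J3" "(\<Sum>j\<in>F. sM (a j) (rep3 j)) \<in> B3"
proof
  fix j assume "j \<in> F"
  have "kap (Some 2) (\<Sum>i\<in>F. eps (a i) i) = 0"
    using that(2) unfolding kap_sum kap_eps J3_def by (intro sum.neutral) auto
  then have "coeff (fst (\<Sum>i\<in>F. eps (a i) i)) 2 = 0" by (simp add: kap_def)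
  then have "(\<Sum>i\<in>F. eps (a i) i) = 0" using E3_B3 that(3) unfolding sum_E by blast
  then show "a j = 0"
    using kap_sum_eps[OF that(1) \<open>j \<in> F\<close>, of a] by (auto simp: kap_def split: option.splits)
qed

lemma span2: "\<exists>F a. finite F \<and> F \<subseteq> UNIV \<and> x - (\<Sum>j\<in>F. sc2 (a j) (rep2 j)) \<in> B2" if "x \<in> Z2"
proof -
  obtain q b g where "Poly_Mapping.lookup (fst x) 1 = [:q:] + const2 b * cc (-1) + diag pe (cc 0 * g)"
    using second_normal_form by blast
  from Z2_E2[OF that this] show ?thesis
    by (intro exI[of _ "insert None (Some ` {..Polynomial.degree q})"] exI[of _ "\<lambda>j. kap j (q, b)"])
      (simp only: sum_E eps_expansion[symmetric], simp)
qed

lemma span3: "\<exists>F a. finite F \<and> F \<subseteq> J3 \<and> x - (\<Sum>j\<in>F. sM (a j) (rep3 j)) \<in> B3"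
proof -
  obtain q b g where q: "Poly_Mapping.lookup x 0 = [:q:] + const2 b * lu 1 (lin 1 0) + diag ke (cc 0 * g)" "coeff q 2 = 0"
    using third_normal_form by blast
  let ?F = "insert None (Some ` {..Polynomial.degree q})"
  \<comment> \<open>Dropping the index of w1^2 costs nothing, as the normal form has no x^2 term in
    q.\<close>
  have "(\<Sum>j\<in>?F - {Some 2}. eps (kap j (q, b)) j) = (\<Sum>j\<in>?F. eps (kap j (q, b)) j)"
    by (rule sum.mono_neutral_left) (auto simp: kap_def eps_def q(2) zero_prod_def)
  with Z3_E3[OF q(1)] show ?thesis
    by (intro exI[of _ "?F - {Some 2}"] exI[of _ "\<lambda>j. kap j (q, b)"])
      (simp only: sum_E eps_expansion[symmetric], auto simp: J3_def)
qed

lemma e2b_Phi: "rep2 (Some k) = (Phi (w1_elem ^ k * genD), Phi (genU * w1_elem ^ k))"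
  "rep2 None = (Phi (genU * genD * genD), Phi (genU * genU * genD))"
proof -
  show "rep2 (Some k) = (Phi (w1_elem ^ k * genD), Phi (genU * w1_elem ^ k))"
    by (simp add: rep2_def E2_def R2_def eps_def Phi_left Phi_right Phi_W1_pow Op_single ops_def const2_hom)
  note D = Phi_gens(1)
  show "rep2 None = (Phi (genU * genD * genD), Phi (genU * genU * genD))"
    by (simp add: rep2_def E2_def R2_def eps_def Phi_left mult.assoc D Op_single ops_def const2_hom)
qed

lemma e3b_Phi: "rep3 (Some k) = Phi (w1_elem ^ k)" "rep3 None = Phi (genU * w1_elem * genD)"
proof -
  show "rep3 (Some k) = Phi (w1_elem ^ k)"
    by (simp add: rep3_def E3_def R3_def eps_def Phi_W1_pow const2_hom)
  note D = Phi_gens(1)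
  show "rep3 None = Phi (genU * w1_elem * genD)"
    by (simp add: rep3_def E3_def R3_def eps_def Phi_left mult.assoc Phi_W_single[OF D] Op_single const2_hom)
qed

lemma HH2_basis: "classes_form_basis \<alpha> \<beta> 2
   ({([Dn, Dn, Up] \<parallel>\<^bsub>AA\<^esub> (cl w1_elem [^]\<^bsub>AA\<^esub> k \<otimes>\<^bsub>AA\<^esub> cl genD)) \<oplus>\<^bsub>cochains AA 2\<^esub> ([Dn, Up, Up] \<parallel>\<^bsub>AA\<^esub> (cl genU \<otimes>\<^bsub>AA\<^esub> cl w1_elem [^]\<^bsub>AA\<^esub> k)) | k :: nat. True} \<union>
    {([Dn, Dn, Up] \<parallel>\<^bsub>AA\<^esub> (cl genU \<otimes>\<^bsub>AA\<^esub> cl genD \<otimes>\<^bsub>AA\<^esub> cl genD)) \<oplus>\<^bsub>cochains AA 2\<^esub> ([Dn, Up, Up] \<parallel>\<^bsub>AA\<^esub> (cl genU \<otimes>\<^bsub>AA\<^esub> cl genU \<otimes>\<^bsub>AA\<^esub> cl genD))})"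
    (is "classes_form_basis \<alpha> \<beta> 2 ({?f k | k. True} \<union> {?g})")
proof -
  have T: "([Dn, Dn, Up] \<parallel>\<^bsub>AA\<^esub> Gam m) \<oplus>\<^bsub>cochains AA 2\<^esub> ([Dn, Up, Up] \<parallel>\<^bsub>AA\<^esub> Gam m') = Th2 (m, m')" for m m'
    by (auto simp: cochains_def tensor_def Th_def Gam_ops intro!: ext)
  have "?f k = Th2 (rep2 (Some k))" for k
    by (simp add: pow_W1 cl_ops T e2b_Phi) (simp add: cl_eq T)
  moreover have "?g = Th2 (rep2 None)"
    by (simp add: cl_ops e2b_Phi) (simp add: cl_eq T)
  ultimately have E: "{?f k | k. True} \<union> {?g} = (\<lambda>j. Th2 (rep2 j)) ` UNIV"
    by (auto simp: UNIV_option_conv)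
  have Z: "rep2 j \<in> Z2" for j by (simp add: rep2_def E2_Z2)
  show ?thesis
    unfolding classes_form_basis_def HH_eq HH_class_eq cocycles_eq E
    using H2.basis_H[where J = UNIV and e = rep2, OF Z span2 indep2] Z by auto
qed

lemma HH3_basis: "classes_form_basis \<alpha> \<beta> 3
   ({[Dn, Dn, Up, Up] \<parallel>\<^bsub>AA\<^esub> (cl w1_elem [^]\<^bsub>AA\<^esub> j) | j :: nat. j \<noteq> 2} \<union> {[Dn, Dn, Up, Up] \<parallel>\<^bsub>AA\<^esub> (cl genU \<otimes>\<^bsub>AA\<^esub> cl w1_elem \<otimes>\<^bsub>AA\<^esub> cl genD)})"
    (is "classes_form_basis \<alpha> \<beta> 3 ({?f k | k. k \<noteq> 2} \<union> {?g})")
proof -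
  have T: "[Dn, Dn, Up, Up] \<parallel>\<^bsub>AA\<^esub> Gam m = Th3 m" for m
    by (auto simp: tensor_def Th_def Gam_ops intro!: ext)
  have "?f k = Th3 (rep3 (Some k))" for k
    by (simp add: pow_W1 e3b_Phi) (simp add: cl_eq T)
  then have "{?f k | k. k \<noteq> 2} = (\<lambda>k. Th3 (rep3 (Some k))) ` {k. k \<noteq> 2}" by auto
  moreover have "?g = Th3 (rep3 None)"
    by (simp add: cl_ops e3b_Phi) (simp add: cl_eq T)
  moreover have J3_eq: "J3 = insert None (Some ` {k. k \<noteq> 2})"
    unfolding J3_def by (auto simp: image_iff) (metis not_None_eq)
  ultimately have E: "{?f k | k. k \<noteq> 2} \<union> {?g} = (\<lambda>j. Th3 (rep3 j)) ` J3"
    unfolding J3_eq image_insert image_image by simp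
  show ?thesis
    unfolding classes_form_basis_def HH_eq HH_class_eq cocycles_eq E
    using H3.basis_H[where J = J3 and e = rep3, OF UNIV_I span3 indep3] by auto
qed

section \<open>Graded dimensions in degrees two and three\<close>

definition deg2 :: "nat option \<Rightarrow> int" where
  "deg2 j = (case j of Some k \<Rightarrow> 2 * int k - 2 | None \<Rightarrow> 0)"

definition deg3 :: "nat option \<Rightarrow> int" where
  "deg3 j = (case j of Some k \<Rightarrow> 2 * int k - 4 | None \<Rightarrow> 0)"

lemma e2b_deg: "rep2 j \<in> Zdeg2 (deg2 j)"
proof -
  have "rep2 j \<in> Z2" by (simp add: rep2_def E2_Z2)
  moreover have "hdeg (deg2 j + 3) (fst (rep2 j)) \<and> hdeg (deg2 j + 3) (snd (rep2 j))"
  proof (cases j)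
    case None
    have "homog_word (1 + 1 + 1) (genU * genD * genD)" "homog_word (1 + 1 + 1) (genU * genU * genD)"
      by (intro hw_mult hw_simps)+
    then have "hdeg 3 (Phi (genU * genD * genD))" "hdeg 3 (Phi (genU * genU * genD))"
      by (auto simp: hdeg_iff)
    then show ?thesis unfolding None e2b_Phi by (simp add: deg2_def)
  next
    case (Some k)
    have "homog_word (2 * int k + 1) (w1_elem ^ k * genD)" "homog_word (1 + 2 * int k) (genU * w1_elem ^ k)"
      by (intro hw_mult hw_simps hw_W1_pow)+
    then show ?thesis by (auto simp: Some deg2_def e2b_Phi hdeg_iff add.commute)
  qed
  ultimately show ?thesis by (simp add: Zdeg2_def)
qed

lemma e3b_deg: "rep3 j \<in> Zdeg3 (deg3 j)"
proof (cases j)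
  case None
  have "homog_word (1 + 2 * int 1 + 1) (genU * w1_elem ^ 1 * genD)"
    by (intro hw_mult hw_simps hw_W1_pow)
  then show ?thesis by (auto simp: None deg3_def e3b_Phi Zdeg3_def hdeg_iff)
next
  case (Some k)
  then show ?thesis using hw_W1_pow[of k] by (auto simp: deg3_def e3b_Phi Zdeg3_def hdeg_iff)
qed

text \<open>The class depends only on the weight 0 component. For D = 2 s - 2 its coefficient is
  homogeneous of total degree s in x and y; for all other D it is zero.\<close>

lemma span2_hom:
  assumes x: "x \<in> Zdeg2 D"
  shows "\<exists>F a. finite F \<and> F \<subseteq> {j. deg2 j = D} \<and> x - (\<Sum>j\<in>F. sc2 (a j) (rep2 j)) \<in> B2"
proof (cases "\<exists>s. D = 2 * int s - 2")
  case True
  then obtain s where s: "D = 2 * int s - 2" by blast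
  have h: "homog (D + 3) (fst x)" and xZ: "x \<in> Z2" using x hdeg_hom by (auto simp: Zdeg2_def)
  have "hom_part s (Poly_Mapping.lookup (fst x) 1) = Poly_Mapping.lookup (fst x) 1"
    using hmg_hp[OF h, of s 1] s by simp
  then obtain a b g where ab: "Poly_Mapping.lookup (fst x) 1 = [:Polynomial.monom a s:] + const2 b * cc (-1) + diag pe (cc 0 * g)"
    "s \<noteq> 1 \<longrightarrow> b = 0"
    using second_normal_form_hom by blast
  \<comment> \<open>Both w1 d and u d^2 give classes of degree 0, which is the case s = 1.\<close>
  let ?F = "if s = 1 then {Some s, None} else {Some s}"
  have "(\<Sum>j\<in>?F. eps (if j = None then b else a) j) = (Polynomial.monom a s, b)"
    using ab(2) by (auto simp: eps_def)
  with Z2_E2[OF xZ ab(1)] show ?thesis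
    by (intro exI[of _ ?F] exI[of _ "\<lambda>j. if j = None then b else a"])
      (simp only: sum_E, auto simp: deg2_def s)
next
  case False
  have h: "homog (D + 3) (fst x)" and xZ: "x \<in> Z2" using x hdeg_hom by (auto simp: Zdeg2_def)
  have "D + 3 \<noteq> 2 * int s + \<bar>1\<bar>" for s
  proof -
    have "D \<noteq> 2 * int s - 2" using False by blast
    then show ?thesis by simp
  qed
  from hmg_zero[OF h this] have "Poly_Mapping.lookup (fst x) 1 = [:0:] + const2 0 * cc (-1) + diag pe (cc 0 * 0)"
    by (simp add: const2_hom)
  from Z2_E2[OF xZ this] have "x \<in> B2" using E_0(1) by (simp flip: zero_prod_def)
  then show ?thesis by (intro exI[of _ "{}"]) simp
qed

lemma span3_hom:
  assumes x: "x \<in> Zdeg3 D"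
  shows "\<exists>F a. finite F \<and> F \<subseteq> {j \<in> J3. deg3 j = D} \<and> x - (\<Sum>j\<in>F. sM (a j) (rep3 j)) \<in> B3"
proof (cases "\<exists>s. D = 2 * int s - 4")
  case True
  then obtain s where s: "D = 2 * int s - 4" by blast
  have h: "homog (D + 4) x" using x hdeg_hom by (auto simp: Zdeg3_def)
  have "hom_part s (Poly_Mapping.lookup x 0) = Poly_Mapping.lookup x 0"
    using hmg_hp[OF h, of s 0] s by simp
  then obtain a b g where ab: "Poly_Mapping.lookup x 0 = [:Polynomial.monom a s:] + const2 b * lu 1 (lin 1 0) + diag ke (cc 0 * g)"
    "s \<noteq> 2 \<longrightarrow> b = 0" "s = 2 \<longrightarrow> a = 0"
    using third_normal_form_hom by blast
  \<comment> \<open>For s = 2 the class of u w1 d takes the place of the missing w1^2.\<close>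
  let ?F = "if s = 2 then {None} else {Some s}"
  have "(\<Sum>j\<in>?F. eps (if j = None then b else a) j) = (Polynomial.monom a s, b)"
    using ab(2,3) by (auto simp: eps_def)
  with Z3_E3[OF ab(1)] show ?thesis
    by (intro exI[of _ ?F] exI[of _ "\<lambda>j. if j = None then b else a"])
      (simp only: sum_E, auto simp: deg3_def s J3_def)
next
  case False
  have h: "homog (D + 4) x" using x hdeg_hom by (auto simp: Zdeg3_def)
  have "D + 4 \<noteq> 2 * int s + \<bar>0\<bar>" for s
  proof -
    have "D \<noteq> 2 * int s - 4" using False by blast
    then show ?thesis by simp
  qed
  from hmg_zero[OF h this] have "Poly_Mapping.lookup x 0 = [:0:] + const2 0 * lu 1 (lin 1 0) + diag ke (cc 0 * 0)"
    by (simp add: const2_hom)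
  from Z3_E3[OF this] have "x \<in> B3" using E_0 by (simp add: zero_prod_def)
  then show ?thesis by (intro exI[of _ "{}"]) simp
qed

lemma deg2_fibre: "{j. deg2 j = D} = (if D \<ge> -2 \<and> even D then {Some (nat ((D + 2) div 2))} else {}) \<union> (if D = 0 then {None} else {})"
proof (rule Set.set_eqI)
  fix j
  show "j \<in> {j. deg2 j = D} \<longleftrightarrow> j \<in> (if D \<ge> -2 \<and> even D then {Some (nat ((D + 2) div 2))} else {}) \<union> (if D = 0 then {None} else {})"
  proof (cases j)
    case (Some k)
    have "2 * int k - 2 = D \<longleftrightarrow> D \<ge> -2 \<and> even D \<and> k = nat ((D + 2) div 2)" by auto
    then show ?thesis using Some by (auto simp: deg2_def)
  qed (auto simp: deg2_def)
qed

lemma deg3_fibre: "{j \<in> J3. deg3 j = D} = (if D \<ge> -4 \<and> even D \<and> D \<noteq> 0 then {Some (nat ((D + 4) div 2))} else {}) \<union> (if D = 0 then {None} else {})"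
proof (rule Set.set_eqI)
  fix j
  show "j \<in> {j \<in> J3. deg3 j = D} \<longleftrightarrow> j \<in> (if D \<ge> -4 \<and> even D \<and> D \<noteq> 0 then {Some (nat ((D + 4) div 2))} else {}) \<union> (if D = 0 then {None} else {})"
  proof (cases j)
    case (Some k)
    have "k \<noteq> 2 \<and> 2 * int k - 4 = D \<longleftrightarrow> D \<ge> -4 \<and> even D \<and> D \<noteq> 0 \<and> k = nat ((D + 4) div 2)" by auto
    then show ?thesis using Some by (auto simp: deg3_def J3_def)
  qed (auto simp: deg3_def J3_def)
qed

lemma HH2_dim: "vectorspace.fin_dim class_ring (HH_deg \<alpha> \<beta> 2 D)"
  "vectorspace.dim class_ring (HH_deg \<alpha> \<beta> 2 D) = (if D \<ge> -2 \<and> even D then 1 else 0) + (if D = 0 then 1 else 0)"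
proof -
  let ?J = "{j. deg2 j = D}"
  have 1: "rep2 j \<in> Zdeg2 D" if "j \<in> ?J" for j using that e2b_deg[of j] by auto
  have 3: "\<forall>j\<in>F. a j = 0" if "finite F" "F \<subseteq> ?J" "(\<Sum>j\<in>F. sc2 (a j) (rep2 j)) \<in> B2" for F a
    using indep2 that by blast
  have f: "finite ?J" unfolding deg2_fibre by simp
  have W: "Zdeg2 D \<subseteq> Z2" by (auto simp: Zdeg2_def)
  note d = H2.dim_HW[where J = ?J and e = rep2 and W = "Zdeg2 D", OF f W_subspaces(3) W 1 span2_hom 3]
  show "vectorspace.fin_dim class_ring (HH_deg \<alpha> \<beta> 2 D)"
    unfolding HH_deg_eq by (rule d(1))
  have "vectorspace.dim class_ring (HH_deg \<alpha> \<beta> 2 D) = card ?J"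
    unfolding HH_deg_eq by (rule d(2))
  then show "vectorspace.dim class_ring (HH_deg \<alpha> \<beta> 2 D) = (if D \<ge> -2 \<and> even D then 1 else 0) + (if D = 0 then 1 else 0)"
    unfolding deg2_fibre by simp
qed

lemma HH3_dim: "vectorspace.fin_dim class_ring (HH_deg \<alpha> \<beta> 3 D)"
  "vectorspace.dim class_ring (HH_deg \<alpha> \<beta> 3 D) = (if D \<ge> -4 \<and> even D then 1 else 0)"
proof -
  let ?J = "{j \<in> J3. deg3 j = D}"
  have 1: "rep3 j \<in> Zdeg3 D" if "j \<in> ?J" for j using that e3b_deg[of j] by auto
  have 3: "\<forall>j\<in>F. a j = 0" if "finite F" "F \<subseteq> ?J" "(\<Sum>j\<in>F. sM (a j) (rep3 j)) \<in> B3" for F a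
    using indep3 that by blast
  have f: "finite ?J" unfolding deg3_fibre by simp
  note d = H3.dim_HW[where J = ?J and e = rep3 and W = "Zdeg3 D", OF f W_subspaces(4) subset_UNIV 1 span3_hom 3]
  show "vectorspace.fin_dim class_ring (HH_deg \<alpha> \<beta> 3 D)"
    unfolding HH_deg_eq by (rule d(1))
  have "vectorspace.dim class_ring (HH_deg \<alpha> \<beta> 3 D) = card ?J"
    unfolding HH_deg_eq by (rule d(2))
  then show "vectorspace.dim class_ring (HH_deg \<alpha> \<beta> 3 D) = (if D \<ge> -4 \<and> even D then 1 else 0)"
    unfolding deg3_fibre by simp
qed

end

section \<open>Expansion of the rational Hilbert series\<close>

definition geom2 :: "rat fls" where "geom2 = fps_to_fls (Abs_fps (\<lambda>n. if even n then 1 else 0))"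

lemma geom2_nth: "fls_nth geom2 m = (if m \<ge> 0 \<and> even m then 1 else 0)"
  by (auto simp: geom2_def even_nat_iff)

lemma geom2_eq: "(1 - fls_X ^ 2) * geom2 = 1"
  by (rule fls_eqI) (auto simp: left_diff_distrib fls_X_power_times_conv_shift geom2_nth)

lemma one_minus_X2_nz: "1 - fls_X ^ 2 \<noteq> (0 :: rat fls)"
  using geom2_eq by (metis mult_zero_left zero_neq_one)

lemma hilbert2_nth: "fls_nth (1 / fls_X ^ 2 + 2 + fls_X ^ 2 / (1 - fls_X ^ 2)) D
    = (of_nat ((if D \<ge> -2 \<and> even D then 1 else 0) + (if D = 0 then 1 else 0)) :: rat)"
proof -
  have "1 / fls_X ^ 2 = (fls_shift 2 1 :: rat fls)"
    by (simp add: divide_eq_eq fls_X_power_times_conv_shift)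
  moreover have "fls_X ^ 2 / (1 - fls_X ^ 2) = fls_X ^ 2 * geom2"
    using geom2_eq one_minus_X2_nz by (simp add: divide_eq_eq mult.assoc mult.commute[of geom2])
  moreover have "(2 :: rat fls) = 1 + 1" "D + 2 = 0 \<longleftrightarrow> D = -2" by auto
  ultimately show ?thesis
    by (simp only: fls_plus_nth fls_X_power_times_conv_shift fls_shift_nth geom2_nth fls_one_nth) auto
qed

lemma hilbert3_nth: "fls_nth (1 / (fls_X ^ 4 * (1 - fls_X ^ 2))) D
    = (of_nat (if D \<ge> -4 \<and> even D then 1 else 0) :: rat)"
proof -
  have "fls_X ^ 4 * (1 - fls_X ^ 2) * fls_shift 4 geom2 = (1 - fls_X ^ 2) * (fls_X ^ 4 * fls_shift 4 geom2)"
    by (simp add: mult_ac)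
  also have "\<dots> = 1" by (simp add: fls_X_power_times_conv_shift geom2_eq)
  finally have "1 / (fls_X ^ 4 * (1 - fls_X ^ 2)) = fls_shift 4 geom2"
    using one_minus_X2_nz by (simp add: divide_eq_eq mult.commute)
  then show ?thesis by (simp add: geom2_nth)
qed

theorem theorem2p2:
  fixes \<alpha> \<beta> r1 r2 :: "'k::field_char_0"
    and A :: "('k, (word \<Rightarrow>\<^sub>0 'k) set) module" (structure)
    and d u w1 :: "(word \<Rightarrow>\<^sub>0 'k) set"
  assumes F1: "family_F1 \<alpha> \<beta> r1 r2"
    and r1: "r1 \<noteq> 0"
    and A: "A = down_up \<alpha> \<beta>"
    and d: "d = du_d \<alpha> \<beta>"
    and u: "u = du_u \<alpha> \<beta>"
    and w1: "w1 = \<beta> \<odot> (u \<otimes> d) \<oplus> r1 \<odot> (d \<otimes> u)"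
  shows
    "has_hilbert_series (HH_deg \<alpha> \<beta> 0) 1 \<and>
     has_hilbert_series (HH_deg \<alpha> \<beta> 1) 2 \<and>
     has_hilbert_series (HH_deg \<alpha> \<beta> 2) (1 / fls_X ^ 2 + 2 + fls_X ^ 2 / (1 - fls_X ^ 2)) \<and>
     has_hilbert_series (HH_deg \<alpha> \<beta> 3) (1 / (fls_X ^ 4 * (1 - fls_X ^ 2))) \<and>
     bij_betw (\<lambda>c. HH_class \<alpha> \<beta> 0 ([] \<parallel> (c \<odot> \<one>))) UNIV (carrier (HH \<alpha> \<beta> 0)) \<and>
     classes_form_basis \<alpha> \<beta> 1 {[Dn] \<parallel> d, [Up] \<parallel> u} \<and>
     classes_form_basis \<alpha> \<beta> 2
       ({([Dn, Dn, Up] \<parallel> (w1 [^] k \<otimes> d)) \<oplus>\<^bsub>cochains A 2\<^esub> ([Dn, Up, Up] \<parallel> (u \<otimes> w1 [^] k)) | k :: nat. True} \<union>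
        {([Dn, Dn, Up] \<parallel> (u \<otimes> d \<otimes> d)) \<oplus>\<^bsub>cochains A 2\<^esub> ([Dn, Up, Up] \<parallel> (u \<otimes> u \<otimes> d))}) \<and>
     classes_form_basis \<alpha> \<beta> 3
       ({[Dn, Dn, Up, Up] \<parallel> (w1 [^] j) | j :: nat. j \<noteq> 2} \<union> {[Dn, Dn, Up, Up] \<parallel> (u \<otimes> w1 \<otimes> d)})"
proof -
  interpret F1 \<alpha> \<beta> r1 r2 using F1 by unfold_locales
  have du: "d = cl genD" "u = cl genU" by (simp_all add: d u gens_cl)
  have w: "w1 = cl w1_elem" by (simp add: w1 du A w1_cl)
  have two: "fls_nth (2 :: rat fls) D = (if D = 0 then 2 else 0)" for D
  proof -
    have "(2 :: rat fls) = 1 + 1" by simp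
    then show ?thesis by (simp only: fls_plus_nth fls_one_nth) auto
  qed
  show ?thesis
    unfolding A du w
  proof (intro conjI)
    show "has_hilbert_series (HH_deg \<alpha> \<beta> 0) 1"
      using HH0_dim by (simp add: has_hilbert_series_def)
    show "has_hilbert_series (HH_deg \<alpha> \<beta> 1) 2"
      using HH1_dim by (simp add: has_hilbert_series_def two)
    show "has_hilbert_series (HH_deg \<alpha> \<beta> 2) (1 / fls_X ^ 2 + 2 + fls_X ^ 2 / (1 - fls_X ^ 2))"
      unfolding has_hilbert_series_def hilbert2_nth HH2_dim(2) using HH2_dim(1) by blast
    show "has_hilbert_series (HH_deg \<alpha> \<beta> 3) (1 / (fls_X ^ 4 * (1 - fls_X ^ 2)))"
      unfolding has_hilbert_series_def hilbert3_nth HH3_dim(2) using HH3_dim(1) by blast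
  qed (rule HH0_bij HH1_basis HH2_basis HH3_basis)+
qed

end
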